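(* In positive characteristic, every generic parabolic periodic point is isolated as a periodic point. Explicitly: let $p$ be a prime number and let $(k,|\cdot|)$ be an ultrametric field of characteristic $p$. Let $f$ be an analytic map in one variable over $k$ and let $\zeta_0$ be a parabolic periodic point of $f$ of minimal period $n\ge 1$, that is, $(f^n)'(\zeta_0)$ is a root of unity. Suppose that $\zeta_0$ is generic, the genericity condition being that the power series $F(\zeta):=f^n(\zeta+\zeta_0)-\zeta_0\in k[[\zeta]]$ is minimally ramified. Then $\zeta_0$ is isolated as a periodic point: there is a neighborhood of $\zeta_0$ that contains no periodic point of $f$ other than $\zeta_0$. Moreover, the condition of being minimally ramified is indeed generic among parabolic power series with a prescribed multiplier, in the following sense: if $\gamma$ is a root of unity in $k$, $q$ is its order, and $F_0$ is the prime field of $k$, then there is a nonzero polynomial $M_q(x_1,\ldots,x_{2q})$ with coefficients in $F_0(\gamma)$ such that a power series in $k[[\zeta]]$ of the form $\gamma\zeta\left(1+\sum_{i=1}^{+\infty}c_i\zeta^i\right)$ is minimally ramified if and only if $M_q(c_1,\ldots,c_{2q})\neq 0$.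
   Context: Powers of maps or power series denote iterates under composition. An analytic map over $k$ is given near each point of its domain by a convergent power series with coefficients in $k$. A point $\zeta$ is periodic for $f$ if $f^m(\zeta)=\zeta$ for some integer $m\ge 1$; the least such $m$ is its minimal period. For a nonzero power series in $k[[\zeta]]$, $\operatorname{ord}$ denotes the lowest degree of its nonzero terms, and $\operatorname{ord}(0)=+\infty$. For $g(\zeta)\in k[[\zeta]]$ with $g(0)=0$ and $g'(0)=1$, and each integer $m\ge 0$, put $$ i_m(g) := \operatorname{ord}\left(\frac{g^{p^m}(\zeta)-\zeta}{\zeta}\right). $$ A power series $F(\zeta)\in k[[\zeta]]$ is parabolic if $F(0)=0$ and $F'(0)$ is a root of unity; $F'(0)$ is its multiplier. If $q$ is the order of $F'(0)$, then $F^q(0)=0$ and $(F^q)'(0)=1$, and for every integer $m\ge 0$ one has $i_m(F^q)\ge q\,\frac{p^{m+1}-1}{p-1}$. The series $F$ is called minimally ramified if equality holds for every integer $m\ge 0$. *)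

theory Defs
  imports
    Complex_Main
    "HOL-Library.Extended_Nat"
    "HOL-Library.Poly_Mapping"
    "HOL-Computational_Algebra.Computational_Algebra"
begin

section \<open>Ultrametric fields and analytic maps\<close>

text \<open>Neither completeness nor nontriviality of the absolute value is required.\<close>

locale ultrametric_field =
  fixes absv :: "'k::field \<Rightarrow> real"
  assumes absv_nonneg: "0 \<le> absv x"
    and absv_eq_0_iff: "absv x = 0 \<longleftrightarrow> x = 0"
    and absv_mult: "absv (x * y) = absv x * absv y"
    and absv_ultrametric: "absv (x + y) \<le> max (absv x) (absv y)"

definition absv_sums :: "('k::field \<Rightarrow> real) \<Rightarrow> (nat \<Rightarrow> 'k) \<Rightarrow> 'k \<Rightarrow> bool" where
  "absv_sums absv a s \<longleftrightarrow> (\<lambda>N. absv ((\<Sum>i<N. a i) - s)) \<longlonglongrightarrow> 0"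

definition has_expansion_at_0 :: "('k::field \<Rightarrow> real) \<Rightarrow> ('k \<Rightarrow> 'k) \<Rightarrow> 'k fps \<Rightarrow> bool" where
  "has_expansion_at_0 absv g F \<longleftrightarrow>
     (\<exists>r>0. \<forall>x. absv x < r \<longrightarrow> absv_sums absv (\<lambda>i. fps_nth F i * x ^ i) (g x))"

text \<open>
  A map with domain \<open>U\<close> is a total function \<open>f\<close> whose values outside \<open>U\<close> are irrelevant.
\<close>

definition analytic_map :: "('k::field \<Rightarrow> real) \<Rightarrow> 'k set \<Rightarrow> ('k \<Rightarrow> 'k) \<Rightarrow> bool" where
  "analytic_map absv U f \<longleftrightarrow>
     (\<forall>a\<in>U. (\<exists>r>0. \<forall>x. absv (x - a) < r \<longrightarrow> x \<in> U) \<and>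
             (\<exists>F. has_expansion_at_0 absv (\<lambda>x. f (a + x)) F))"


section \<open>Periodic points\<close>

text \<open>The orbit has to stay in the domain \<open>U\<close> for the iterate to be defined.\<close>

definition fixed_by_iterate :: "'k set \<Rightarrow> ('k \<Rightarrow> 'k) \<Rightarrow> nat \<Rightarrow> 'k \<Rightarrow> bool" where
  "fixed_by_iterate U f m z \<longleftrightarrow> (\<forall>j<m. (f ^^ j) z \<in> U) \<and> (f ^^ m) z = z"

definition periodic_point :: "'k set \<Rightarrow> ('k \<Rightarrow> 'k) \<Rightarrow> 'k \<Rightarrow> bool" where
  "periodic_point U f z \<longleftrightarrow> (\<exists>m\<ge>1. fixed_by_iterate U f m z)"

definition minimal_period :: "'k set \<Rightarrow> ('k \<Rightarrow> 'k) \<Rightarrow> 'k \<Rightarrow> nat" where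
  "minimal_period U f z = (LEAST m. 1 \<le> m \<and> fixed_by_iterate U f m z)"

definition isolated_periodic_point ::
    "('k::field \<Rightarrow> real) \<Rightarrow> 'k set \<Rightarrow> ('k \<Rightarrow> 'k) \<Rightarrow> 'k \<Rightarrow> bool" where
  "isolated_periodic_point absv U f z0 \<longleftrightarrow>
     periodic_point U f z0 \<and>
     (\<exists>r>0. \<forall>z. absv (z - z0) < r \<and> periodic_point U f z \<longrightarrow> z = z0)"


section \<open>Minimally ramified power series\<close>

definition root_of_unity :: "'k::field \<Rightarrow> bool" where
  "root_of_unity a \<longleftrightarrow> (\<exists>n\<ge>1. a ^ n = 1)"

definition unity_order :: "'k::field \<Rightarrow> nat" where
  "unity_order a = (LEAST n. 1 \<le> n \<and> a ^ n = 1)"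

definition fps_ord :: "'k::field fps \<Rightarrow> enat" where
  "fps_ord g = (if g = 0 then \<infinity> else enat (subdegree g))"

definition fps_iterate :: "'k::field fps \<Rightarrow> nat \<Rightarrow> 'k fps" where
  "fps_iterate g m = ((\<lambda>h. g oo h) ^^ m) fps_X"

definition ramification_number :: "nat \<Rightarrow> 'k::field fps \<Rightarrow> nat \<Rightarrow> enat" where
  "ramification_number p g m = fps_ord ((fps_iterate g (p ^ m) - fps_X) / fps_X)"

definition multiplier :: "'k::field fps \<Rightarrow> 'k" where
  "multiplier F = fps_nth (fps_deriv F) 0"

definition parabolic :: "'k::field fps \<Rightarrow> bool" where
  "parabolic F \<longleftrightarrow> fps_nth F 0 = 0 \<and> root_of_unity (multiplier F)"

definition minimally_ramified :: "nat \<Rightarrow> 'k::field fps \<Rightarrow> bool" where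
  "minimally_ramified p F \<longleftrightarrow>
     parabolic F \<and>
     (let q = unity_order (multiplier F) in
      \<forall>m. ramification_number p (fps_iterate F q) m =
            enat (q * ((p ^ (m + 1) - 1) div (p - 1))))"


section \<open>Generated subfields and multivariate polynomials\<close>

definition is_subfield :: "'k::field set \<Rightarrow> bool" where
  "is_subfield K \<longleftrightarrow>
     0 \<in> K \<and> 1 \<in> K \<and>
     (\<forall>x\<in>K. \<forall>y\<in>K. x + y \<in> K \<and> x * y \<in> K) \<and>
     (\<forall>x\<in>K. - x \<in> K \<and> inverse x \<in> K)"

definition prime_field :: "'k::field set" where
  "prime_field = is_subfield hull {}"

definition adjoin :: "'k::field set \<Rightarrow> 'k \<Rightarrow> 'k set" where
  "adjoin K a = is_subfield hull (insert a K)"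

text \<open>
  A monomial is a finitely supported family of exponents, indexed by the numbers of the
  variables; a polynomial is a finitely supported family of coefficients, indexed by the
  monomials.
\<close>

type_synonym 'k multipoly = "(nat \<Rightarrow>\<^sub>0 nat) \<Rightarrow>\<^sub>0 'k"

definition multipoly_over :: "'k::field set \<Rightarrow> nat set \<Rightarrow> 'k multipoly set" where
  "multipoly_over K I =
     {M. (\<forall>e. Poly_Mapping.lookup M e \<in> K) \<and> (\<forall>e\<in>Poly_Mapping.keys M. Poly_Mapping.keys e \<subseteq> I)}"

definition multipoly_eval :: "'k::field multipoly \<Rightarrow> (nat \<Rightarrow> 'k) \<Rightarrow> 'k" where
  "multipoly_eval M x = (\<Sum>e\<in>Poly_Mapping.keys M. Poly_Mapping.lookup M e * (\<Prod>i\<in>Poly_Mapping.keys e. x i ^ Poly_Mapping.lookup e i))"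

end

theory Submission
  imports Defs "HOL-Number_Theory.Cong"
begin

text \<open>
  Write \<open>T \<phi> = \<phi> \<circ> g\<close> and \<open>g = X + \<Delta>\<close>.  In characteristic \<open>p\<close> the \<open>p\<close>-th iterate of \<open>g\<close> is
  \<open>X + (T - 1) ^ (p - 1) \<Delta>\<close>, and \<open>T - 1\<close> agrees with the derivation \<open>D = \<Delta> d/dX\<close> up to terms
  quadratic in \<open>\<Delta>\<close>.  Since \<open>D ^ p\<close> is a derivation commuting with \<open>D\<close>, one has \<open>D ^ p = c D\<close> with
  \<open>c' = 0\<close>.  So, up to small errors, passing to the \<open>p\<close>-th iterate replaces \<open>\<Delta>\<close> by \<open>c \<Delta>\<close> and \<open>c\<close> by
  \<open>c ^ p\<close>; once \<open>\<Delta>\<close> and \<open>c\<close> have a dominant monomial on a disc, this persists for all iterates on the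
  same disc, so none of them has a nonzero fixed point there.

  For the genericity, a conjugacy whose coefficients are polynomials in those of the series brings it to the form
  \<open>\<gamma> X (1 + \<alpha> X ^ q + \<beta> X ^ (2 q) + \<dots>)\<close>.  In the coordinate \<open>t = X ^ (- q)\<close> its \<open>q\<close>-th iterate is
  \<open>t \<mapsto> t - A + \<rho> / t + \<dots>\<close>, and iterated differences of this map give the first three ramification
  numbers: they are minimal if and only if \<open>A\<close>, \<open>\<rho>\<close> and \<open>(p choose 2) A\<^sup>2 + \<rho>\<close> do not vanish.  The last
  factor matters only for \<open>p = 2\<close>.
\<close>

section \<open>Iterates and the difference operator\<close>

text \<open>The obstacle to isolation is uniformity: for each m separately, nonzero fixed points of
  the m-th iterate stay away from 0, but the radius of the punctured disc could shrink with m. A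
  period is split as m = p^e M with p not dividing M. Up to terms quadratic in \<Delta>, an M-th
  iterate multiplies the displacement by M, an element of absolute value 1, so only the exponents
  p^e need control. Along these the size G of \<Delta> (relative to the radius) and the size K of c
  evolve by G -> K G and K -> K^p. The errors stay negligible while G^(2p-1) is smaller than K^2,
  and the recursion preserves this inequality. Applied to orders of vanishing, the same mechanism
  shows that once the inequality holds at one level, the orders of all later iterates are forced.
  This turns minimal ramification, a condition on infinitely many iterates, into one on the first
  three ramification numbers. These see the series only modulo X^(2q+2), which is where the number
  2q of variables comes from.\<close>

lemma fps_iterate_0 [simp]: "fps_iterate g 0 = fps_X"
  by (simp add: fps_iterate_def)

lemma fps_iterate_Suc: "fps_iterate g (Suc m) = g oo fps_iterate g m"
  by (simp add: fps_iterate_def)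

lemma fps_iterate_nth_0:
  fixes g :: "'k::field fps"
  assumes "g $ 0 = 0"
  shows "fps_iterate g m $ 0 = 0"
  using assms by (cases m) (simp_all add: fps_iterate_Suc)

lemma fps_iterate_1:
  fixes g :: "'k::field fps"
  shows "fps_iterate g (Suc 0) = g"
  by (simp add: fps_iterate_Suc)

lemma fps_iterate_add:
  fixes g :: "'k::field fps"
  assumes "g $ 0 = 0"
  shows "fps_iterate g (m + n) = fps_iterate g m oo fps_iterate g n"
  by (induction m)
    (use assms in \<open>simp_all add: fps_iterate_Suc fps_compose_assoc fps_iterate_nth_0\<close>)

lemma fps_iterate_Suc2:
  fixes g :: "'k::field fps"
  assumes "g $ 0 = 0"
  shows "fps_iterate g (Suc m) = fps_iterate g m oo g"
  using fps_iterate_add[OF assms, of m "Suc 0"] by (simp add: fps_iterate_1)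

lemma fps_iterate_mult:
  fixes g :: "'k::field fps"
  assumes "g $ 0 = 0"
  shows "fps_iterate g (m * n) = fps_iterate (fps_iterate g m) n"
proof (induction n)
  case (Suc n)
  have "fps_iterate g (m * Suc n) = fps_iterate g (m + m * n)"
    by simp
  with Suc show ?case
    by (simp only: fps_iterate_add[OF assms] fps_iterate_Suc)
qed simp

lemma fps_compose_nth_1:
  fixes a b :: "'k::field fps"
  assumes "b $ 0 = 0"
  shows "(a oo b) $ 1 = a $ 1 * b $ 1"
  using assms by (simp add: fps_compose_nth)

lemma fps_iterate_nth_1:
  fixes g :: "'k::field fps"
  assumes "g $ 0 = 0"
  shows "fps_iterate g m $ 1 = (g $ 1) ^ m"
proof (induction m)
  case (Suc m)
  then show ?case
    using assms fps_iterate_nth_0[OF assms, of m]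
    by (simp only: fps_iterate_Suc fps_compose_nth_1) simp
qed simp

section \<open>The difference operator of a substitution\<close>

definition diff_op :: "'k::field fps \<Rightarrow> 'k fps \<Rightarrow> 'k fps" where
  "diff_op g \<phi> = (\<phi> oo g) - \<phi>"

lemma diff_op_add: "diff_op g (\<phi> + \<psi>) = diff_op g \<phi> + diff_op g \<psi>"
  by (simp add: diff_op_def fps_compose_add_distrib)

lemma diff_op_diff: "diff_op g (\<phi> - \<psi>) = diff_op g \<phi> - diff_op g \<psi>"
  by (simp add: diff_op_def fps_compose_sub_distrib)

lemma diff_op_const [simp]: "diff_op g (fps_const c) = 0"
  by (simp add: diff_op_def)

text \<open>Substituting \<open>g\<close> is the operator 1 + N with N = \<open>diff_op g\<close>,
  and the sum of its powers below n is ((1 + N)^n - 1) / N. Induction with Pascal's rule avoids the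
  division by N.\<close>

lemma sum_compose_iterates_eq_binomial_sum:
  fixes g :: "'k::field fps"
  assumes g: "g $ 0 = 0"
  shows "(\<Sum>j<n. \<phi> oo fps_iterate g j) = (\<Sum>k<n. of_nat (n choose Suc k) * (diff_op g ^^ k) \<phi>)"
proof (induction n)
  case (Suc n)
  let ?d = "\<lambda>k. (diff_op g ^^ k) \<phi>"
  have T: "(?d k) oo g = ?d (Suc k) + ?d k" for k
    by (simp add: diff_op_def)
  have "(\<Sum>j<Suc n. \<phi> oo fps_iterate g j) = \<phi> + (\<Sum>j<n. \<phi> oo fps_iterate g (Suc j))"
    unfolding sum.lessThan_Suc_shift by simp
  also have "(\<Sum>j<n. \<phi> oo fps_iterate g (Suc j)) = (\<Sum>j<n. \<phi> oo fps_iterate g j) oo g"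
    by (simp add: fps_iterate_Suc2[OF g] fps_compose_assoc fps_iterate_nth_0 g
        fps_compose_sum_distrib)
  also have "\<dots> = (\<Sum>k<n. of_nat (n choose Suc k) * (?d (Suc k) + ?d k))"
    unfolding Suc
    by (simp add: fps_compose_sum_distrib fps_compose_mult_distrib[OF g] T
        flip: fps_of_nat del: funpow.simps)
  also have "\<phi> + \<dots> = (\<Sum>k<Suc n. of_nat (Suc n choose Suc k) * ?d k)"
  proof -
    have "(\<Sum>k<n. of_nat (n choose Suc k) * ?d (Suc k)) + \<phi> = (\<Sum>k<Suc n. of_nat (n choose k) * ?d k)"
      unfolding sum.lessThan_Suc_shift by simp
    moreover have "(\<Sum>k<n. of_nat (n choose Suc k) * ?d k) = (\<Sum>k<Suc n. of_nat (n choose Suc k) * ?d k)"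
      by (simp add: binomial_eq_0)
    ultimately show ?thesis
      by (simp add: distrib_left distrib_right sum.distrib algebra_simps del: funpow.simps sum.lessThan_Suc)
  qed
  finally show ?case .
qed simp

text \<open>In characteristic p the only binomial coefficient of the preceding sum that survives is
  (p choose p).\<close>

lemma sum_compose_iterates_eq_diff_op:
  fixes g :: "'k::field fps"
  assumes g: "g $ 0 = 0" and p: "prime p" "CHAR('k) = p"
  shows "(\<Sum>j<p. \<phi> oo fps_iterate g j) = (diff_op g ^^ (p - 1)) \<phi>"
proof -
  have "p > 0" using p(1) by (rule prime_gt_0_nat)
  have "(of_nat (p choose Suc k) :: 'k fps) = 0" if "k \<in> {..<p} - {p - 1}" for k
  proof -
    have "p dvd p choose Suc k"
      by (rule dvd_choose_prime) (use that p in auto)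
    then show ?thesis
      by (simp add: of_nat_eq_0_iff_char_dvd p(2))
  qed
  then have "(\<Sum>k<p. of_nat (p choose Suc k) * (diff_op g ^^ k) \<phi>)
      = (\<Sum>k\<in>{p - 1}. of_nat (p choose Suc k) * (diff_op g ^^ k) \<phi>)"
    using \<open>p > 0\<close> by (intro sum.mono_neutral_right) auto
  also have "\<dots> = (diff_op g ^^ (p - 1)) \<phi>"
    using \<open>p > 0\<close> by simp
  finally show ?thesis
    by (simp add: sum_compose_iterates_eq_binomial_sum[OF g])
qed

lemma fps_iterate_minus_X_eq_sum:
  fixes g :: "'k::field fps"
  assumes "g $ 0 = 0"
  shows "fps_iterate g n - fps_X = (\<Sum>j<n. (g - fps_X) oo fps_iterate g j)"
proof (induction n)
  case (Suc n)
  show ?case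
    using Suc by (simp add: fps_iterate_Suc fps_compose_sub_distrib fps_iterate_nth_0 assms
        algebra_simps)
qed simp

lemma fps_iterate_prime_minus_X:
  fixes g :: "'k::field fps"
  assumes "g $ 0 = 0" "prime p" "CHAR('k) = p"
  shows "fps_iterate g p - fps_X = (diff_op g ^^ (p - 1)) (g - fps_X)"
  by (simp only: fps_iterate_minus_X_eq_sum[OF assms(1)] sum_compose_iterates_eq_diff_op[OF assms])

subsection \<open>Formal vector fields\<close>

definition vec_op :: "'k::field fps \<Rightarrow> 'k fps \<Rightarrow> 'k fps" where
  "vec_op \<Delta> \<phi> = \<Delta> * fps_deriv \<phi>"

lemma vec_op_add: "vec_op \<Delta> (\<phi> + \<psi>) = vec_op \<Delta> \<phi> + vec_op \<Delta> \<psi>"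
  by (simp add: vec_op_def algebra_simps)

lemma vec_op_diff: "vec_op \<Delta> (\<phi> - \<psi>) = vec_op \<Delta> \<phi> - vec_op \<Delta> \<psi>"
  by (simp add: vec_op_def algebra_simps)

lemma vec_op_diff_left: "vec_op (\<Delta> - \<gamma>) \<phi> = vec_op \<Delta> \<phi> - vec_op \<gamma> \<phi>"
  by (simp add: vec_op_def algebra_simps)

lemma funpow_vec_op_add:
  "(vec_op \<Delta> ^^ n) (\<phi> + \<psi>) = (vec_op \<Delta> ^^ n) \<phi> + (vec_op \<Delta> ^^ n) \<psi>"
  by (induction n) (simp_all add: vec_op_add)

lemma funpow_vec_op_mult:
  "(vec_op \<Delta> ^^ n) (\<phi> * \<psi>) =
     (\<Sum>k\<le>n. of_nat (n choose k) * (vec_op \<Delta> ^^ k) \<phi> * (vec_op \<Delta> ^^ (n - k)) \<psi>)"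
proof (induction n)
  case (Suc n)
  let ?D = "\<lambda>k. vec_op \<Delta> ^^ k"
  have vsum: "vec_op \<Delta> (sum f A) = (\<Sum>k\<in>A. vec_op \<Delta> (f k))" for f :: "nat \<Rightarrow> 'a fps" and A
    by (simp add: vec_op_def fps_deriv_sum sum_distrib_left)
  have vnat: "vec_op \<Delta> (of_nat m * a * b) = of_nat m * a * vec_op \<Delta> b + of_nat m * vec_op \<Delta> a * b"
    for m a b
    by (simp add: vec_op_def algebra_simps)
  have "?D (Suc n) (\<phi> * \<psi>) =
      (\<Sum>k\<le>n. of_nat (n choose k) * ?D k \<phi> * ?D (Suc n - k) \<psi>)
      + (\<Sum>k\<le>n. of_nat (n choose k) * ?D (Suc k) \<phi> * ?D (n - k) \<psi>)"
    by (simp add: Suc vsum vnat sum.distrib Suc_diff_le)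
  also have "(\<Sum>k\<le>n. of_nat (n choose k) * ?D k \<phi> * ?D (Suc n - k) \<psi>)
      = (\<Sum>k\<le>Suc n. of_nat (n choose k) * ?D k \<phi> * ?D (Suc n - k) \<psi>)"
    by (simp add: binomial_eq_0)
  also have "\<dots> = \<phi> * ?D (Suc n) \<psi> + (\<Sum>k\<le>n. of_nat (n choose Suc k) * ?D (Suc k) \<phi> * ?D (n - k) \<psi>)"
    unfolding sum.atMost_Suc_shift by (simp del: sum.atMost_Suc)
  also have "\<dots> + (\<Sum>k\<le>n. of_nat (n choose k) * ?D (Suc k) \<phi> * ?D (n - k) \<psi>)
     = (\<Sum>k\<le>Suc n. of_nat (Suc n choose k) * ?D k \<phi> * ?D (Suc n - k) \<psi>)"
    unfolding sum.atMost_Suc_shift by (simp add: sum.distrib algebra_simps del: funpow.simps sum.atMost_Suc)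
  finally show ?case .
qed simp

lemma funpow_vec_op_mult_prime:
  fixes \<Delta> :: "'k::field fps"
  assumes p: "prime p" "CHAR('k) = p"
  shows "(vec_op \<Delta> ^^ p) (\<phi> * \<psi>) = \<phi> * (vec_op \<Delta> ^^ p) \<psi> + (vec_op \<Delta> ^^ p) \<phi> * \<psi>"
proof -
  have "p > 0" using p(1) by (rule prime_gt_0_nat)
  have "(of_nat (p choose k) :: 'k fps) = 0" if "k \<in> {..p} - {0, p}" for k
  proof -
    have "p dvd p choose k"
      by (rule dvd_choose_prime) (use that p in auto)
    then show ?thesis
      by (simp add: of_nat_eq_0_iff_char_dvd p(2))
  qed
  then have "(vec_op \<Delta> ^^ p) (\<phi> * \<psi>) =
     (\<Sum>k\<in>{0,p}. of_nat (p choose k) * (vec_op \<Delta> ^^ k) \<phi> * (vec_op \<Delta> ^^ (p - k)) \<psi>)"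
    unfolding funpow_vec_op_mult by (intro sum.mono_neutral_right) auto
  then show ?thesis
    using \<open>p > 0\<close> by simp
qed

lemma fps_decompose_shift: "(\<phi> :: 'k::field fps) = fps_const (\<phi> $ 0) + fps_X * fps_shift 1 \<phi>"
  by (rule fps_ext) (simp add: fps_X_mult_nth)

text \<open>The \<open>p\<close>-th power of a derivation is again a derivation, hence determined by its value at \<open>fps_X\<close>.\<close>

lemma funpow_vec_op_prime:
  fixes \<Delta> :: "'k::field fps"
  assumes p: "prime p" "CHAR('k) = p"
  shows "(vec_op \<Delta> ^^ p) \<phi> = (vec_op \<Delta> ^^ (p - 1)) \<Delta> * fps_deriv \<phi>"
proof -
  have "p > 0" using p(1) by (rule prime_gt_0_nat)
  let ?h = "(vec_op \<Delta> ^^ (p - 1)) \<Delta>"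
  \<comment> \<open>Both terms are derivations with the same value at \<open>fps_X\<close>, so
    \<open>E\<close> is a derivation that kills X and the constants. Splitting off the constant term
    gives E \<phi> = X E(\<phi>') with \<phi>' the shifted series; repeating this pushes the order
    of E \<phi> beyond every degree, which replaces a continuity argument.\<close>
  define E where "E \<phi> = (vec_op \<Delta> ^^ p) \<phi> - ?h * fps_deriv \<phi>" for \<phi>
  have suc: "(vec_op \<Delta> ^^ p) \<phi> = (vec_op \<Delta> ^^ (p - 1)) (vec_op \<Delta> \<phi>)" for \<phi>
    using \<open>p > 0\<close> by (metis Suc_diff_1 comp_apply funpow_Suc_right)
  have vec0: "(vec_op \<Delta> ^^ n) 0 = 0" for n
    by (induction n) (simp_all add: vec_op_def)
  have E_const: "E (fps_const c) = 0" for c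
    unfolding E_def suc by (simp add: vec_op_def[of _ "fps_const c"] vec0)
  have E_X: "E fps_X = 0"
    unfolding E_def suc by (simp add: vec_op_def)
  have E_mult: "E (a * b) = a * E b + E a * b" for a b
    unfolding E_def funpow_vec_op_mult_prime[OF p] by (simp add: algebra_simps)
  have E_add: "E (a + b) = E a + E b" for a b
    unfolding E_def funpow_vec_op_add by (simp add: algebra_simps)
  have E_shift: "E \<phi> = fps_X * E (fps_shift 1 \<phi>)" for \<phi>
  proof -
    have "E \<phi> = E (fps_const (\<phi> $ 0) + fps_X * fps_shift 1 \<phi>)"
      using fps_decompose_shift[of \<phi>] by simp
    also have "\<dots> = fps_X * E (fps_shift 1 \<phi>)"
      unfolding E_add E_mult E_const E_X by simp
    finally show ?thesis .
  qed
  have "E \<phi> $ n = 0" for n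
  proof (induction n arbitrary: \<phi>)
    case 0
    then show ?case by (subst E_shift) simp
  next
    case (Suc n)
    then show ?case by (subst E_shift) (simp add: fps_X_mult_nth)
  qed
  then have "E \<phi> = 0"
    by (intro fps_ext) simp
  then show ?thesis
    by (simp add: E_def)
qed

text \<open>The quotient of D^k \<Delta> by \<Delta>, given by a recursion so that no division
  occurs and \<Delta> = 0 is allowed. The series c of the overview is the value at k = p -
  1.\<close>

primrec vec_coeff :: "'k::field fps \<Rightarrow> nat \<Rightarrow> 'k fps" where
  "vec_coeff \<Delta> 0 = 1"
| "vec_coeff \<Delta> (Suc k) = \<Delta> * fps_deriv (vec_coeff \<Delta> k) + vec_coeff \<Delta> k * fps_deriv \<Delta>"

lemma funpow_vec_op_eq_vec_coeff: "(vec_op \<Delta> ^^ k) \<Delta> = vec_coeff \<Delta> k * \<Delta>"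
  by (induction k) (simp_all add: vec_op_def algebra_simps)

text \<open>The derivation \<open>vec_op \<Delta>\<close> commutes with its \<open>p\<close>-th power, so the quotient of the two is
  killed by \<open>fps_deriv\<close>.\<close>

lemma fps_deriv_vec_coeff:
  fixes \<Delta> :: "'k::field fps"
  assumes p: "prime p" "CHAR('k) = p"
  shows "fps_deriv (vec_coeff \<Delta> (p - 1)) = 0"
proof (cases "\<Delta> = 0")
  case True
  have "p \<ge> 2" using p(1) by (rule prime_ge_2_nat)
  then have "p - 1 = Suc (p - 2)" by simp
  then show ?thesis by (simp only: True) simp
next
  case False
  have "p > 0" using p(1) by (rule prime_gt_0_nat)
  let ?c = "vec_coeff \<Delta> (p - 1)"
  have "vec_op \<Delta> (?c * \<Delta>) = (vec_op \<Delta> ^^ Suc (p - 1)) \<Delta>"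
    by (simp only: funpow_vec_op_eq_vec_coeff[symmetric] funpow.simps comp_apply)
  also have "\<dots> = (?c * \<Delta>) * fps_deriv \<Delta>"
    using funpow_vec_op_prime[OF p, of \<Delta> \<Delta>] \<open>p > 0\<close>
    by (simp only: Suc_diff_1 funpow_vec_op_eq_vec_coeff)
  finally have "vec_op \<Delta> (?c * \<Delta>) = (?c * \<Delta>) * fps_deriv \<Delta>" .
  then have "\<Delta> * \<Delta> * fps_deriv ?c = 0"
    by (simp add: vec_op_def algebra_simps)
  then show ?thesis
    using False by simp
qed

lemma funpow_vec_op_scale:
  assumes "fps_deriv c = 0"
  shows "(vec_op (c * \<gamma>) ^^ k) \<phi> = c ^ k * (vec_op \<gamma> ^^ k) \<phi>"
proof (induction k)
  case (Suc k)
  have "fps_deriv (c ^ k) = 0"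
    using assms by (simp add: fps_deriv_power)
  with Suc show ?case
    by (simp add: vec_op_def algebra_simps)
qed simp

text \<open>For \<gamma> = \<Delta>, c = \<open>vec_coeff \<Delta> (p - 1)\<close> and k = p - 1 the
  right-hand side is c^p (c \<Delta>): the vector field c \<Delta> has the coefficient c^p. This is
  the source of the rule c' = c^p.\<close>

lemma funpow_vec_op_scale_self:
  assumes "fps_deriv c = 0"
  shows "(vec_op (c * \<gamma>) ^^ k) (c * \<gamma>) = c ^ Suc k * (vec_op \<gamma> ^^ k) \<gamma>"
proof -
  have "(vec_op \<gamma> ^^ k) (c * \<gamma>) = c * (vec_op \<gamma> ^^ k) \<gamma>"
    by (induction k) (simp_all add: vec_op_def assms algebra_simps)
  then show ?thesis
    by (simp only: funpow_vec_op_scale[OF assms]) simp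
qed

section \<open>Gauss norms\<close>

context ultrametric_field
begin

lemma absv_0 [simp]: "absv 0 = 0"
  by (simp add: absv_eq_0_iff)

lemma absv_1 [simp]: "absv 1 = 1"
proof -
  have "absv 1 * absv 1 = absv 1"
    using absv_mult[of 1 1] by simp
  moreover have "absv 1 \<noteq> 0"
    by (simp add: absv_eq_0_iff)
  ultimately show ?thesis by simp
qed

lemma absv_pos_iff: "0 < absv x \<longleftrightarrow> x \<noteq> 0"
  using absv_nonneg[of x] absv_eq_0_iff[of x] by linarith

lemma absv_power: "absv (x ^ n) = absv x ^ n"
  by (induction n) (simp_all add: absv_mult)

lemma absv_eq_1_if_power_eq_1:
  assumes "x ^ n = 1" "n \<ge> 1"
  shows "absv x = 1"
proof -
  have "absv x ^ n = 1"
    using assms by (simp flip: absv_power)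
  then show ?thesis
    using power_eq_iff_eq_base[of n "absv x" 1] assms(2) absv_nonneg[of x] by simp
qed

lemma absv_minus [simp]: "absv (- x) = absv x"
proof -
  have "absv (- 1) = 1"
    by (rule absv_eq_1_if_power_eq_1[of _ 2]) auto
  then show ?thesis
    using absv_mult[of "- 1" x] by simp
qed

lemma absv_minus_commute: "absv (x - y) = absv (y - x)"
  using absv_minus[of "x - y"] by simp

lemma absv_add_le: "absv x \<le> B \<Longrightarrow> absv y \<le> B \<Longrightarrow> absv (x + y) \<le> B"
  using absv_ultrametric[of x y] by simp

lemma absv_diff_le: "absv x \<le> B \<Longrightarrow> absv y \<le> B \<Longrightarrow> absv (x - y) \<le> B"
  using absv_add_le[of x B "- y"] by simp

lemma absv_sum_le:
  assumes "\<And>i. i \<in> A \<Longrightarrow> absv (f i) \<le> B" "0 \<le> B"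
  shows "absv (sum f A) \<le> B"
  using assms(1)
  by (induction A rule: infinite_finite_induct) (auto intro: absv_add_le simp: assms(2))

lemma absv_of_nat_le_1: "absv (of_nat n) \<le> 1"
  by (induction n) (auto intro: absv_add_le)

lemma absv_add_eq:
  assumes "absv y < absv x"
  shows "absv (x + y) = absv x"
proof (rule antisym)
  show "absv (x + y) \<le> absv x"
    using assms by (intro absv_add_le) auto
  show "absv x \<le> absv (x + y)"
  proof (rule ccontr)
    assume "\<not> absv x \<le> absv (x + y)"
    then have "absv ((x + y) - y) \<le> max (absv (x + y)) (absv y)"
      by (intro absv_diff_le) auto
    with assms \<open>\<not> _\<close> show False by simp
  qed
qed

text \<open>An inverse of n modulo p gives two factors of absolute value at most 1 whose product is
  1.\<close>

lemma absv_of_nat_eq_1: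
  assumes p: "prime p" "CHAR('k) = p" and n: "\<not> p dvd n"
  shows "absv (of_nat n) = 1"
proof -
  have "coprime n p"
    using p n by (metis coprime_commute prime_imp_coprime)
  then obtain m where "[n * m = 1] (mod p)"
    by (metis One_nat_def cong_solve_coprime_nat)
  then have "of_nat (n * m) = (of_nat 1 :: 'k)"
    using p(2) of_nat_eq_iff_cong_CHAR by blast
  then have "absv (of_nat n) * absv (of_nat m) = 1"
    by (simp flip: absv_mult)
  moreover have "absv (of_nat n) * absv (of_nat m) \<le> absv (of_nat n)"
    using absv_of_nat_le_1[of m] absv_nonneg[of "of_nat n"] by (simp add: mult_left_le)
  ultimately show ?thesis
    using absv_of_nat_le_1[of n] by linarith
qed

text \<open>The Gauss norm on the disc of radius \<open>r\<close> enters only through upper bounds,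
  so a series that is unbounded at this radius needs no separate treatment.\<close>

definition gauss_le :: "real \<Rightarrow> 'k fps \<Rightarrow> real \<Rightarrow> bool" where
  "gauss_le r a B \<longleftrightarrow> (\<forall>i. absv (a $ i) * r ^ i \<le> B)"

text \<open>A ratio \<theta> common to all degrees, instead of a strict inequality in each, leaves a
  gap that infinite sums and repeated estimates cannot close.\<close>

definition dominant :: "real \<Rightarrow> real \<Rightarrow> 'k fps \<Rightarrow> nat \<Rightarrow> bool" where
  "dominant r \<theta> a m \<longleftrightarrow>
     a $ m \<noteq> 0 \<and> (\<forall>i. i \<noteq> m \<longrightarrow> absv (a $ i) * r ^ i \<le> \<theta> * (absv (a $ m) * r ^ m))"

lemma gauss_le_mono: "gauss_le r a B \<Longrightarrow> B \<le> C \<Longrightarrow> gauss_le r a C"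
  unfolding gauss_le_def by (meson order_trans)

lemma gauss_le_0 [simp]: "gauss_le r 0 B \<longleftrightarrow> 0 \<le> B"
  by (simp add: gauss_le_def)

lemma gauss_le_nonneg: "gauss_le r a B \<Longrightarrow> 0 \<le> B"
  unfolding gauss_le_def using absv_nonneg[of "a $ 0"] by (metis mult.right_neutral order_trans power_0)

lemma gauss_le_const: "absv c \<le> B \<Longrightarrow> 0 \<le> B \<Longrightarrow> gauss_le r (fps_const c) B"
  by (auto simp: gauss_le_def)

lemma gauss_le_of_nat: "gauss_le r (of_nat n) 1"
  using absv_of_nat_le_1[of n] by (auto intro: gauss_le_const simp flip: fps_of_nat)

lemma gauss_le_1: "gauss_le r 1 1"
  using gauss_le_of_nat[of r 1] by simp

lemma gauss_le_X_power:
  assumes "0 < r"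
  shows "gauss_le r (fps_X ^ n) (r ^ n)"
  using assms by (auto simp: gauss_le_def fps_X_power_nth)

lemma gauss_le_X: "0 < r \<Longrightarrow> gauss_le r fps_X r"
  using gauss_le_X_power[of r 1] by simp

lemma gauss_le_add:
  assumes "0 < r" "gauss_le r a B" "gauss_le r b B"
  shows "gauss_le r (a + b) B"
  unfolding gauss_le_def
proof
  fix i
  have "absv (a $ i) \<le> B / r ^ i" "absv (b $ i) \<le> B / r ^ i"
    using assms by (auto simp: gauss_le_def field_simps)
  then have "absv ((a + b) $ i) \<le> B / r ^ i"
    by (simp add: absv_add_le)
  then show "absv ((a + b) $ i) * r ^ i \<le> B"
    using assms(1) by (simp add: field_simps)
qed

lemma gauss_le_minus [simp]: "gauss_le r (- a) B \<longleftrightarrow> gauss_le r a B"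
  by (simp add: gauss_le_def)

lemma gauss_le_diff:
  assumes "0 < r" "gauss_le r a B" "gauss_le r b B"
  shows "gauss_le r (a - b) B"
  using gauss_le_add[of r a B "- b"] assms by simp

lemma gauss_le_mult:
  assumes "0 < r" "gauss_le r a A" "gauss_le r b B"
  shows "gauss_le r (a * b) (A * B)"
  unfolding gauss_le_def
proof
  fix n
  have nn: "0 \<le> A" "0 \<le> B"
    using assms(2,3) by (auto intro: gauss_le_nonneg)
  have "absv ((a * b) $ n) \<le> A * B / r ^ n"
    unfolding fps_mult_nth
  proof (rule absv_sum_le)
    fix i assume i: "i \<in> {0..n}"
    have "absv (a $ i) * r ^ i * (absv (b $ (n - i)) * r ^ (n - i)) \<le> A * B"
      using assms nn by (intro mult_mono) (auto simp: gauss_le_def absv_nonneg)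
    moreover have "r ^ n = r ^ i * r ^ (n - i)"
      using i by (simp flip: power_add)
    ultimately show "absv (a $ i * b $ (n - i)) \<le> A * B / r ^ n"
      using assms(1) by (simp add: absv_mult field_simps)
  qed (use nn assms(1) in simp)
  then show "absv ((a * b) $ n) * r ^ n \<le> A * B"
    using assms(1) by (simp add: field_simps)
qed

lemma gauss_le_power:
  assumes "0 < r" "gauss_le r a A"
  shows "gauss_le r (a ^ n) (A ^ n)"
  by (induction n) (auto intro: gauss_le_mult gauss_le_1 assms)

lemma gauss_le_deriv:
  assumes "0 < r" "gauss_le r a B"
  shows "gauss_le r (fps_deriv a) (B / r)"
  unfolding gauss_le_def
proof
  fix n
  have "absv (of_nat (n + 1)) * (absv (a $ (n + 1)) * r ^ (n + 1)) \<le> 1 * B"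
  proof (rule mult_mono)
    show "absv (a $ (n + 1)) * r ^ (n + 1) \<le> B"
      using assms(2) unfolding gauss_le_def by blast
    show "absv (of_nat (n + 1)) \<le> 1"
      by (rule absv_of_nat_le_1)
  qed (use assms(1) absv_nonneg in auto)
  then show "absv (fps_deriv a $ n) * r ^ n \<le> B / r"
    unfolding fps_deriv_nth absv_mult using assms(1) by (simp add: field_simps del: of_nat_Suc)
qed

text \<open>The displacement is measured as r G because differentiation costs a factor 1 / r; each
  application of D then gains exactly G.\<close>

lemma gauss_le_vec_op:
  assumes "0 < r" "gauss_le r \<Delta> (r * G)" "gauss_le r \<phi> B"
  shows "gauss_le r (vec_op \<Delta> \<phi>) (B * G)"
proof -
  have "gauss_le r (\<Delta> * fps_deriv \<phi>) ((r * G) * (B / r))"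
    using assms by (intro gauss_le_mult gauss_le_deriv)
  then show ?thesis
    using assms(1) by (simp add: vec_op_def mult_ac)
qed

lemma gauss_le_funpow_vec_op:
  assumes "0 < r" "gauss_le r \<Delta> (r * G)" "gauss_le r \<phi> B"
  shows "gauss_le r ((vec_op \<Delta> ^^ k) \<phi>) (B * G ^ k)"
proof (induction k)
  case (Suc k)
  show ?case
    using gauss_le_vec_op[OF assms(1,2) Suc] by (simp add: mult_ac)
qed (use assms in simp)

lemma gauss_le_vec_coeff:
  assumes "0 < r" "gauss_le r \<Delta> (r * G)"
  shows "gauss_le r (vec_coeff \<Delta> k) (G ^ k)"
proof (induction k)
  case (Suc k)
  have "gauss_le r (\<Delta> * fps_deriv (vec_coeff \<Delta> k)) ((r * G) * (G ^ k / r))"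
    using assms Suc by (intro gauss_le_mult gauss_le_deriv)
  moreover have "gauss_le r (vec_coeff \<Delta> k * fps_deriv \<Delta>) (G ^ k * (r * G / r))"
    using assms Suc by (intro gauss_le_mult gauss_le_deriv)
  ultimately show ?case
    using assms(1) by (auto intro: gauss_le_add simp: mult_ac)
qed (simp add: gauss_le_1)

lemma gauss_le_X_add:
  assumes "0 < r" "gauss_le r \<Delta> (r * G)" "G \<le> 1"
  shows "gauss_le r (fps_X + \<Delta>) r"
  using assms gauss_le_mono[of r \<Delta> "r * G" r] by (intro gauss_le_add gauss_le_X) auto

text \<open>The remainders satisfy R(i+1) = (X + \<Delta>) R(i) + i X^(i-1) \<Delta>^2. This avoids
  the factor 1/2 of a second derivative, and integer factors cost nothing in an ultrametric
  estimate.\<close>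

lemma gauss_le_power_Taylor:
  assumes r: "0 < r" and \<Delta>: "gauss_le r \<Delta> (r * G)" and G: "0 \<le> G" "G \<le> 1"
  shows "gauss_le r ((fps_X + \<Delta>) ^ i - fps_X ^ i - of_nat i * fps_X ^ (i - 1) * \<Delta>) (r ^ i * G\<^sup>2)"
proof (induction i)
  case (Suc i)
  let ?R = "\<lambda>i. (fps_X + \<Delta>) ^ i - fps_X ^ i - of_nat i * fps_X ^ (i - 1) * \<Delta>"
  have eq: "?R (Suc i) = (fps_X + \<Delta>) * ?R i + of_nat i * fps_X ^ (i - 1) * \<Delta>\<^sup>2"
    by (cases i) (simp_all add: algebra_simps power2_eq_square)
  have "gauss_le r ((fps_X + \<Delta>) * ?R i) (r * (r ^ i * G\<^sup>2))"
    by (intro gauss_le_mult Suc gauss_le_X_add[OF r \<Delta> G(2)] r)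
  moreover have "gauss_le r (of_nat i * fps_X ^ (i - 1) * \<Delta>\<^sup>2) (r ^ Suc i * G\<^sup>2)"
  proof (cases i)
    case 0
    then show ?thesis using r by simp
  next
    case (Suc j)
    have "gauss_le r (of_nat i * fps_X ^ (i - 1) * \<Delta>\<^sup>2) (1 * r ^ (i - 1) * (r * G)\<^sup>2)"
      by (intro gauss_le_mult gauss_le_of_nat gauss_le_X_power gauss_le_power \<Delta> r)
    then show ?thesis
      by (simp add: Suc power2_eq_square mult_ac)
  qed
  ultimately show ?case
    unfolding eq using r by (intro gauss_le_add) (auto simp: mult_ac)
qed simp

lemma gauss_le_diff_op_vec_op:
  assumes r: "0 < r" and \<Delta>: "gauss_le r \<Delta> (r * G)" and G: "0 \<le> G" "G \<le> 1"
    and \<Delta>0: "\<Delta> $ 0 = 0" and \<phi>: "gauss_le r \<phi> B"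
  shows "gauss_le r (diff_op (fps_X + \<Delta>) \<phi> - vec_op \<Delta> \<phi>) (B * G\<^sup>2)"
  unfolding gauss_le_def
proof
  fix n
  let ?R = "\<lambda>i. (fps_X + \<Delta>) ^ i - fps_X ^ i - of_nat i * fps_X ^ (i - 1) * \<Delta>"
  have "vec_op \<Delta> \<phi> $ n = (\<Sum>i=0..n. of_nat (Suc i) * \<phi> $ Suc i * \<Delta> $ (n - i))"
    unfolding vec_op_def mult.commute[of \<Delta>] fps_mult_nth by simp
  also have "\<dots> = (\<Sum>i=0..n. \<phi> $ i * ((of_nat i * fps_X ^ (i - 1) * \<Delta>) $ n))"
  proof -
    have c: "(of_nat i * fps_X ^ (i - 1) * \<Delta>) $ n = of_nat i * (if n < i - 1 then 0 else \<Delta> $ (n - (i - 1)))" for i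
      by (simp add: mult.assoc fps_X_power_mult_nth flip: fps_of_nat)
    \<comment> \<open>The derivative also sees the coefficient of \<phi> in degree n + 1, while
      composition stops at degree n. The additional term has the factor \<open>\<Delta> $ 0\<close>,
      which is 0.\<close>
    have "(\<Sum>i=0..n. \<phi> $ i * ((of_nat i * fps_X ^ (i - 1) * \<Delta>) $ n))
        = (\<Sum>i=0..Suc n. \<phi> $ i * ((of_nat i * fps_X ^ (i - 1) * \<Delta>) $ n))"
      unfolding c by (simp add: \<Delta>0)
    also have "\<dots> = (\<Sum>i=0..n. \<phi> $ Suc i * ((of_nat (Suc i) * fps_X ^ i * \<Delta>) $ n))"
      unfolding sum.atLeast0_atMost_Suc_shift by simp
    also have "\<dots> = (\<Sum>i=0..n. of_nat (Suc i) * \<phi> $ Suc i * \<Delta> $ (n - i))"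
      using c[of "Suc _"] by (intro sum.cong) (auto simp del: of_nat_Suc)
    finally show ?thesis by simp
  qed
  finally have v: "vec_op \<Delta> \<phi> $ n = \<dots>" .
  have "\<phi> = \<phi> oo fps_X" by simp
  then have "\<phi> $ n = (\<Sum>i=0..n. \<phi> $ i * (fps_X ^ i) $ n)"
    by (metis fps_compose_nth)
  then have "(diff_op (fps_X + \<Delta>) \<phi> - vec_op \<Delta> \<phi>) $ n = (\<Sum>i=0..n. \<phi> $ i * (?R i $ n))"
    unfolding fps_sub_nth v diff_op_def fps_compose_nth
    by (simp add: sum_subtractf right_diff_distrib)
  moreover have "absv (\<Sum>i=0..n. \<phi> $ i * (?R i $ n)) \<le> B * G\<^sup>2 / r ^ n"
  proof (rule absv_sum_le)
    fix i
    have B: "0 \<le> B" using \<phi> by (rule gauss_le_nonneg)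
    have "absv (\<phi> $ i) * (absv (?R i $ n) * r ^ n) \<le> absv (\<phi> $ i) * (r ^ i * G\<^sup>2)"
      using gauss_le_power_Taylor[OF r \<Delta> G, of i]
      by (intro mult_left_mono) (auto simp: gauss_le_def absv_nonneg)
    also have "\<dots> \<le> B * G\<^sup>2"
      using \<phi> by (auto simp: gauss_le_def mult.assoc[symmetric] intro!: mult_right_mono)
    finally show "absv (\<phi> $ i * (?R i $ n)) \<le> B * G\<^sup>2 / r ^ n"
      by (simp only: absv_mult pos_le_divide_eq[OF zero_less_power[OF r]] mult.assoc)
  qed (use gauss_le_nonneg[OF \<phi>] r in simp)
  ultimately show "absv ((diff_op (fps_X + \<Delta>) \<phi> - vec_op \<Delta> \<phi>) $ n) * r ^ n \<le> B * G\<^sup>2"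
    using r by (simp add: field_simps)
qed

lemma gauss_le_diff_op:
  assumes r: "0 < r" and \<Delta>: "gauss_le r \<Delta> (r * G)" and G: "0 \<le> G" "G \<le> 1"
    and \<Delta>0: "\<Delta> $ 0 = 0" and \<phi>: "gauss_le r \<phi> B"
  shows "gauss_le r (diff_op (fps_X + \<Delta>) \<phi>) (B * G)"
proof -
  have "0 \<le> B" using \<phi> by (rule gauss_le_nonneg)
  then have "B * G\<^sup>2 \<le> B * G"
    using G by (auto simp: power2_eq_square intro!: mult_left_mono mult_left_le)
  then have "gauss_le r (diff_op (fps_X + \<Delta>) \<phi> - vec_op \<Delta> \<phi>) (B * G)"
    using gauss_le_diff_op_vec_op[OF assms] by (rule gauss_le_mono[rotated])
  from gauss_le_add[OF r this gauss_le_vec_op[OF r \<Delta> \<phi>]] show ?thesis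
    by simp
qed

text \<open>Telescoping: with N = \<open>diff_op\<close>, N^(k+1) - D^(k+1) = N (N^k - D^k) + (N -
  D) D^k. The error has one factor G more than the main term.\<close>

lemma gauss_le_funpow_diff_op_vec_op:
  assumes r: "0 < r" and \<Delta>: "gauss_le r \<Delta> (r * G)" and G: "0 \<le> G" "G \<le> 1"
    and \<Delta>0: "\<Delta> $ 0 = 0" and \<phi>: "gauss_le r \<phi> B"
  shows "gauss_le r ((diff_op (fps_X + \<Delta>) ^^ k) \<phi> - (vec_op \<Delta> ^^ k) \<phi>) (B * G ^ Suc k)"
proof (induction k)
  case 0
  then show ?case using gauss_le_nonneg[OF \<phi>] G by simp
next
  case (Suc k)
  let ?T = "diff_op (fps_X + \<Delta>)"
  have "gauss_le r (?T ((?T ^^ k) \<phi> - (vec_op \<Delta> ^^ k) \<phi>)) ((B * G ^ Suc k) * G)"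
    by (rule gauss_le_diff_op[OF r \<Delta> G \<Delta>0 Suc])
  moreover have "gauss_le r (?T ((vec_op \<Delta> ^^ k) \<phi>) - vec_op \<Delta> ((vec_op \<Delta> ^^ k) \<phi>)) ((B * G ^ k) * G\<^sup>2)"
    by (rule gauss_le_diff_op_vec_op[OF r \<Delta> G \<Delta>0 gauss_le_funpow_vec_op[OF r \<Delta> \<phi>]])
  ultimately have "gauss_le r (?T ((?T ^^ k) \<phi> - (vec_op \<Delta> ^^ k) \<phi>) +
     (?T ((vec_op \<Delta> ^^ k) \<phi>) - vec_op \<Delta> ((vec_op \<Delta> ^^ k) \<phi>))) (B * G ^ Suc (Suc k))"
    by (intro gauss_le_add r) (simp_all add: power2_eq_square mult_ac)
  then show ?case
    by (simp add: diff_op_diff)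
qed

text \<open>The same telescoping for two vector fields: each summand of the expansion contains the
  difference of the fields once and k factors of size G.\<close>

lemma gauss_le_funpow_vec_op_perturb:
  assumes r: "0 < r" and \<Delta>: "gauss_le r \<Delta> (r * G)" and \<gamma>: "gauss_le r \<gamma> (r * G)"
    and \<epsilon>: "gauss_le r (\<Delta> - \<gamma>) (r * E)"
  shows "gauss_le r ((vec_op \<Delta> ^^ k) \<Delta> - (vec_op \<gamma> ^^ k) \<gamma>) (r * E * G ^ k)"
proof (induction k)
  case 0
  then show ?case using \<epsilon> by simp
next
  case (Suc k)
  have "gauss_le r (vec_op \<gamma> ((vec_op \<Delta> ^^ k) \<Delta> - (vec_op \<gamma> ^^ k) \<gamma>)) ((r * E * G ^ k) * G)"
    by (rule gauss_le_vec_op[OF r \<gamma> Suc])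
  moreover have "gauss_le r (vec_op (\<Delta> - \<gamma>) ((vec_op \<Delta> ^^ k) \<Delta>)) ((r * G * G ^ k) * E)"
    by (rule gauss_le_vec_op[OF r \<epsilon> gauss_le_funpow_vec_op[OF r \<Delta> \<Delta>]])
  ultimately have "gauss_le r (vec_op \<gamma> ((vec_op \<Delta> ^^ k) \<Delta> - (vec_op \<gamma> ^^ k) \<gamma>)
       + vec_op (\<Delta> - \<gamma>) ((vec_op \<Delta> ^^ k) \<Delta>)) (r * E * G ^ Suc k)"
    by (intro gauss_le_add r) (simp_all add: mult_ac)
  then show ?case
    by (simp add: vec_op_diff vec_op_diff_left)
qed

section \<open>Series with a dominant monomial\<close>

lemma dominant_gauss_le:
  assumes "dominant r \<theta> a m" "\<theta> \<le> 1" "0 < r"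
  shows "gauss_le r a (absv (a $ m) * r ^ m)"
proof -
  have "\<theta> * (absv (a $ m) * r ^ m) \<le> 1 * (absv (a $ m) * r ^ m)"
    using assms by (intro mult_right_mono) (auto simp: absv_nonneg)
  then show ?thesis
    using assms(1) unfolding gauss_le_def dominant_def by (metis mult_1 order.refl order_trans)
qed

lemma dominant_add:
  assumes a: "dominant r \<theta> a m" and b: "gauss_le r b (\<theta> * (absv (a $ m) * r ^ m))"
    and \<theta>: "\<theta> < 1" and r: "0 < r"
  shows "dominant r \<theta> (a + b) m" "absv ((a + b) $ m) = absv (a $ m)"
proof -
  have pos: "0 < absv (a $ m) * r ^ m"
    using a r by (simp add: dominant_def absv_pos_iff)
  have "absv (b $ m) * r ^ m \<le> \<theta> * (absv (a $ m) * r ^ m)"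
    using b by (simp add: gauss_le_def)
  also have "\<dots> < absv (a $ m) * r ^ m"
    using mult_strict_right_mono[OF \<theta> pos] by simp
  finally have "absv (b $ m) < absv (a $ m)"
    using r by simp
  then show eq: "absv ((a + b) $ m) = absv (a $ m)"
    by (simp add: absv_add_eq)
  have "(a + b) $ m \<noteq> 0"
    using eq pos by (metis absv_0 less_irrefl mult_zero_left)
  moreover have "absv ((a + b) $ i) * r ^ i \<le> \<theta> * (absv (a $ m) * r ^ m)" if "i \<noteq> m" for i
  proof -
    have "absv (a $ i) \<le> \<theta> * (absv (a $ m) * r ^ m) / r ^ i"
         "absv (b $ i) \<le> \<theta> * (absv (a $ m) * r ^ m) / r ^ i"
      using a b that r by (auto simp: dominant_def gauss_le_def field_simps)
    then have "absv ((a + b) $ i) \<le> \<theta> * (absv (a $ m) * r ^ m) / r ^ i"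
      by (simp add: absv_add_le)
    then show ?thesis
      using r by (simp add: field_simps)
  qed
  ultimately show "dominant r \<theta> (a + b) m"
    unfolding dominant_def eq by blast
qed

text \<open>This is the multiplicativity of the Gauss norm: the product of the two dominant terms is
  the only contribution without a factor \<theta>.\<close>

lemma dominant_mult:
  assumes a: "dominant r \<theta> a m" and b: "dominant r \<theta> b n"
    and \<theta>: "0 \<le> \<theta>" "\<theta> < 1" and r: "0 < r"
  shows "dominant r \<theta> (a * b) (m + n)" "absv ((a * b) $ (m + n)) = absv (a $ m) * absv (b $ n)"
proof -
  define A B where "A = absv (a $ m) * r ^ m" and "B = absv (b $ n) * r ^ n"
  have pos: "0 < A" "0 < B"
    using a b r by (simp_all add: A_def B_def dominant_def absv_pos_iff)
  have le: "absv (a $ i) * r ^ i \<le> A" "absv (b $ i) * r ^ i \<le> B" for i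
    using dominant_gauss_le[OF a] dominant_gauss_le[OF b] \<theta> r
    by (auto simp: gauss_le_def A_def B_def)
  have term_le: "absv (a $ i * b $ j) \<le> \<theta> * (A * B) / r ^ (i + j)" if "i \<noteq> m \<or> j \<noteq> n" for i j
  proof -
    have "(absv (a $ i) * r ^ i) * (absv (b $ j) * r ^ j) \<le> \<theta> * (A * B)"
    proof (cases "i = m")
      case False
      then have "(absv (a $ i) * r ^ i) * (absv (b $ j) * r ^ j) \<le> (\<theta> * A) * B"
        using a le(2)[of j] \<theta> pos r
        by (intro mult_mono[of _ "\<theta> * A"]) (auto simp: dominant_def A_def absv_nonneg)
      then show ?thesis by (simp add: mult_ac)
    next
      case True
      with that have "j \<noteq> n" by simp
      then have "(absv (a $ i) * r ^ i) * (absv (b $ j) * r ^ j) \<le> A * (\<theta> * B)"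
        using b le(1)[of i] \<theta> pos r
        by (intro mult_mono[of _ A _ "\<theta> * B"]) (auto simp: dominant_def B_def absv_nonneg)
      then show ?thesis by (simp add: mult_ac)
    qed
    then show ?thesis
      using r by (simp add: absv_mult power_add field_simps)
  qed
  have nn: "0 \<le> \<theta> * (A * B) / r ^ k" for k
    using pos \<theta> r by simp
  have lead: "(a * b) $ (m + n) = a $ m * b $ n + (\<Sum>i\<in>{0..m + n} - {m}. a $ i * b $ (m + n - i))"
    unfolding fps_mult_nth by (subst sum.remove[of _ m]) auto
  have "absv (\<Sum>i\<in>{0..m + n} - {m}. a $ i * b $ (m + n - i)) \<le> \<theta> * (A * B) / r ^ (m + n)"
  proof (rule absv_sum_le[OF _ nn])
    fix i assume i: "i \<in> {0..m + n} - {m}"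
    then show "absv (a $ i * b $ (m + n - i)) \<le> \<theta> * (A * B) / r ^ (m + n)"
      using term_le[of i "m + n - i"] by auto
  qed
  also have "\<theta> * (A * B) / r ^ (m + n) < (A * B) / r ^ (m + n)"
    using \<theta> pos r by (intro divide_strict_right_mono) auto
  also have "(A * B) / r ^ (m + n) = absv (a $ m * b $ n)"
    using r by (simp add: A_def B_def absv_mult power_add)
  finally show eq: "absv ((a * b) $ (m + n)) = absv (a $ m) * absv (b $ n)"
    unfolding lead by (subst absv_add_eq) (simp_all add: absv_mult)
  have AB: "absv ((a * b) $ (m + n)) * r ^ (m + n) = A * B"
    unfolding eq by (simp add: A_def B_def power_add mult_ac)
  have "absv ((a * b) $ k) * r ^ k \<le> \<theta> * (A * B)" if "k \<noteq> m + n" for k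
  proof -
    have "absv ((a * b) $ k) \<le> \<theta> * (A * B) / r ^ k"
      unfolding fps_mult_nth
    proof (rule absv_sum_le[OF _ nn])
      fix i assume i: "i \<in> {0..k}"
      then have "i \<noteq> m \<or> k - i \<noteq> n"
        using that by auto
      then show "absv (a $ i * b $ (k - i)) \<le> \<theta> * (A * B) / r ^ k"
        using term_le[of i "k - i"] i by simp
    qed
    then show ?thesis
      using r by (simp add: field_simps)
  qed
  moreover have "(a * b) $ (m + n) \<noteq> 0"
    using AB pos by (metis absv_0 less_irrefl mult_pos_pos mult_zero_left)
  ultimately show "dominant r \<theta> (a * b) (m + n)"
    unfolding dominant_def AB by blast
qed

lemma dominant_power:
  assumes a: "dominant r \<theta> a m" and \<theta>: "0 \<le> \<theta>" "\<theta> < 1" and r: "0 < r"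
  shows "dominant r \<theta> (a ^ k) (k * m)" "absv ((a ^ k) $ (k * m)) = absv (a $ m) ^ k"
proof -
  have "dominant r \<theta> (a ^ k) (k * m) \<and> absv ((a ^ k) $ (k * m)) = absv (a $ m) ^ k"
  proof (induction k)
    case 0
    then show ?case using \<theta> by (auto simp: dominant_def)
  next
    case (Suc k)
    then show ?case
      using dominant_mult[OF a, of "a ^ k" "k * m"] \<theta> r by simp
  qed
  then show "dominant r \<theta> (a ^ k) (k * m)" "absv ((a ^ k) $ (k * m)) = absv (a $ m) ^ k"
    by blast+
qed

text \<open>The supremum defining the Gauss norm of \<open>a\<close> need not be attained; instead, each use of the
  dominance improves an arbitrary bound by the factor \<open>\<theta>\<close>.\<close>

lemma gauss_le_cancel_dominant:
  assumes b: "dominant r \<theta> b m" and ab: "gauss_le r (a * b) (B * (absv (b $ m) * r ^ m))"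
    and a: "gauss_le r a C" and \<theta>: "0 \<le> \<theta>" "\<theta> < 1" and r: "0 < r" and B: "0 \<le> B"
  shows "gauss_le r a B"
proof -
  define D where "D = absv (b $ m) * r ^ m"
  have D: "0 < D"
    using b r by (simp add: D_def dominant_def absv_pos_iff)
  have improve: "gauss_le r a (max B (\<theta> * C))" if a: "gauss_le r a C" for C
    unfolding gauss_le_def
  proof
    fix i
    have C: "0 \<le> C" using a by (rule gauss_le_nonneg)
    define E where "E = max B (\<theta> * C) * D / r ^ (i + m)"
    have E: "0 \<le> E" using B D r by (simp add: E_def le_max_iff_disj)
    \<comment> \<open>Coefficient i + m isolates \<open>a $ i * b $ m\<close>. Every other summand
      involves a non-dominant coefficient of \<open>b\<close>, hence a factor \<theta>.\<close>
    have split: "(a * b) $ (i + m) = a $ i * b $ m + (\<Sum>j\<in>{0..i + m} - {i}. a $ j * b $ (i + m - j))"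
      unfolding fps_mult_nth by (subst sum.remove[of _ i]) auto
    have "absv ((a * b) $ (i + m)) * r ^ (i + m) \<le> B * D"
      using ab by (simp add: gauss_le_def D_def)
    also have "\<dots> \<le> max B (\<theta> * C) * D"
      using D by (intro mult_right_mono) auto
    finally have 1: "absv ((a * b) $ (i + m)) \<le> E"
      using r by (simp add: E_def field_simps)
    have 2: "absv (\<Sum>j\<in>{0..i + m} - {i}. a $ j * b $ (i + m - j)) \<le> E"
    proof (rule absv_sum_le[OF _ E])
      fix j assume j: "j \<in> {0..i + m} - {i}"
      have "i + m - j \<noteq> m" using j by auto
      then have "absv (b $ (i + m - j)) * r ^ (i + m - j) \<le> \<theta> * D"
        using b unfolding dominant_def D_def by blast
      then have "(absv (a $ j) * r ^ j) * (absv (b $ (i + m - j)) * r ^ (i + m - j)) \<le> C * (\<theta> * D)"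
        using a C r by (intro mult_mono[of _ C _ "\<theta> * D"]) (auto simp: gauss_le_def absv_nonneg)
      also have "\<dots> \<le> max B (\<theta> * C) * D"
        using D by (simp add: mult_ac)
      finally have "(absv (a $ j) * absv (b $ (i + m - j))) * (r ^ j * r ^ (i + m - j)) \<le> max B (\<theta> * C) * D"
        by (simp only: mult_ac)
      moreover have "r ^ j * r ^ (i + m - j) = r ^ (i + m)"
        using j by (simp flip: power_add)
      ultimately show "absv (a $ j * b $ (i + m - j)) \<le> E"
        using r by (simp add: E_def absv_mult field_simps)
    qed
    have "absv ((a * b) $ (i + m) - (\<Sum>j\<in>{0..i + m} - {i}. a $ j * b $ (i + m - j))) \<le> E"
      by (rule absv_diff_le[OF 1 2])
    then have "absv (a $ i) * absv (b $ m) \<le> E"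
      unfolding split by (simp add: absv_mult)
    then have "(absv (a $ i) * r ^ i) * D \<le> max B (\<theta> * C) * D"
      using r by (simp add: E_def D_def power_add field_simps)
    then show "absv (a $ i) * r ^ i \<le> max B (\<theta> * C)"
      using D by simp
  qed
  have C: "0 \<le> C" using a by (rule gauss_le_nonneg)
  have iter: "gauss_le r a (max B (\<theta> ^ n * C))" for n
  proof (induction n)
    case (Suc n)
    have "\<theta> * B \<le> B" using B \<theta> by (simp add: mult_left_le_one_le)
    then have "max B (\<theta> * max B (\<theta> ^ n * C)) \<le> max B (\<theta> ^ Suc n * C)"
      using \<theta> by (simp add: max_mult_distrib_left mult_ac)
    then show ?case
      using improve[OF Suc] by (rule gauss_le_mono[rotated])
  qed (use a in \<open>auto intro: gauss_le_mono\<close>)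
  have "(\<lambda>n. max B (\<theta> ^ n * C)) \<longlonglongrightarrow> max B (0 * C)"
    using \<theta> by (intro tendsto_max tendsto_const tendsto_mult LIMSEQ_power_zero) auto
  then have lim: "(\<lambda>n. max B (\<theta> ^ n * C)) \<longlonglongrightarrow> B"
    using B by simp
  show ?thesis
    unfolding gauss_le_def
  proof
    fix i
    show "absv (a $ i) * r ^ i \<le> B"
      by (rule LIMSEQ_le_const[OF lim]) (use iter in \<open>auto simp: gauss_le_def\<close>)
  qed
qed

end

section \<open>Growth of the iterates\<close>

context ultrametric_field
begin

text \<open>\<open>G\<close> and \<open>K\<close> are the Gauss norms of \<Delta> / X and of c; the
  index s + 1 makes s the ramification number when the dominant monomial is the lowest one. The last
  inequality is what makes the error in c' = c^p smaller than the main term by the factor \<theta>;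
  it also keeps the error in \<Delta>' = c \<Delta> small.\<close>

definition ramified_state :: "nat \<Rightarrow> real \<Rightarrow> real \<Rightarrow> 'k fps \<Rightarrow> nat \<Rightarrow> nat \<Rightarrow> bool" where
  "ramified_state p r \<theta> g s d \<longleftrightarrow>
     (let \<Delta> = g - fps_X; c = vec_coeff \<Delta> (p - 1);
          G = absv (\<Delta> $ (s + 1)) * r ^ s; K = absv (c $ d) * r ^ d
      in g $ 0 = 0 \<and> dominant r \<theta> \<Delta> (s + 1) \<and> dominant r \<theta> c d \<and>
         G \<le> \<theta> \<and> G ^ (2 * p - 1) \<le> \<theta> * K\<^sup>2)"

text \<open>Write \<open>\<Delta>\<close>, \<open>c\<close> for the data of \<open>g\<close> and \<open>\<Delta>'\<close>, \<open>c'\<close> for those of its \<open>p\<close>-th iterate.  Then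
  \<open>\<Delta>' = c \<Delta>\<close> and \<open>c' = c ^ p\<close> up to errors that are strictly smaller than the dominant terms.\<close>

lemma ramified_state_step:
  assumes p: "prime p" "CHAR('k) = p" and \<theta>: "0 < \<theta>" "\<theta> < 1" and r: "0 < r"
    and state: "ramified_state p r \<theta> g s d"
  shows "ramified_state p r \<theta> (fps_iterate g p) (s + d) (p * d)"
proof -
  have p2: "p \<ge> 2" using p(1) by (rule prime_ge_2_nat)
  define \<Delta> c G K where "\<Delta> = g - fps_X" and "c = vec_coeff \<Delta> (p - 1)"
    and "G = absv (\<Delta> $ (s + 1)) * r ^ s" and "K = absv (c $ d) * r ^ d"
  have g0: "g $ 0 = 0" and dom\<Delta>: "dominant r \<theta> \<Delta> (s + 1)" and domc: "dominant r \<theta> c d"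
    and G\<theta>: "G \<le> \<theta>" and GK: "G ^ (2 * p - 1) \<le> \<theta> * K\<^sup>2"
    using state unfolding ramified_state_def Let_def \<Delta>_def[symmetric] c_def[symmetric]
      G_def[symmetric] K_def[symmetric] by auto
  have g: "g = fps_X + \<Delta>" by (simp add: \<Delta>_def)
  have \<Delta>0: "\<Delta> $ 0 = 0" using g0 by (simp add: \<Delta>_def)
  have G: "0 < G" "G \<le> 1"
    using dom\<Delta> r G\<theta> \<theta> by (auto simp: G_def dominant_def absv_pos_iff)
  have K: "0 < K"
    using domc r by (auto simp: K_def dominant_def absv_pos_iff)
  have gb\<Delta>: "gauss_le r \<Delta> (r * G)"
    using dominant_gauss_le[OF dom\<Delta>] \<theta> r by (simp add: G_def mult_ac)
  have gbc: "gauss_le r c K"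
    using dominant_gauss_le[OF domc] \<theta> r by (simp add: K_def)
  have KG: "K \<le> G ^ (p - 1)"
    using gauss_le_vec_coeff[OF r gb\<Delta>, of "p - 1", folded c_def]
    by (simp add: K_def gauss_le_def)
  also have "\<dots> \<le> 1"
    using G by (intro power_le_one) auto
  finally have K1: "K \<le> 1" .
  have dc: "fps_deriv c = 0"
    unfolding c_def by (rule fps_deriv_vec_coeff[OF p])
  define \<Delta>' err where "\<Delta>' = fps_iterate g p - fps_X" and "err = \<Delta>' - c * \<Delta>"
  have "\<Delta>' = (diff_op (fps_X + \<Delta>) ^^ (p - 1)) \<Delta>"
    unfolding \<Delta>'_def fps_iterate_prime_minus_X[OF g0 p] by (simp add: g)
  moreover have "c * \<Delta> = (vec_op \<Delta> ^^ (p - 1)) \<Delta>"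
    by (simp add: c_def funpow_vec_op_eq_vec_coeff)
  ultimately have gberr: "gauss_le r err (r * (G * G ^ p))"
    using gauss_le_funpow_diff_op_vec_op[OF r gb\<Delta> _ G(2) \<Delta>0 gb\<Delta>, of "p - 1"] G p2
    by (simp add: err_def mult_ac)
  \<comment> \<open>The error in \<Delta>' relative to the main term is G^p / K. Multiplying the two
    size conditions of the state bounds the square of this ratio by \<theta>^2.\<close>
  have "(G ^ p)\<^sup>2 = G ^ (2 * p - 1) * G"
  proof -
    have "(G ^ p)\<^sup>2 = G ^ (Suc (2 * p - 1))"
      using p2 by (simp add: power_mult[symmetric] mult.commute)
    then show ?thesis by simp
  qed
  also have "\<dots> \<le> (\<theta> * K\<^sup>2) * \<theta>"
    using GK G\<theta> G K \<theta> by (intro mult_mono) auto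
  also have "\<dots> = (\<theta> * K)\<^sup>2"
    by (simp add: power2_eq_square)
  finally have Gp: "G ^ p \<le> \<theta> * K"
    by (rule power2_le_imp_le) (use \<theta> K in simp)
  have domc\<Delta>: "dominant r \<theta> (c * \<Delta>) (d + (s + 1))"
    and abs_c\<Delta>: "absv ((c * \<Delta>) $ (d + (s + 1))) = absv (c $ d) * absv (\<Delta> $ (s + 1))"
    using dominant_mult[OF domc dom\<Delta>] \<theta> r by auto
  have lead: "absv ((c * \<Delta>) $ (d + (s + 1))) * r ^ (d + (s + 1)) = r * (K * G)"
    unfolding abs_c\<Delta> by (simp add: K_def G_def power_add)
  have "gauss_le r err (\<theta> * (r * (K * G)))"
    using Gp G r by (intro gauss_le_mono[OF gberr]) (simp add: mult_ac)
  from dominant_add[OF domc\<Delta> this[folded lead] \<theta>(2) r]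
  have dom\<Delta>': "dominant r \<theta> \<Delta>' (d + (s + 1))"
    and abs\<Delta>': "absv (\<Delta>' $ (d + (s + 1))) * r ^ (d + (s + 1)) = r * (K * G)"
    using lead by (simp_all add: err_def)
  define G' c' where "G' = K * G" and "c' = vec_coeff \<Delta>' (p - 1)"
  have G': "0 < G'" using K G by (simp add: G'_def)
  have gb\<Delta>': "gauss_le r \<Delta>' (r * G')"
    using dominant_gauss_le[OF dom\<Delta>' less_imp_le[OF \<theta>(2)] r] unfolding abs\<Delta>' G'_def .
  have gbc\<Delta>: "gauss_le r (c * \<Delta>) (r * G')"
    using dominant_gauss_le[OF domc\<Delta> less_imp_le[OF \<theta>(2)] r] unfolding lead G'_def .
  have "(vec_op (c * \<Delta>) ^^ (p - 1)) (c * \<Delta>) = c ^ p * (c * \<Delta>)"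
    using funpow_vec_op_scale_self[OF dc, where \<gamma> = \<Delta> and k = "p - 1"]
      Suc_diff_1[OF prime_gt_0_nat[OF p(1)]]
    by (simp only: funpow_vec_op_eq_vec_coeff[where \<Delta> = \<Delta>] c_def[symmetric])
  moreover have "(vec_op \<Delta>' ^^ (p - 1)) \<Delta>' = c' * \<Delta>'"
    by (simp add: funpow_vec_op_eq_vec_coeff c'_def)
  ultimately have gb1: "gauss_le r (c' * \<Delta>' - c ^ p * (c * \<Delta>)) (r * (G * G ^ p) * G' ^ (p - 1))"
    using gauss_le_funpow_vec_op_perturb[OF r gb\<Delta>' gbc\<Delta> gberr[unfolded err_def], of "p - 1"]
    by simp
  have "K ^ p = K ^ (p - 1) * K"
    using p2 by (cases p) simp_all
  also have "\<dots> \<le> K ^ (p - 1) * G ^ (p - 1)"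
    using KG K by (intro mult_left_mono) auto
  also have "\<dots> = G' ^ (p - 1)"
    by (simp add: G'_def power_mult_distrib)
  finally have KpG': "K ^ p \<le> G' ^ (p - 1)" .
  have gb2: "gauss_le r (c ^ p * err) (r * (G * G ^ p) * G' ^ (p - 1))"
  proof (rule gauss_le_mono)
    show "gauss_le r (c ^ p * err) (K ^ p * (r * (G * G ^ p)))"
      by (intro gauss_le_mult gauss_le_power gbc gberr r)
    show "K ^ p * (r * (G * G ^ p)) \<le> r * (G * G ^ p) * G' ^ (p - 1)"
      using KpG' r G by (simp add: mult_ac)
  qed
  \<comment> \<open>Only the product c' \<Delta>' is accessible, so c' - c^p is estimated after
    multiplication by \<Delta>', and \<Delta>' is cancelled by its dominance.\<close>
  have "(c' - c ^ p) * \<Delta>' = (c' * \<Delta>' - c ^ p * (c * \<Delta>)) - c ^ p * err"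
    by (simp add: err_def algebra_simps)
  then have gb3: "gauss_le r ((c' - c ^ p) * \<Delta>') (r * (G * G ^ p) * G' ^ (p - 1))"
    using gauss_le_diff[OF r gb1 gb2] by simp
  \<comment> \<open>With G' = K G and the common factors removed, this is exactly G^(2p-1) \<le>
    \<theta> K^2.\<close>
  have "r * (G * G ^ p) * G' ^ (p - 1) \<le> \<theta> * K ^ p * (r * G')"
  proof -
    have "G ^ p * G ^ (p - 1) = G ^ (2 * p - 1)"
      using p2 by (simp add: power_add[symmetric] mult_2)
    then have "r * (G * G ^ p) * G' ^ (p - 1) = r * G * (G ^ (2 * p - 1) * K ^ (p - 1))"
      by (simp add: G'_def power_mult_distrib mult_ac)
    also have "\<dots> \<le> r * G * (\<theta> * K\<^sup>2 * K ^ (p - 1))"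
      using GK r G K by (intro mult_left_mono mult_right_mono) auto
    also have "\<dots> = \<theta> * (K * K ^ (p - 1)) * (r * (K * G))"
      by (simp add: power2_eq_square mult_ac)
    also have "K * K ^ (p - 1) = K ^ p"
      using p2 by (cases p) simp_all
    finally show ?thesis by (simp add: G'_def)
  qed
  from gauss_le_mono[OF gb3 this]
  have gb4: "gauss_le r ((c' - c ^ p) * \<Delta>') (\<theta> * K ^ p * (r * G'))" .
  \<comment> \<open>A crude bound: the cancellation lemma improves a bound step by step and needs
    some finite one to start from.\<close>
  have "gauss_le r (c' - c ^ p) (max (G' ^ (p - 1)) (K ^ p))"
  proof (intro gauss_le_diff r)
    show "gauss_le r c' (max (G' ^ (p - 1)) (K ^ p))"
      unfolding c'_def by (rule gauss_le_mono[OF gauss_le_vec_coeff[OF r gb\<Delta>'] max.cobounded1])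
    show "gauss_le r (c ^ p) (max (G' ^ (p - 1)) (K ^ p))"
      by (rule gauss_le_mono[OF gauss_le_power[OF r gbc] max.cobounded2])
  qed
  then have gb5: "gauss_le r (c' - c ^ p) (\<theta> * K ^ p)"
    by (rule gauss_le_cancel_dominant[OF dom\<Delta>' gb4[unfolded G'_def, folded abs\<Delta>']])
      (use \<theta> r K in auto)
  have domcp: "dominant r \<theta> (c ^ p) (p * d)" and "absv ((c ^ p) $ (p * d)) = absv (c $ d) ^ p"
    using dominant_power[OF domc] \<theta> r by auto
  then have abscp: "absv ((c ^ p) $ (p * d)) * r ^ (p * d) = K ^ p"
    by (simp add: K_def power_mult_distrib power_mult[symmetric] mult.commute)
  from dominant_add[OF domcp gb5[folded abscp] \<theta>(2) r]
  have domc': "dominant r \<theta> c' (p * d)" and absc': "absv (c' $ (p * d)) * r ^ (p * d) = K ^ p"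
    using abscp by simp_all
  have abs\<Delta>'': "absv (\<Delta>' $ (s + d + 1)) * r ^ (s + d) = G'"
    using abs\<Delta>' r by (simp add: G'_def add_ac mult_ac)
  have "G' \<le> \<theta>"
    unfolding G'_def using mult_right_mono[OF K1, of G] G G\<theta> by linarith
  moreover have "G' ^ (2 * p - 1) \<le> \<theta> * (K ^ p)\<^sup>2"
  proof -
    have "G' ^ (2 * p - 1) \<le> K ^ (2 * p - 1) * (\<theta> * K\<^sup>2)"
      unfolding G'_def power_mult_distrib using GK K by (intro mult_left_mono) auto
    also have "\<dots> = \<theta> * (K ^ (2 * p) * K)"
    proof -
      have "K ^ (2 * p - 1) * K = K ^ (2 * p)"
        using p2 by (cases p) simp_all
      then show ?thesis by (simp add: power2_eq_square mult_ac)
    qed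
    also have "\<dots> \<le> \<theta> * (K ^ (2 * p))"
      using K K1 \<theta> by (intro mult_left_mono mult_right_le_one_le) auto
    also have "\<dots> = \<theta> * (K ^ p)\<^sup>2"
      by (simp add: power_mult[symmetric] mult.commute)
    finally show ?thesis .
  qed
  moreover have "dominant r \<theta> \<Delta>' (s + d + 1)"
    using dom\<Delta>' by (simp add: add_ac)
  moreover have "fps_iterate g p $ 0 = 0"
    by (rule fps_iterate_nth_0[OF g0])
  ultimately show ?thesis
    using domc' abs\<Delta>'' absc'
    unfolding ramified_state_def Let_def \<Delta>'_def[symmetric] c'_def[symmetric] by simp
qed

lemma ramified_state_iterate:
  assumes p: "prime p" "CHAR('k) = p" and \<theta>: "0 < \<theta>" "\<theta> < 1" and r: "0 < r"
    and state: "ramified_state p r \<theta> g s d"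
  shows "ramified_state p r \<theta> (fps_iterate g (p ^ n)) (s + d * (\<Sum>j<n. p ^ j)) (p ^ n * d)"
proof (induction n)
  case 0
  then show ?case using state by (simp add: fps_iterate_1)
next
  case (Suc n)
  have g0: "g $ 0 = 0"
    using state by (simp add: ramified_state_def Let_def)
  show ?case
    using ramified_state_step[OF p \<theta> r Suc]
    by (simp add: fps_iterate_mult[OF g0, symmetric] algebra_simps)
qed

lemma eventually_dominant:
  assumes a: "gauss_le \<rho> a C" "0 < \<rho>" and ord: "\<And>i. i < m \<Longrightarrow> a $ i = 0" "a $ m \<noteq> 0"
    and \<theta>: "0 < \<theta>"
  shows "eventually (\<lambda>r. dominant r \<theta> a m) (at_right 0)"
proof -
  \<comment> \<open>For r below this value C r / \<rho>^(m+1) is at most \<theta> |a_m|, which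
    places every term of degree above m below the required fraction of term m. The summand 1 in C +
    1 keeps the denominator positive.\<close>
  define b where "b = min \<rho> (\<theta> * absv (a $ m) * \<rho> ^ Suc m / (C + 1))"
  have C: "0 \<le> C" using a(1) by (rule gauss_le_nonneg)
  have am: "0 < absv (a $ m)" using ord by (simp add: absv_pos_iff)
  have b: "0 < b"
    using a \<theta> am C by (simp add: b_def)
  have "dominant r \<theta> a m" if r: "0 < r" "r < b" for r
    unfolding dominant_def
  proof (intro conjI allI impI)
    fix i assume "i \<noteq> m"
    show "absv (a $ i) * r ^ i \<le> \<theta> * (absv (a $ m) * r ^ m)"
    proof (cases "i < m")
      case True
      then show ?thesis using ord \<theta> r am by simp
    next
      case False
      with \<open>i \<noteq> m\<close> have i: "Suc m \<le> i" by simp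
      have r\<rho>: "r \<le> \<rho>" using r by (simp add: b_def)
      have "absv (a $ i) * r ^ i = (absv (a $ i) * \<rho> ^ i) * (r / \<rho>) ^ i"
        using a by (simp add: power_divide)
      also have "\<dots> \<le> C * (r / \<rho>) ^ Suc m"
        using a r r\<rho> i C by (intro mult_mono power_decreasing) (auto simp: gauss_le_def)
      also have "\<dots> = (C * r / \<rho> ^ Suc m) * r ^ m"
        by (simp add: power_divide)
      also have "\<dots> \<le> (\<theta> * absv (a $ m)) * r ^ m"
      proof (rule mult_right_mono)
        have "C * r \<le> (C + 1) * r" using r by simp
        also have "\<dots> \<le> \<theta> * absv (a $ m) * \<rho> ^ Suc m"
          using r C by (simp add: b_def field_simps)
        finally show "C * r / \<rho> ^ Suc m \<le> \<theta> * absv (a $ m)"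
          using a by (simp add: divide_le_eq)
      qed (use r in simp)
      finally show ?thesis by (simp add: mult_ac)
    qed
  qed (rule ord)
  then show ?thesis
    using b unfolding eventually_at_right_field by blast
qed

lemma eventually_power_le:
  fixes c D :: real
  assumes "b < a" "0 < D"
  shows "eventually (\<lambda>r. c * r ^ a \<le> D * r ^ b) (at_right 0)"
proof -
  have "((\<lambda>r. c * r ^ (a - b)) \<longlongrightarrow> c * 0 ^ (a - b)) (at_right (0::real))"
    by (intro tendsto_intros)
  then have "((\<lambda>r. c * r ^ (a - b)) \<longlongrightarrow> 0) (at_right (0::real))"
    using assms by (simp add: zero_power)
  then have "eventually (\<lambda>r. c * r ^ (a - b) < D) (at_right 0)"
    using assms(2) by (rule order_tendstoD)
  moreover have "eventually (\<lambda>r::real. 0 < r) (at_right 0)"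
    by (rule eventually_at_right_less)
  ultimately show ?thesis
  proof eventually_elim
    case (elim r)
    have "(c * r ^ (a - b)) * r ^ b \<le> D * r ^ b"
      using elim by (intro mult_right_mono) auto
    moreover have "r ^ a = r ^ (a - b) * r ^ b"
      using assms by (simp flip: power_add)
    ultimately show ?case by (simp add: mult_ac)
  qed
qed

text \<open>As r tends to 0 the lowest monomials dominate, and G and K behave like r^s and r^d. The
  inequality between G^(2p-1) and K^2 then becomes the comparison 2d < (2p-1)s of exponents.\<close>

lemma eventually_ramified_state:
  assumes p: "prime p" "CHAR('k) = p" and \<theta>: "0 < \<theta>"
    and g0: "g $ 0 = 0" and \<rho>: "0 < \<rho>" and gb: "gauss_le \<rho> (g - fps_X) \<rho>"
    and ord_g: "\<And>i. i < s + 1 \<Longrightarrow> (g - fps_X) $ i = 0" "(g - fps_X) $ (s + 1) \<noteq> 0"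
    and ord_c: "\<And>i. i < d \<Longrightarrow> vec_coeff (g - fps_X) (p - 1) $ i = 0"
      "vec_coeff (g - fps_X) (p - 1) $ d \<noteq> 0"
    and s: "0 < s" and sd: "2 * d < (2 * p - 1) * s"
  shows "eventually (\<lambda>r. ramified_state p r \<theta> g s d) (at_right 0)"
proof -
  define \<Delta> c where "\<Delta> = g - fps_X" and "c = vec_coeff \<Delta> (p - 1)"
  have "gauss_le \<rho> c (1 ^ (p - 1))"
    unfolding c_def using gb by (intro gauss_le_vec_coeff \<rho>) (simp add: \<Delta>_def)
  then have "eventually (\<lambda>r. dominant r \<theta> c d) (at_right 0)"
    by (rule eventually_dominant[OF _ \<rho> _ _ \<theta>]) (use ord_c in \<open>auto simp: c_def \<Delta>_def\<close>)
  moreover have "eventually (\<lambda>r. dominant r \<theta> \<Delta> (s + 1)) (at_right 0)"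
    using gb[folded \<Delta>_def] by (rule eventually_dominant[OF _ \<rho> _ _ \<theta>]) (use ord_g in \<open>auto simp: \<Delta>_def\<close>)
  moreover have "eventually (\<lambda>r. absv (\<Delta> $ (s + 1)) * r ^ s \<le> \<theta> * r ^ 0) (at_right 0)"
    by (rule eventually_power_le) (use s \<theta> in auto)
  moreover have "eventually (\<lambda>r. absv (\<Delta> $ (s + 1)) ^ (2 * p - 1) * r ^ ((2 * p - 1) * s)
      \<le> (\<theta> * (absv (c $ d))\<^sup>2) * r ^ (2 * d)) (at_right 0)"
    by (rule eventually_power_le) (use ord_c(2) sd \<theta> in \<open>auto simp: c_def \<Delta>_def absv_eq_0_iff\<close>)
  ultimately show ?thesis
  proof eventually_elim
    case (elim r)
    have "(r ^ s) ^ (2 * p - 1) = r ^ ((2 * p - 1) * s)" "(r ^ d)\<^sup>2 = r ^ (2 * d)"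
      by (simp_all add: power_mult[symmetric] mult.commute)
    then show ?case
      using elim g0 unfolding ramified_state_def Let_def \<Delta>_def[symmetric] c_def[symmetric]
      by (simp add: power_mult_distrib mult_ac)
  qed
qed

text \<open>Each iteration adds \<Delta> composed with the previous iterate, and this differs from
  \<Delta> by a difference quadratic in the displacement.\<close>

lemma gauss_le_iterate_linear:
  assumes r: "0 < r" and \<Delta>: "gauss_le r \<Delta> (r * G)" and G: "0 \<le> G" "G \<le> 1"
    and \<Delta>0: "\<Delta> $ 0 = 0"
  shows "gauss_le r (fps_iterate (fps_X + \<Delta>) M - fps_X - of_nat M * \<Delta>) (r * G * G)"
proof (induction M)
  case 0
  then show ?case using r G by simp
next
  case (Suc M)
  let ?g = "fps_X + \<Delta>"
  have g0: "?g $ 0 = 0" using \<Delta>0 by simp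
  define \<Delta>M where "\<Delta>M = fps_iterate ?g M - fps_X"
  have "gauss_le r (of_nat M * \<Delta>) (1 * (r * G))"
    by (intro gauss_le_mult gauss_le_of_nat r \<Delta>)
  moreover have "gauss_le r (fps_iterate ?g M - fps_X - of_nat M * \<Delta>) (r * G)"
    using G r by (intro gauss_le_mono[OF Suc] mult_left_le) auto
  ultimately have "gauss_le r \<Delta>M (r * G)"
    using gauss_le_add[OF r, of "\<Delta>M - of_nat M * \<Delta>" "r * G" "of_nat M * \<Delta>"]
    by (simp add: \<Delta>M_def)
  moreover have "\<Delta>M $ 0 = 0"
    using fps_iterate_nth_0[OF g0] by (simp add: \<Delta>M_def)
  ultimately have "gauss_le r (diff_op (fps_X + \<Delta>M) \<Delta>) (r * G * G)"
    by (intro gauss_le_diff_op r G \<Delta>)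
  from gauss_le_add[OF r Suc this] show ?case
    by (simp add: diff_op_def \<Delta>M_def fps_iterate_Suc fps_compose_add_distrib
        fps_iterate_nth_0[OF g0] algebra_simps)
qed

text \<open>M \<Delta> is as large as \<Delta> because |M| = 1, and the quadratic error is smaller
  by the factor G \<le> \<theta>.\<close>

lemma dominant_iterate_coprime:
  assumes p: "prime p" "CHAR('k) = p" and M: "\<not> p dvd M" and \<theta>: "0 < \<theta>" "\<theta> < 1" and r: "0 < r"
    and g0: "g $ 0 = 0" and dom: "dominant r \<theta> (g - fps_X) (s + 1)"
    and le: "absv ((g - fps_X) $ (s + 1)) * r ^ s \<le> \<theta>"
  shows "dominant r \<theta> (fps_iterate g M - fps_X) (s + 1)"
proof -
  define \<Delta> G where "\<Delta> = g - fps_X" and "G = absv (\<Delta> $ (s + 1)) * r ^ s"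
  have g: "g = fps_X + \<Delta>" by (simp add: \<Delta>_def)
  have G: "0 \<le> G" "G \<le> \<theta>"
    using le r by (simp_all add: G_def \<Delta>_def absv_nonneg)
  have gb: "gauss_le r \<Delta> (r * G)"
    using dominant_gauss_le[OF dom] \<theta> r by (simp add: G_def \<Delta>_def mult_ac)
  have absM: "absv (of_nat M) = 1"
    by (rule absv_of_nat_eq_1[OF p M])
  have nth: "(of_nat M * \<Delta>) $ i = of_nat M * \<Delta> $ i" for i
    by (simp flip: fps_of_nat)
  have "dominant r \<theta> (of_nat M * \<Delta>) (s + 1)"
    using dom absM absv_eq_0_iff[of "of_nat M"]
    unfolding dominant_def nth \<Delta>_def[symmetric] absv_mult by simp
  moreover have "gauss_le r (fps_iterate g M - fps_X - of_nat M * \<Delta>)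
      (\<theta> * (absv ((of_nat M * \<Delta>) $ (s + 1)) * r ^ (s + 1)))"
  proof (rule gauss_le_mono)
    show "gauss_le r (fps_iterate g M - fps_X - of_nat M * \<Delta>) (r * G * G)"
      unfolding g using G \<theta> g0 by (intro gauss_le_iterate_linear r gb) (auto simp: \<Delta>_def)
    have "r * G * G \<le> r * G * \<theta>"
      using G r by (intro mult_left_mono) auto
    then show "r * G * G \<le> \<theta> * (absv ((of_nat M * \<Delta>) $ (s + 1)) * r ^ (s + 1))"
      unfolding nth absv_mult absM by (simp add: G_def mult_ac)
  qed
  ultimately have "dominant r \<theta> (of_nat M * \<Delta> + (fps_iterate g M - fps_X - of_nat M * \<Delta>)) (s + 1)"
    using \<theta> r by (intro dominant_add)
  then show ?thesis by simp
qed

end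

section \<open>Orders of vanishing\<close>

definition exact_order :: "'k::field fps \<Rightarrow> nat \<Rightarrow> bool" where
  "exact_order a n \<longleftrightarrow> (\<forall>i<n. a $ i = 0) \<and> a $ n \<noteq> 0"

lemma exact_order_iff_subdegree: "exact_order a n \<longleftrightarrow> a \<noteq> 0 \<and> subdegree a = n"
  unfolding exact_order_def
  by (metis nth_less_subdegree_zero nth_subdegree_nonzero subdegreeI fps_nonzero_nth)

lemma exact_order_mult_iff:
  assumes "exact_order b m"
  shows "exact_order (a * b) (n + m) \<longleftrightarrow> exact_order a n"
  using assms by (auto simp: exact_order_iff_subdegree)

lemma fps_nonzero_if_exact_order: "exact_order a n \<Longrightarrow> a \<noteq> 0"
  by (simp add: exact_order_iff_subdegree)

lemma exact_order_unique: "exact_order a n \<Longrightarrow> exact_order a m \<Longrightarrow> n = m"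
  by (auto simp: exact_order_iff_subdegree)

lemma ramification_number_eq_iff:
  fixes g :: "'k::field fps"
  assumes "g $ 0 = 0"
  shows "ramification_number p g m = enat n \<longleftrightarrow> exact_order (fps_iterate g (p ^ m) - fps_X) (n + 1)"
proof -
  define \<Delta> where "\<Delta> = fps_iterate g (p ^ m) - fps_X"
  have "\<Delta> $ 0 = 0"
    using fps_iterate_nth_0[OF assms] by (simp add: \<Delta>_def)
  then have \<Delta>: "\<Delta> = fps_shift 1 \<Delta> * fps_X"
    using fps_decompose_shift[of \<Delta>] by (simp add: mult.commute)
  then have "\<Delta> / fps_X = fps_shift 1 \<Delta>"
    by (metis fps_X_neq_zero nonzero_mult_div_cancel_right)
  then have "ramification_number p g m = enat n \<longleftrightarrow> exact_order (fps_shift 1 \<Delta>) n"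
    by (auto simp: ramification_number_def fps_ord_def \<Delta>_def exact_order_iff_subdegree)
  also have "\<dots> \<longleftrightarrow> exact_order (fps_shift 1 \<Delta> * fps_X) (n + 1)"
    by (rule exact_order_mult_iff[symmetric]) (simp add: exact_order_def)
  finally show ?thesis
    unfolding \<Delta>[symmetric] unfolding \<Delta>_def .
qed

subsection \<open>The trivial absolute value\<close>

text \<open>For the trivial absolute value and a radius below \<open>1\<close>, Gauss norms record orders of vanishing,
  so that the formal statements become instances of the metric ones.\<close>

definition trivial_absv :: "'k::field \<Rightarrow> real" where
  "trivial_absv x = (if x = 0 then 0 else 1)"

lemma ultrametric_field_trivial_absv: "ultrametric_field trivial_absv"
  by unfold_locales (auto simp: trivial_absv_def)

lemma exact_order_if_dominant_trivial:
  fixes a :: "'k::field fps"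
  assumes "ultrametric_field.dominant trivial_absv r \<theta> a m" "0 < r" "r < 1" "\<theta> < 1"
  shows "exact_order a m"
proof -
  interpret ultrametric_field "trivial_absv :: 'k \<Rightarrow> real"
    by (rule ultrametric_field_trivial_absv)
  have "a $ i = 0" if "i < m" for i
  proof (rule ccontr)
    assume "a $ i \<noteq> 0"
    then have "r ^ i \<le> \<theta> * r ^ m"
      using assms(1) that unfolding dominant_def by (auto simp: trivial_absv_def dest!: spec[of _ i])
    also have "\<dots> \<le> 1 * r ^ m"
      using assms by (intro mult_right_mono) auto
    also have "\<dots> < r ^ i"
      using assms that by (simp add: power_strict_decreasing)
    finally show False by simp
  qed
  then show ?thesis
    using assms(1) by (simp add: exact_order_def dominant_def)
qed

text \<open>The displacement of the p-th iterate is c \<Delta> up to terms of order s + s p + 1.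
  Since q < s, its order p s + q + 1 lies below that precision, so the order of c is the difference
  of the two given orders.\<close>

lemma exact_order_vec_coeff:
  fixes g :: "'k::field fps"
  assumes p: "prime p" "CHAR('k) = p" and g0: "g $ 0 = 0"
    and ord: "exact_order (g - fps_X) (s + 1)"
      "exact_order (fps_iterate g p - fps_X) (p * s + q + 1)" and q: "q < s"
  shows "exact_order (vec_coeff (g - fps_X) (p - 1)) ((p - 1) * s + q)"
proof -
  interpret ultrametric_field "trivial_absv :: 'k \<Rightarrow> real"
    by (rule ultrametric_field_trivial_absv)
  have "p > 0" using p(1) by (rule prime_gt_0_nat)
  \<comment> \<open>Any radius strictly between 0 and 1 would serve: its powers strictly decrease
    and so encode orders.\<close>
  define \<Delta> r G where "\<Delta> = g - fps_X" and "r = (1 / 2 :: real)" and "G = r ^ s"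
  have r: "0 < r" "r < 1" by (simp_all add: r_def)
  have G: "0 \<le> G" "G \<le> 1" using r by (simp_all add: G_def power_le_one)
  have gb: "gauss_le r \<Delta> (r * G)"
    unfolding gauss_le_def
  proof
    fix i
    show "trivial_absv (\<Delta> $ i) * r ^ i \<le> r * G"
    proof (cases "i < s + 1")
      case True
      then show ?thesis using ord r G by (simp add: exact_order_def \<Delta>_def)
    next
      case False
      then have "r ^ i \<le> r ^ (s + 1)"
        using r by (intro power_decreasing) auto
      then show ?thesis
        using r G by (simp add: trivial_absv_def G_def)
    qed
  qed
  have \<Delta>0: "\<Delta> $ 0 = 0" using g0 by (simp add: \<Delta>_def)
  define err where "err = fps_iterate g p - fps_X - vec_coeff \<Delta> (p - 1) * \<Delta>"
  have "gauss_le r err ((r * G) * G ^ Suc (p - 1))"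
    using gauss_le_funpow_diff_op_vec_op[OF r(1) gb G \<Delta>0 gb, of "p - 1"]
    by (simp add: err_def fps_iterate_prime_minus_X[OF g0 p] funpow_vec_op_eq_vec_coeff \<Delta>_def)
  moreover have "(r * G) * G ^ Suc (p - 1) = r ^ (1 + s + s * p)"
    using \<open>p > 0\<close> by (simp add: G_def power_mult power_add)
  ultimately have "gauss_le r err (r ^ (1 + s + s * p))"
    by (simp only:)
  then have gberr: "trivial_absv (err $ i) * r ^ i \<le> r ^ (1 + s + s * p)" for i
    unfolding gauss_le_def by blast
  have err0: "err $ i = 0" if "i \<le> p * s + q + 1" for i
  proof (rule ccontr)
    assume "err $ i \<noteq> 0"
    then have "r ^ i \<le> r ^ (1 + s + s * p)"
      using gberr[of i] by (simp add: trivial_absv_def)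
    moreover have "r ^ (1 + s + s * p) < r ^ i"
      using r that q by (intro power_strict_decreasing) (auto simp: mult.commute)
    ultimately show False by simp
  qed
  have "(vec_coeff \<Delta> (p - 1) * \<Delta>) $ i = (fps_iterate g p - fps_X) $ i"
    if "i \<le> p * s + q + 1" for i
    using err0[OF that] by (simp add: err_def)
  then have "exact_order (vec_coeff \<Delta> (p - 1) * \<Delta>) (p * s + q + 1)"
    using ord(2) by (simp add: exact_order_def)
  moreover have "p * s + q + 1 = ((p - 1) * s + q) + (s + 1)"
    using \<open>p > 0\<close> by (cases p) auto
  ultimately have "exact_order (vec_coeff \<Delta> (p - 1) * \<Delta>) (((p - 1) * s + q) + (s + 1))"
    by (simp only:)
  then show ?thesis
    unfolding \<Delta>_def exact_order_mult_iff[OF ord(1)] .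
qed

lemma (in ultrametric_field) eventually_ramified_state_if_orders:
  assumes p: "prime p" "CHAR('k) = p" and \<theta>: "0 < \<theta>"
    and g0: "g $ 0 = 0" and \<rho>: "0 < \<rho>" and gb: "gauss_le \<rho> (g - fps_X) \<rho>"
    and ord: "exact_order (g - fps_X) (s + 1)"
      "exact_order (fps_iterate g p - fps_X) (p * s + q + 1)" and q: "2 * q < s"
  shows "eventually (\<lambda>r. ramified_state p r \<theta> g s ((p - 1) * s + q)) (at_right 0)"
proof (rule eventually_ramified_state[OF p \<theta> g0 \<rho> gb])
  have "exact_order (vec_coeff (g - fps_X) (p - 1)) ((p - 1) * s + q)"
    using q by (intro exact_order_vec_coeff p g0 ord) auto
  then show "\<And>i. i < (p - 1) * s + q \<Longrightarrow> vec_coeff (g - fps_X) (p - 1) $ i = 0"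
     "vec_coeff (g - fps_X) (p - 1) $ ((p - 1) * s + q) \<noteq> 0"
    by (auto simp: exact_order_def)
  have "p \<ge> 2" using p(1) by (rule prime_ge_2_nat)
  then have "2 * p - 1 = 2 * (p - 1) + 1" by simp
  then show "2 * ((p - 1) * s + q) < (2 * p - 1) * s"
    using q by (simp add: algebra_simps)
qed (use ord(1) q in \<open>auto simp: exact_order_def\<close>)

text \<open>For the trivial absolute value every series is bounded at radius 1. A single small
  radius carries the state through all iterates, and there the dominant degree is the order. The
  condition 2q < s is 2d < (2p-1)s for d = (p-1)s + q.\<close>

theorem exact_order_iterates:
  fixes g :: "'k::field fps"
  assumes p: "prime p" "CHAR('k) = p" and g0: "g $ 0 = 0"
    and ord: "exact_order (g - fps_X) (s + 1)"
      "exact_order (fps_iterate g p - fps_X) (p * s + q + 1)" and q: "2 * q < s"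
  shows "exact_order (fps_iterate g (p ^ n) - fps_X) (s + ((p - 1) * s + q) * (\<Sum>j<n. p ^ j) + 1)"
proof -
  interpret ultrametric_field "trivial_absv :: 'k \<Rightarrow> real"
    by (rule ultrametric_field_trivial_absv)
  have "gauss_le 1 (g - fps_X) 1"
    by (simp add: gauss_le_def trivial_absv_def)
  then have "eventually (\<lambda>r. ramified_state p r (1/2) g s ((p - 1) * s + q)) (at_right 0)"
    by (intro eventually_ramified_state_if_orders p g0 ord q) auto
  moreover have "eventually (\<lambda>r::real. 0 < r) (at_right 0)"
    by (rule eventually_at_right_less)
  moreover have "eventually (\<lambda>r::real. r < 1) (at_right 0)"
    by (rule order_tendstoD[of "\<lambda>r. r" 0]) (auto intro: tendsto_intros)
  ultimately have "eventually (\<lambda>r. ramified_state p r (1/2) g s ((p - 1) * s + q) \<and> 0 < r \<and> r < 1) (at_right 0)"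
    by eventually_elim auto
  then obtain r where r: "0 < r" "r < 1" and state: "ramified_state p r (1/2) g s ((p - 1) * s + q)"
    using eventually_happens[of _ "at_right (0::real)"] by auto
  from ramified_state_iterate[OF p _ _ r(1) state, of n]
  have "dominant r (1/2) (fps_iterate g (p ^ n) - fps_X) (s + ((p - 1) * s + q) * (\<Sum>j<n. p ^ j) + 1)"
    by (simp add: ramified_state_def Let_def)
  then show ?thesis
    by (rule exact_order_if_dominant_trivial) (use r in auto)
qed

subsection \<open>Minimal ramification\<close>

lemma geometric_sum_nat:
  assumes "2 \<le> (p::nat)"
  shows "(\<Sum>j<n. p ^ j) = (p ^ n - 1) div (p - 1)"
proof -
  have "(p - 1) * (\<Sum>j<n. p ^ j) = p ^ n - 1"
  proof (induction n)
    case (Suc n)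
    have "(p - 1) * (\<Sum>j<Suc n. p ^ j) = p ^ n - 1 + (p - 1) * p ^ n"
      by (simp only: sum.lessThan_Suc distrib_left Suc)
    also have "\<dots> = p ^ Suc n - 1"
    proof -
      have "p ^ n \<ge> 1" using assms by simp
      moreover have "(p - 1) * p ^ n = p * p ^ n - p ^ n"
        by (simp add: algebra_simps)
      moreover have "p * p ^ n \<ge> p ^ n" using assms by simp
      ultimately show ?thesis by simp
    qed
    finally show ?case .
  qed simp
  then show ?thesis
    using assms by (metis One_nat_def Suc_1 diff_is_0_eq' less_eq_Suc_le
        nat_less_le nonzero_mult_div_cancel_left not_less zero_less_diff)
qed

text \<open>The condition \<open>2 * q < s\<close> of \<open>exact_order_iterates\<close> fails for \<open>g\<close>, where \<open>s = q\<close>, but holds for its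
  \<open>p\<close>-th iterate, where \<open>s = q * (1 + p)\<close>; this is why three orders are needed.\<close>

lemma minimally_ramified_iff_orders:
  fixes F :: "'k::field fps"
  assumes p: "prime p" "CHAR('k) = p" and F: "parabolic F" and q: "q = unity_order (multiplier F)"
    "1 \<le> q"
  defines "g \<equiv> fps_iterate F q"
  shows "minimally_ramified p F \<longleftrightarrow>
     exact_order (g - fps_X) (q + 1) \<and>
     exact_order (fps_iterate g p - fps_X) (q * (1 + p) + 1) \<and>
     exact_order (fps_iterate g (p ^ 2) - fps_X) (q * (1 + p + p ^ 2) + 1)"
proof -
  have p2: "p \<ge> 2" using p(1) by (rule prime_ge_2_nat)
  have "F $ 0 = 0" using F by (simp add: parabolic_def)
  then have g0: "g $ 0 = 0" by (simp add: g_def fps_iterate_nth_0)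
  have mr: "minimally_ramified p F \<longleftrightarrow>
      (\<forall>m. exact_order (fps_iterate g (p ^ m) - fps_X) (q * (\<Sum>j<m+1. p ^ j) + 1))"
    by (simp only: minimally_ramified_def F Let_def q(1)[symmetric] g_def[symmetric]
        ramification_number_eq_iff[OF g0] geometric_sum_nat[OF p2] simp_thms)
  show ?thesis
  proof
    assume "minimally_ramified p F"
    then have *: "exact_order (fps_iterate g (p ^ m) - fps_X) (q * (\<Sum>j<m+1. p ^ j) + 1)" for m
      unfolding mr by blast
    show "exact_order (g - fps_X) (q + 1) \<and>
     exact_order (fps_iterate g p - fps_X) (q * (1 + p) + 1) \<and>
     exact_order (fps_iterate g (p ^ 2) - fps_X) (q * (1 + p + p ^ 2) + 1)"
      using *[of 0] *[of 1] *[of 2] by (simp add: fps_iterate_1 eval_nat_numeral add_ac)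
  next
    assume ord: "exact_order (g - fps_X) (q + 1) \<and>
     exact_order (fps_iterate g p - fps_X) (q * (1 + p) + 1) \<and>
     exact_order (fps_iterate g (p ^ 2) - fps_X) (q * (1 + p + p ^ 2) + 1)"
    define h s where "h = fps_iterate g p" and "s = q * (1 + p)"
    have h0: "h $ 0 = 0" by (simp add: h_def fps_iterate_nth_0 g0)
    have iter: "fps_iterate g (p ^ Suc n) = fps_iterate h (p ^ n)" for n
      unfolding h_def fps_iterate_mult[OF g0, symmetric] by simp
    have "2 * q < s" using q p2 by (simp add: s_def)
    moreover have "exact_order (fps_iterate h p - fps_X) (p * s + q + 1)"
      using ord iter[of 1] by (simp add: s_def algebra_simps power2_eq_square)
    ultimately have *: "exact_order (fps_iterate h (p ^ n) - fps_X)
        (s + ((p - 1) * s + q) * (\<Sum>j<n. p ^ j) + 1)" for n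
      using ord by (intro exact_order_iterates p h0) (auto simp: h_def s_def)
    \<comment> \<open>The gain d equals q p^2, so the successive gains d p^j continue the
      progression q, q p already reached by the order of \<open>h\<close>.\<close>
    have s2: "(p - 1) * s + q = q * p ^ 2"
      using p2 by (cases p) (simp_all add: s_def algebra_simps power2_eq_square)
    have "exact_order (fps_iterate g (p ^ m) - fps_X) (q * (\<Sum>j<m+1. p ^ j) + 1)" for m
    proof (cases m)
      case 0
      then show ?thesis using ord by (simp add: fps_iterate_1)
    next
      case (Suc n)
      have "(\<Sum>j<Suc (Suc n). p ^ j) = 1 + p * (1 + p * (\<Sum>j<n. p ^ j))"
        unfolding sum.lessThan_Suc_shift by (simp add: sum_distrib_left)
      then have "q * (\<Sum>j<Suc (Suc n). p ^ j) = s + q * p ^ 2 * (\<Sum>j<n. p ^ j)"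
        by (simp add: s_def algebra_simps power2_eq_square)
      then show ?thesis
        using *[of n] unfolding s2 Suc iter by (simp del: sum.lessThan_Suc)
    qed
    then show "minimally_ramified p F"
      unfolding mr by blast
  qed
qed

lemma unity_order:
  assumes "root_of_unity a"
  shows "1 \<le> unity_order a" "a ^ unity_order a = 1"
    and "\<And>i. 1 \<le> i \<Longrightarrow> i < unity_order a \<Longrightarrow> a ^ i \<noteq> 1"
proof -
  obtain n where "1 \<le> n \<and> a ^ n = 1"
    using assms by (auto simp: root_of_unity_def)
  then show "1 \<le> unity_order a" "a ^ unity_order a = 1"
    unfolding unity_order_def by (metis (mono_tags, lifting) LeastI)+
  show "a ^ i \<noteq> 1" if "1 \<le> i" "i < unity_order a" for i
    using that not_less_Least unfolding unity_order_def by blast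
qed

section \<open>Isolated periodic points\<close>

context ultrametric_field
begin

section \<open>Values of power series over a field that may be incomplete\<close>

lemma absv_sums_dist_le:
  assumes a: "absv_sums absv a s" and C: "\<And>M. N \<le> M \<Longrightarrow> absv ((\<Sum>i<M. a i) - t) \<le> C"
  shows "absv (s - t) \<le> C"
proof (rule field_le_epsilon)
  fix e :: real assume "0 < e"
  then have "eventually (\<lambda>M. absv ((\<Sum>i<M. a i) - s) < e) sequentially"
    using a unfolding absv_sums_def by (intro order_tendstoD)
  moreover have "eventually (\<lambda>M. N \<le> M) sequentially"
    by (rule eventually_ge_at_top)
  ultimately have "eventually (\<lambda>M. absv ((\<Sum>i<M. a i) - s) < e \<and> N \<le> M) sequentially"
    by (rule eventually_conj)
  then obtain M where M: "absv ((\<Sum>i<M. a i) - s) < e" "N \<le> M"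
    using eventually_happens[of _ sequentially] by auto
  have "0 \<le> C" using C[of N] absv_nonneg order_trans by blast
  have "absv ((((\<Sum>i<M. a i) - t)) - ((\<Sum>i<M. a i) - s)) \<le> max C e"
    by (rule absv_diff_le) (use C[OF M(2)] M(1) in auto)
  then show "absv (s - t) \<le> C + e"
    using \<open>0 < e\<close> \<open>0 \<le> C\<close> by simp
qed

lemma absv_sums_if_le:
  assumes "\<And>N. absv ((\<Sum>i<N. a i) - s) \<le> C N" "C \<longlonglongrightarrow> 0"
  shows "absv_sums absv a s"
  unfolding absv_sums_def
  by (rule tendsto_sandwich[OF _ _ tendsto_const assms(2)]) (auto simp: absv_nonneg assms(1))

lemma absv_sums_diff:
  assumes "absv_sums absv a s" "absv_sums absv b t"
  shows "absv_sums absv (\<lambda>i. a i - b i) (s - t)"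
proof (rule absv_sums_if_le)
  show "absv ((\<Sum>i<N. a i - b i) - (s - t)) \<le>
      max (absv ((\<Sum>i<N. a i) - s)) (absv ((\<Sum>i<N. b i) - t))" for N
  proof -
    have "(\<Sum>i<N. a i - b i) - (s - t) = ((\<Sum>i<N. a i) - s) - ((\<Sum>i<N. b i) - t)"
      by (simp add: sum_subtractf)
    then show ?thesis by (simp only:) (rule absv_diff_le, auto)
  qed
  show "(\<lambda>N. max (absv ((\<Sum>i<N. a i) - s)) (absv ((\<Sum>i<N. b i) - t))) \<longlonglongrightarrow> 0"
    using tendsto_max[of _ 0 sequentially _ 0] assms by (simp add: absv_sums_def)
qed

text \<open>The value belongs to the relation: convergence cannot be deduced from small terms, so
  sums for products and composites are proved to converge to a value already at hand.\<close>

abbreviation evaluates :: "'k fps \<Rightarrow> 'k \<Rightarrow> 'k \<Rightarrow> bool" where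
  "evaluates a x s \<equiv> absv_sums absv (\<lambda>i. a $ i * x ^ i) s"

lemma absv_sums_X: "evaluates fps_X x x"
proof -
  have "(\<Sum>i<N + 2. fps_nth fps_X i * x ^ i) = x" for N
    by (induction N) (auto simp: eval_nat_numeral)
  then have "(\<lambda>N. absv ((\<Sum>i<N + 2. fps_nth fps_X i * x ^ i) - x)) \<longlonglongrightarrow> 0"
    by simp
  then show ?thesis
    unfolding absv_sums_def by (rule LIMSEQ_offset)
qed

lemma gauss_le_term_le:
  assumes "gauss_le r a B" "0 < r"
  shows "absv (a $ i * x ^ i) \<le> B * (absv x / r) ^ i"
proof -
  have "absv (a $ i * x ^ i) = (absv (a $ i) * r ^ i) * (absv x / r) ^ i"
    using assms(2) by (simp add: absv_mult absv_power power_divide)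
  also have "\<dots> \<le> B * (absv x / r) ^ i"
    using assms by (intro mult_right_mono) (auto simp: gauss_le_def absv_nonneg)
  finally show ?thesis .
qed

lemma absv_sums_tail_le:
  assumes a: "gauss_le r a B" and r: "0 < r" and x: "absv x < r"
    and s: "evaluates a x s"
  shows "absv ((\<Sum>i<N. a $ i * x ^ i) - s) \<le> B * (absv x / r) ^ N"
proof -
  have \<theta>: "0 \<le> absv x / r" "absv x / r \<le> 1"
    using x r by (auto simp: absv_nonneg)
  have B: "0 \<le> B" using a by (rule gauss_le_nonneg)
  have "absv (s - (\<Sum>i<N. a $ i * x ^ i)) \<le> B * (absv x / r) ^ N"
  proof (rule absv_sums_dist_le[OF s])
    fix M assume "N \<le> M"
    then have "(\<Sum>i<M. a $ i * x ^ i) - (\<Sum>i<N. a $ i * x ^ i) = (\<Sum>i=N..<M. a $ i * x ^ i)"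
      by (simp add: sum_diff_nat_ivl lessThan_atLeast0)
    also have "absv \<dots> \<le> B * (absv x / r) ^ N"
    proof (rule absv_sum_le)
      fix i assume "i \<in> {N..<M}"
      have "absv (a $ i * x ^ i) \<le> B * (absv x / r) ^ i"
        by (rule gauss_le_term_le[OF a r])
      also have "\<dots> \<le> B * (absv x / r) ^ N"
        using \<theta> B \<open>i \<in> _\<close> by (intro mult_left_mono power_decreasing) auto
      finally show "absv (a $ i * x ^ i) \<le> B * (absv x / r) ^ N" .
    qed (use \<theta> B in simp)
    finally show "absv ((\<Sum>i<M. a $ i * x ^ i) - (\<Sum>i<N. a $ i * x ^ i)) \<le> B * (absv x / r) ^ N" .
  qed
  then show ?thesis by (simp add: absv_minus_commute)
qed

text \<open>A partial sum of the product runs over the triangle i + j < N. Summed by rows, it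
  differs from s t by terms that each contain a tail of one factor, and these tails decay
  geometrically in |x| / r.\<close>

lemma absv_sums_mult:
  assumes a: "gauss_le r a A" and b: "gauss_le r b B" and r: "0 < r" and x: "absv x < r"
    and s: "evaluates a x s" and t: "evaluates b x t"
  shows "evaluates (a * b) x (s * t)"
proof (rule absv_sums_if_le)
  define \<theta> where "\<theta> = absv x / r"
  have \<theta>: "0 \<le> \<theta>" "\<theta> < 1"
    using x r by (auto simp: \<theta>_def absv_nonneg)
  have AB: "0 \<le> A" "0 \<le> B" using a b by (auto intro: gauss_le_nonneg)
  show "absv ((\<Sum>i<N. (a * b) $ i * x ^ i) - s * t) \<le> A * B * \<theta> ^ N" for N
  proof -
    let ?S = "\<lambda>N. \<Sum>i<N. b $ i * x ^ i"
    have "(\<Sum>n<N. (a * b) $ n * x ^ n) = (\<Sum>n<N. \<Sum>i\<le>n. (a $ i * x ^ i) * (b $ (n - i) * x ^ (n - i)))"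
    proof (rule sum.cong[OF refl])
      fix n
      have "x ^ n = x ^ i * x ^ (n - i)" if "i \<le> n" for i
        using that by (simp flip: power_add)
      then show "(a * b) $ n * x ^ n = (\<Sum>i\<le>n. (a $ i * x ^ i) * (b $ (n - i) * x ^ (n - i)))"
        unfolding fps_mult_nth atMost_atLeast0 sum_distrib_right by (intro sum.cong) auto
    qed
    also have "\<dots> = (\<Sum>(i, j)\<in>{(i, j). i + j < N}. (a $ i * x ^ i) * (b $ j * x ^ j))"
      by (rule sum.triangle_reindex[symmetric])
    also have "{(i, j). i + j < N} = (SIGMA i:{..<N}. {..<N - i})"
      by auto
    also have "(\<Sum>(i, j)\<in>(SIGMA i:{..<N}. {..<N - i}). (a $ i * x ^ i) * (b $ j * x ^ j))
       = (\<Sum>i<N. (a $ i * x ^ i) * ?S (N - i))"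
      by (simp add: sum.Sigma[symmetric] sum_distrib_left)
    also have "\<dots> - s * t = (\<Sum>i<N. (a $ i * x ^ i) * (?S (N - i) - t)) + ((\<Sum>i<N. a $ i * x ^ i) - s) * t"
      by (simp add: right_diff_distrib left_diff_distrib sum_subtractf sum_distrib_right)
    also have "absv \<dots> \<le> A * B * \<theta> ^ N"
    proof (rule absv_add_le)
      show "absv (\<Sum>i<N. (a $ i * x ^ i) * (?S (N - i) - t)) \<le> A * B * \<theta> ^ N"
      proof (rule absv_sum_le)
        fix i assume "i \<in> {..<N}"
        have "absv (a $ i * x ^ i) * absv (?S (N - i) - t) \<le> (A * \<theta> ^ i) * (B * \<theta> ^ (N - i))"
          using \<theta> AB gauss_le_term_le[OF a r] absv_sums_tail_le[OF b r x t]
          by (intro mult_mono) (auto simp: \<theta>_def absv_nonneg)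
        also have "\<dots> = A * B * (\<theta> ^ i * \<theta> ^ (N - i))" by (simp add: mult_ac)
        also have "\<theta> ^ i * \<theta> ^ (N - i) = \<theta> ^ N"
          using \<open>i \<in> _\<close> by (simp flip: power_add)
        finally show "absv ((a $ i * x ^ i) * (?S (N - i) - t)) \<le> A * B * \<theta> ^ N"
          by (simp add: absv_mult)
      qed (use AB \<theta> in simp)
      have "absv t \<le> B"
        using absv_sums_tail_le[OF b r x t, of 0] by simp
      then have "absv ((\<Sum>i<N. a $ i * x ^ i) - s) * absv t \<le> (A * \<theta> ^ N) * B"
        using \<theta> AB absv_sums_tail_le[OF a r x s] by (intro mult_mono) (auto simp: \<theta>_def absv_nonneg)
      then show "absv (((\<Sum>i<N. a $ i * x ^ i) - s) * t) \<le> A * B * \<theta> ^ N"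
        by (simp add: absv_mult mult_ac)
    qed
    finally show ?thesis .
  qed
  have "(\<lambda>N. A * B * \<theta> ^ N) \<longlonglongrightarrow> A * B * 0"
    using \<theta> by (intro tendsto_mult tendsto_const LIMSEQ_power_zero) auto
  then show "(\<lambda>N. A * B * \<theta> ^ N) \<longlonglongrightarrow> 0" by simp
qed

lemma absv_sums_power:
  assumes a: "gauss_le r a A" and r: "0 < r" and x: "absv x < r"
    and s: "evaluates a x s"
  shows "evaluates (a ^ n) x (s ^ n)"
proof (induction n)
  case 0
  have "(\<Sum>i<N + 1. (1 :: 'k fps) $ i * x ^ i) = 1" for N
    by (induction N) auto
  then have "(\<lambda>N. absv ((\<Sum>i<N + 1. (1 :: 'k fps) $ i * x ^ i) - 1)) \<longlonglongrightarrow> 0"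
    by simp
  then show ?case
    unfolding absv_sums_def power_0 by (rule LIMSEQ_offset)
next
  case (Suc n)
  show ?case
    using absv_sums_mult[OF a gauss_le_power[OF r a] r x s Suc] by simp
qed

lemma gauss_le_compose:
  assumes F: "gauss_le r F B" and G: "gauss_le r G r" and r: "0 < r"
  shows "gauss_le r (F oo G) B"
  unfolding gauss_le_def
proof
  fix n
  have B: "0 \<le> B" using F by (rule gauss_le_nonneg)
  have "absv ((F oo G) $ n) \<le> B / r ^ n"
    unfolding fps_compose_nth
  proof (rule absv_sum_le)
    fix i
    have "absv (F $ i) * (absv ((G ^ i) $ n) * r ^ n) \<le> absv (F $ i) * r ^ i"
      using gauss_le_power[OF r G, of i] by (intro mult_left_mono) (auto simp: gauss_le_def absv_nonneg)
    also have "\<dots> \<le> B" using F by (simp add: gauss_le_def)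
    finally show "absv (F $ i * (G ^ i) $ n) \<le> B / r ^ n"
      using r by (simp add: absv_mult field_simps)
  qed (use B r in simp)
  then show "absv ((F oo G) $ n) * r ^ n \<le> B"
    using r by (simp add: field_simps)
qed

text \<open>Truncating the expansion of each y^i at N costs at most B \<theta>^N with \<theta> = |x|
  / r, uniformly in i; what remains is the partial sum of F at y.\<close>

lemma absv_sums_compose:
  assumes F: "gauss_le r F B" and G: "gauss_le r G r" "G $ 0 = 0" and r: "0 < r" and x: "absv x < r"
    and y: "evaluates G x y" and z: "evaluates F y z"
  shows "evaluates (F oo G) x z"
proof (rule absv_sums_if_le)
  define \<theta> where "\<theta> = absv x / r"
  have \<theta>: "0 \<le> \<theta>" "\<theta> < 1"
    using x r by (auto simp: \<theta>_def absv_nonneg)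
  have B: "0 \<le> B" using F by (rule gauss_le_nonneg)
  let ?S = "\<lambda>N i. \<Sum>n<N. (G ^ i) $ n * x ^ n"
  show "absv ((\<Sum>i<N. (F oo G) $ i * x ^ i) - z) \<le> max (B * \<theta> ^ N) (absv ((\<Sum>i<N. F $ i * y ^ i) - z))" for N
  proof -
    \<comment> \<open>\<open>G $ 0 = 0\<close> makes \<open>(G ^ i) $ n\<close> vanish for i > n, so
      the same range i < N serves all n < N and the two sums can be exchanged.\<close>
    have "(F oo G) $ n = (\<Sum>i<N. F $ i * (G ^ i) $ n)" if "n < N" for n
    proof -
      have "(G ^ i) $ n = 0" if "n < i" for i
        using that G(2) startsby_zero_power_prefix by blast
      then show ?thesis
        unfolding fps_compose_nth using \<open>n < N\<close> by (intro sum.mono_neutral_left) auto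
    qed
    then have "(\<Sum>n<N. (F oo G) $ n * x ^ n) = (\<Sum>n<N. \<Sum>i<N. F $ i * ((G ^ i) $ n * x ^ n))"
      by (simp add: sum_distrib_right mult.assoc)
    also have "\<dots> = (\<Sum>i<N. F $ i * ?S N i)"
      by (subst sum.swap) (simp add: sum_distrib_left)
    also have "\<dots> - z = (\<Sum>i<N. F $ i * (?S N i - y ^ i)) + ((\<Sum>i<N. F $ i * y ^ i) - z)"
      by (simp add: right_diff_distrib sum_subtractf)
    also have "absv \<dots> \<le> max (B * \<theta> ^ N) (absv ((\<Sum>i<N. F $ i * y ^ i) - z))"
    proof (rule absv_add_le)
      have "absv (\<Sum>i<N. F $ i * (?S N i - y ^ i)) \<le> B * \<theta> ^ N"
      proof (rule absv_sum_le)
        fix i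
        have "absv (?S N i - y ^ i) \<le> r ^ i * \<theta> ^ N"
          unfolding \<theta>_def
          by (rule absv_sums_tail_le[OF gauss_le_power[OF r G(1)] r x absv_sums_power[OF G(1) r x y]])
        then have "absv (F $ i) * absv (?S N i - y ^ i) \<le> absv (F $ i) * (r ^ i * \<theta> ^ N)"
          by (intro mult_left_mono) (auto simp: absv_nonneg)
        also have "\<dots> = (absv (F $ i) * r ^ i) * \<theta> ^ N" by simp
        also have "\<dots> \<le> B * \<theta> ^ N"
          using F \<theta> by (intro mult_right_mono) (auto simp: gauss_le_def)
        finally show "absv (F $ i * (?S N i - y ^ i)) \<le> B * \<theta> ^ N"
          by (simp add: absv_mult)
      qed (use B \<theta> in simp)
      then show "absv (\<Sum>i<N. F $ i * (?S N i - y ^ i)) \<le> max (B * \<theta> ^ N) (absv ((\<Sum>i<N. F $ i * y ^ i) - z))"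
        by simp
    qed simp
    finally show ?thesis .
  qed
  have "(\<lambda>N. B * \<theta> ^ N) \<longlonglongrightarrow> B * 0"
    using \<theta> by (intro tendsto_mult tendsto_const LIMSEQ_power_zero) auto
  then show "(\<lambda>N. max (B * \<theta> ^ N) (absv ((\<Sum>i<N. F $ i * y ^ i) - z))) \<longlonglongrightarrow> 0"
    using tendsto_max[of "\<lambda>N. B * \<theta> ^ N" 0 sequentially _ 0] z by (simp add: absv_sums_def)
qed

text \<open>A Schwarz lemma is behind this: a series without constant term whose Gauss norm at r is
  at most r satisfies |\<phi> x| \<le> |x|, so orbits remain in the disc where F can be
  evaluated.\<close>

lemma absv_sums_iterate:
  assumes F: "gauss_le r F r" "F $ 0 = 0" and r: "0 < r"
    and \<phi>: "\<And>x. absv x < r \<Longrightarrow> evaluates F x (\<phi> x)" and x: "absv x < r"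
  shows "gauss_le r (fps_iterate F m) r" "absv ((\<phi> ^^ m) x) < r"
    "evaluates (fps_iterate F m) x ((\<phi> ^^ m) x)"
proof -
  have \<phi>_le: "absv (\<phi> x) \<le> absv x" if x: "absv x < r" for x
  proof -
    have "absv (\<phi> x - 0) \<le> absv x"
    proof (rule absv_sums_dist_le[OF \<phi>[OF x], of 0])
      fix M
      have "absv (F $ i * x ^ i) \<le> absv x" for i
      proof (cases "i = 0")
        case True
        then show ?thesis using F absv_nonneg by simp
      next
        case False
        have "absv (F $ i * x ^ i) \<le> r * (absv x / r) ^ i"
          by (rule gauss_le_term_le[OF F(1) r])
        also have "\<dots> \<le> r * (absv x / r) ^ 1"
          using False x r absv_nonneg[of x] by (intro mult_left_mono power_decreasing) auto
        finally show ?thesis using r by simp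
      qed
      then have "absv (\<Sum>i<M. F $ i * x ^ i) \<le> absv x"
        by (intro absv_sum_le) (auto simp: absv_nonneg)
      then show "absv ((\<Sum>i<M. F $ i * x ^ i) - 0) \<le> absv x" by simp
    qed
    then show ?thesis by simp
  qed
  have gb: "gauss_le r (fps_iterate F m) r" for m
    by (induction m) (auto simp: fps_iterate_Suc gauss_le_X r intro: gauss_le_compose F)
  then show "gauss_le r (fps_iterate F m) r" .
  have "absv ((\<phi> ^^ m) x) < r \<and> evaluates (fps_iterate F m) x ((\<phi> ^^ m) x)"
  proof (induction m)
    case 0
    then show ?case using x absv_sums_X[of x] by simp
  next
    case (Suc m)
    then have "absv ((\<phi> ^^ Suc m) x) < r"
      using \<phi>_le[of "(\<phi> ^^ m) x"] by simp
    moreover have "evaluates (F oo fps_iterate F m) x (\<phi> ((\<phi> ^^ m) x))"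
      using Suc by (intro absv_sums_compose[OF F(1) gb _ r x]) (auto intro: fps_iterate_nth_0 F \<phi>)
    ultimately show ?case by (simp add: fps_iterate_Suc)
  qed
  then show "absv ((\<phi> ^^ m) x) < r"
    "evaluates (fps_iterate F m) x ((\<phi> ^^ m) x)" by blast+
qed

text \<open>A term strictly larger than all others by a uniform ratio cannot be cancelled by
  them.\<close>

lemma dominant_not_sums_0:
  assumes a: "dominant (absv x) \<theta> a m" "0 \<le> \<theta>" "\<theta> < 1" and x: "x \<noteq> 0"
  shows "\<not> evaluates a x 0"
proof
  assume s: "evaluates a x 0"
  define L where "L = absv (a $ m) * absv x ^ m"
  have L: "0 < L" using a x by (simp add: L_def dominant_def absv_pos_iff)
  have "absv (0 - a $ m * x ^ m) \<le> \<theta> * L"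
  proof (rule absv_sums_dist_le[OF s])
    fix M assume "Suc m \<le> M"
    then have "(\<Sum>i<M. a $ i * x ^ i) - a $ m * x ^ m = (\<Sum>i\<in>{..<M} - {m}. a $ i * x ^ i)"
      by (subst sum.remove[of _ m]) auto
    also have "absv \<dots> \<le> \<theta> * L"
      by (rule absv_sum_le) (use a L in \<open>auto simp: dominant_def absv_mult absv_power L_def\<close>)
    finally show "absv ((\<Sum>i<M. a $ i * x ^ i) - a $ m * x ^ m) \<le> \<theta> * L" .
  qed
  then have "L \<le> \<theta> * L"
    by (simp add: absv_mult absv_power L_def)
  with L a show False by simp
qed

lemma gauss_le_if_absv_sums:
  assumes "evaluates F x s"
  shows "\<exists>C. gauss_le (absv x) F C"
proof -
  have "(\<lambda>N. absv ((\<Sum>i<N. F $ i * x ^ i) - s)) \<longlonglongrightarrow> 0"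
    using assms by (simp add: absv_sums_def)
  then have "Bseq (\<lambda>N. absv ((\<Sum>i<N. F $ i * x ^ i) - s))"
    by (intro convergent_imp_Bseq convergentI)
  then obtain C where C: "\<And>N. absv ((\<Sum>i<N. F $ i * x ^ i) - s) \<le> C"
    by (auto simp: Bseq_def absv_nonneg)
  have "absv (F $ i) * absv x ^ i \<le> C" for i
  proof -
    have "F $ i * x ^ i = ((\<Sum>i<Suc i. F $ i * x ^ i) - s) - ((\<Sum>i<i. F $ i * x ^ i) - s)"
      by simp
    also have "absv \<dots> \<le> C"
      by (intro absv_diff_le C)
    finally show ?thesis by (simp add: absv_mult absv_power)
  qed
  then show ?thesis by (auto simp: gauss_le_def)
qed

lemma gauss_le_shrink:
  assumes F: "gauss_le \<rho> F C" "F $ 0 = 0" "absv (F $ 1) = 1" and \<rho>: "0 < \<rho>"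
  obtains r where "0 < r" "r \<le> \<rho>" "gauss_le r F r"
proof -
  \<comment> \<open>The terms of degree at least 2 are bounded by C (r / \<rho>)^2, which is at most
    r once C r \<le> \<rho>^2. The linear term is exactly r.\<close>
  define r where "r = min \<rho> (\<rho>\<^sup>2 / (C + 1))"
  have C: "0 \<le> C" using F(1) by (rule gauss_le_nonneg)
  have r: "0 < r" "r \<le> \<rho>" using \<rho> C by (simp_all add: r_def)
  have "absv (F $ i) * r ^ i \<le> r" for i
  proof -
    consider "i = 0" | "i = 1" | "i \<ge> 2" by linarith
    then show ?thesis
    proof cases
      case 3
      have "absv (F $ i) * r ^ i = (absv (F $ i) * \<rho> ^ i) * (r / \<rho>) ^ i"
        using \<rho> by (simp add: power_divide)
      also have "\<dots> \<le> C * (r / \<rho>) ^ 2"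
        using F r 3 C \<rho> by (intro mult_mono power_decreasing) (auto simp: gauss_le_def)
      also have "\<dots> = (C * r / \<rho>\<^sup>2) * r"
        by (simp add: power2_eq_square)
      also have "\<dots> \<le> 1 * r"
      proof (rule mult_right_mono)
        have "C * r \<le> (C + 1) * r" using r by simp
        also have "\<dots> \<le> (C + 1) * (\<rho>\<^sup>2 / (C + 1))"
          using C by (intro mult_left_mono) (auto simp: r_def)
        also have "\<dots> = \<rho>\<^sup>2" using C by simp
        finally show "C * r / \<rho>\<^sup>2 \<le> 1"
          using \<rho> by simp
      qed (use r in simp)
      finally show ?thesis by simp
    qed (use F r in auto)
  qed
  then show ?thesis
    using r by (intro that[of r]) (auto simp: gauss_le_def)
qed

lemma funpow_fixed_mult:
  assumes "(f ^^ m) x = x"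
  shows "(f ^^ (m * k)) x = x"
proof (induction k)
  case (Suc k)
  then show ?case using assms by (simp add: funpow_add)
qed simp

text \<open>If x is fixed by the m-th iterate, it is fixed by the m-th iterate of \<open>g\<close>.
  Writing m = p^e M with p not dividing M, the displacement of that iterate has a dominant monomial
  at every small radius, hence no zero x other than 0.\<close>

theorem minimally_ramified_isolated_fixed_point:
  assumes p: "prime p" "CHAR('k) = p" and F: "minimally_ramified p F"
    and \<rho>: "0 < \<rho>" and \<phi>: "\<And>x. absv x < \<rho> \<Longrightarrow> evaluates F x (\<phi> x)"
  shows "\<exists>r>0. \<forall>x. absv x < r \<and> (\<exists>m\<ge>1. (\<phi> ^^ m) x = x) \<longrightarrow> x = 0"
proof (cases "\<exists>x1. x1 \<noteq> 0 \<and> absv x1 < \<rho>")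
  case False
  then show ?thesis using \<rho> by blast
next
  case True
  \<comment> \<open>Convergence at a nonzero point provides a radius at which the coefficients of F
    are bounded. Without such a point, as for a trivial absolute value, the disc is reduced to
    0.\<close>
  then obtain x1 where x1: "x1 \<noteq> 0" "absv x1 < \<rho>" by blast
  obtain C where C: "gauss_le (absv x1) F C"
    using gauss_le_if_absv_sums[OF \<phi>[OF x1(2)]] by blast
  have par: "parabolic F" using F by (simp add: minimally_ramified_def)
  then have F0: "F $ 0 = 0" and root: "root_of_unity (multiplier F)"
    by (simp_all add: parabolic_def)
  have "absv (F $ 1) = 1"
    using root by (auto simp: root_of_unity_def multiplier_def intro: absv_eq_1_if_power_eq_1)
  then obtain r1 where r1: "0 < r1" "r1 \<le> absv x1" "gauss_le r1 F r1"
    using gauss_le_shrink[OF C F0] x1 by (auto simp: absv_pos_iff)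
  define q where "q = unity_order (multiplier F)"
  have q: "1 \<le> q" unfolding q_def using root by (rule unity_order)
  \<comment> \<open>The exponent is q p and not q because the order inequality fails for the q-th
    iterate, where s = q.\<close>
  define g where "g = fps_iterate F (q * p)"
  have ord: "exact_order (g - fps_X) (q * (1 + p) + 1)"
      "exact_order (fps_iterate g p - fps_X) (q * (1 + p + p ^ 2) + 1)"
    using F minimally_ramified_iff_orders[OF p par q_def q]
    by (simp_all add: g_def fps_iterate_mult[symmetric] fps_iterate_nth_0 F0 power2_eq_square mult.assoc)
  have g0: "g $ 0 = 0" by (simp add: g_def fps_iterate_nth_0 F0)
  have \<phi>1: "evaluates F x (\<phi> x)" if "absv x < r1" for x
    using \<phi> that r1 x1 by simp
  have "gauss_le r1 g r1"
    unfolding g_def using absv_sums_iterate(1)[OF r1(3) F0 r1(1) \<phi>1, of 0] r1 by simp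
  then have "gauss_le r1 (g - fps_X) r1"
    by (intro gauss_le_diff gauss_le_X r1)
  moreover have "2 * q < q * (1 + p)"
    using q prime_ge_2_nat[OF p(1)] by simp
  ultimately have "eventually (\<lambda>r. ramified_state p r (1/2) g (q * (1 + p)) ((p - 1) * (q * (1 + p)) + q)) (at_right 0)"
    using ord r1(1) g0 by (intro eventually_ramified_state_if_orders[OF p, of _ g r1])
      (auto simp: algebra_simps power2_eq_square)
  then obtain b where b: "0 < b" and state: "\<And>r. 0 < r \<Longrightarrow> r < b \<Longrightarrow>
      ramified_state p r (1/2) g (q * (1 + p)) ((p - 1) * (q * (1 + p)) + q)"
    unfolding eventually_at_right_field by blast
  have "x = 0" if x: "absv x < min b r1" and m: "1 \<le> m" "(\<phi> ^^ m) x = x" for x m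
  proof (rule ccontr)
    assume "x \<noteq> 0"
    then have R: "0 < absv x" by (simp add: absv_pos_iff)
    have "m \<noteq> 0" "\<not> is_unit p" using m p(1) by auto
    then obtain M where M: "m = p ^ multiplicity p m * M" "\<not> p dvd M"
      using multiplicity_decompose'[of m p] by auto
    define e where "e = multiplicity p m"
    define h where "h = fps_iterate g (p ^ e)"
    have h0: "h $ 0 = 0" by (simp add: h_def fps_iterate_nth_0 g0)
    \<comment> \<open>The radius is |x| itself: dominance on the circle through x excludes a zero at
      x. The bound \<open>b\<close> is independent of m, which gives the uniformity.\<close>
    from ramified_state_iterate[OF p _ _ R state, of e]
    have "dominant (absv x) (1/2) (fps_iterate h M - fps_X)
        (q * (1 + p) + ((p - 1) * (q * (1 + p)) + q) * (\<Sum>j<e. p ^ j) + 1)"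
      using R x by (intro dominant_iterate_coprime[OF p M(2) _ _ R h0])
        (auto simp: h_def[symmetric] ramified_state_def Let_def)
    then have "\<not> evaluates (fps_iterate h M - fps_X) x 0"
      using \<open>x \<noteq> 0\<close> by (intro dominant_not_sums_0) auto
    moreover have "fps_iterate h M = fps_iterate F (m * (q * p))"
      unfolding h_def g_def
      by (simp add: fps_iterate_mult[symmetric] fps_iterate_nth_0 F0 M(1)[folded e_def] mult_ac)
    moreover have "evaluates (fps_iterate F (m * (q * p))) x ((\<phi> ^^ (m * (q * p))) x)"
      using x by (intro absv_sums_iterate(3)[OF r1(3) F0 r1(1) \<phi>1]) auto
    then have "absv_sums absv (\<lambda>i. fps_iterate F (m * (q * p)) $ i * x ^ i - fps_X $ i * x ^ i) (x - x)"
      unfolding funpow_fixed_mult[OF m(2)] by (intro absv_sums_diff absv_sums_X)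
    ultimately show False
      by (simp add: left_diff_distrib)
  qed
  then show ?thesis
    using b r1 by (intro exI[of _ "min b r1"]) auto
qed

end

lemma funpow_conj_translation:
  fixes f :: "'k::ab_group_add \<Rightarrow> 'k"
  shows "((\<lambda>x. (f ^^ n) (x + z0) - z0) ^^ m) x = (f ^^ (n * m)) (x + z0) - z0"
  by (induction m) (simp_all add: funpow_add)

theorem minimally_ramified_imp_isolated_periodic_point:
  fixes absv :: "'k::field \<Rightarrow> real"
  assumes p: "prime p" "CHAR('k) = p" and "ultrametric_field absv"
    and z0: "periodic_point U f z0"
    and F: "has_expansion_at_0 absv (\<lambda>x. (f ^^ n) (x + z0) - z0) F" "minimally_ramified p F"
  shows "isolated_periodic_point absv U f z0"
proof -
  interpret ultrametric_field absv by fact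
  let ?\<phi> = "\<lambda>x. (f ^^ n) (x + z0) - z0"
  obtain \<rho> where "0 < \<rho>" "\<And>x. absv x < \<rho> \<Longrightarrow> evaluates F x (?\<phi> x)"
    using F(1) unfolding has_expansion_at_0_def by blast
  then obtain r where r: "0 < r"
    and iso: "\<And>x m. absv x < r \<Longrightarrow> 1 \<le> m \<Longrightarrow> (?\<phi> ^^ m) x = x \<Longrightarrow> x = 0"
    using minimally_ramified_isolated_fixed_point[OF p F(2), of \<rho> ?\<phi>] by blast
  have "z = z0" if z: "absv (z - z0) < r" "periodic_point U f z" for z
  proof -
    obtain m where m: "1 \<le> m" "(f ^^ m) z = z"
      using z(2) by (auto simp: periodic_point_def fixed_by_iterate_def)
    \<comment> \<open>Passing from the period m to its multiple n m makes z a fixed point of the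
      m-th iterate of f^n, the map that F expands.\<close>
    then have "(f ^^ (n * m)) z = z"
      using funpow_fixed_mult[where f = f and m = m and x = z and k = n] by (simp add: mult.commute)
    then have "(?\<phi> ^^ m) (z - z0) = z - z0"
      unfolding funpow_conj_translation by simp
    with iso z m show ?thesis by fastforce
  qed
  then show ?thesis
    using z0 r unfolding isolated_periodic_point_def by blast
qed

section \<open>Genericity\<close>

lemma X_power_dvd_iff: "fps_X ^ n dvd (a :: 'k::field fps) \<longleftrightarrow> (\<forall>i<n. a $ i = 0)"
proof
  assume "fps_X ^ n dvd a"
  then show "\<forall>i<n. a $ i = 0"
    by (auto simp: dvd_def fps_X_power_mult_nth)
next
  assume "\<forall>i<n. a $ i = 0"
  then have "a = fps_X ^ n * fps_shift n a"
    by (intro fps_ext) (auto simp: fps_X_power_mult_nth)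
  then show "fps_X ^ n dvd a" by (rule dvdI)
qed

text \<open>The cofactor of G - H in G^i - H^i is homogeneous of degree i - 1 in two series without
  constant term.\<close>

lemma X_power_dvd_power_diff:
  fixes G H :: "'k::field fps"
  assumes "fps_X ^ n dvd G - H" "G $ 0 = 0" "H $ 0 = 0" "1 \<le> i"
  shows "fps_X ^ (n + i - 1) dvd G ^ i - H ^ i"
proof -
  have "fps_X dvd G" "fps_X dvd H"
    using X_power_dvd_iff[of 1 G] X_power_dvd_iff[of 1 H] assms by auto
  then have "fps_X ^ (i - 1) dvd (\<Sum>j<i. H ^ (i - Suc j) * G ^ j)"
  proof (intro dvd_sum)
    fix j assume "fps_X dvd G" "fps_X dvd H" "j \<in> {..<i}"
    then have "fps_X ^ (i - Suc j) * fps_X ^ j dvd H ^ (i - Suc j) * G ^ j"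
      by (intro mult_dvd_mono dvd_power_same)
    with \<open>j \<in> _\<close> show "fps_X ^ (i - 1) dvd H ^ (i - Suc j) * G ^ j"
      by (simp flip: power_add)
  qed
  then have "fps_X ^ n * fps_X ^ (i - 1) dvd (G - H) * (\<Sum>j<i. H ^ (i - Suc j) * G ^ j)"
    by (intro mult_dvd_mono assms)
  then show ?thesis
    using assms(4) by (simp add: power_diff_sumr2 flip: power_add)
qed

text \<open>The gain m - 1 in precision is the point: with n = q + 1 and m = q it lets knowledge
  modulo X^(q+1) determine a composite modulo X^(2q).\<close>

lemma X_power_dvd_compose_diff:
  fixes G H :: "'k::field fps"
  assumes "fps_X ^ n dvd G - H" "G $ 0 = 0" "H $ 0 = 0" "1 \<le> m" and \<phi>: "\<And>i. 1 \<le> i \<Longrightarrow> i < m \<Longrightarrow> \<phi> $ i = 0"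
  shows "fps_X ^ (n + m - 1) dvd (\<phi> oo G) - (\<phi> oo H)"
  unfolding X_power_dvd_iff
proof (intro allI impI)
  fix k assume k: "k < n + m - 1"
  have "((\<phi> oo G) - (\<phi> oo H)) $ k = (\<Sum>i=0..k. \<phi> $ i * (G ^ i - H ^ i) $ k)"
    by (simp add: fps_compose_nth sum_subtractf right_diff_distrib)
  also have "\<dots> = 0"
  proof (rule sum.neutral, rule ballI)
    fix i assume "i \<in> {0..k}"
    show "\<phi> $ i * (G ^ i - H ^ i) $ k = 0"
    proof (cases "i < m")
      case True
      then show ?thesis using \<phi>[of i] by (cases i) auto
    next
      case False
      then have "fps_X ^ (n + i - 1) dvd G ^ i - H ^ i"
        using assms by (intro X_power_dvd_power_diff) auto
      then show ?thesis
        using k False unfolding X_power_dvd_iff by auto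
    qed
  qed
  finally show "((\<phi> oo G) - (\<phi> oo H)) $ k = 0" .
qed

lemma X_power_dvd_diff_op:
  assumes "fps_X ^ n dvd g - fps_X" "g $ 0 = 0"
  shows "fps_X ^ n dvd diff_op g \<phi>"
  using X_power_dvd_compose_diff[of n g fps_X 1 \<phi>] assms by (simp add: diff_op_def)

text \<open>The modulus is a general divisor z of y^3 because for y = X^q the precision kept is
  X^(2q+1), which divides X^(3q).\<close>

lemma power_quadratic_cong:
  fixes a b y U z :: "'a::comm_ring_1"
  assumes U: "z dvd U - (1 + a * y + b * y\<^sup>2)" and y: "z dvd y ^ 3"
  shows "z dvd U ^ m - (1 + of_nat m * a * y + (of_nat m * b + of_nat (m choose 2) * a\<^sup>2) * y\<^sup>2)"
proof (induction m)
  case (Suc m)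
  define P where "P m = 1 + of_nat m * a * y + (of_nat m * b + of_nat (m choose 2) * a\<^sup>2) * y\<^sup>2" for m
  have "(Suc m choose 2) = m + (m choose 2)"
    by (simp add: numeral_2_eq_2)
  then have "U ^ Suc m - P (Suc m) = U ^ m * (U - (1 + a * y + b * y\<^sup>2)) + (1 + a * y + b * y\<^sup>2) * (U ^ m - P m)
     + y ^ 3 * (of_nat m * a * b + a * (of_nat m * b + of_nat (m choose 2) * a\<^sup>2)
         + y * b * (of_nat m * b + of_nat (m choose 2) * a\<^sup>2))"
    unfolding P_def by (simp add: algebra_simps power2_eq_square power3_eq_cube)
  moreover have "z dvd \<dots>"
    using U Suc y unfolding P_def[symmetric] by (intro dvd_add dvd_mult dvd_mult2)
  ultimately show ?case
    unfolding P_def by simp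
qed (simp add: binomial_eq_0)

lemma inverse_quadratic_cong:
  fixes a b y W U z :: "'a::comm_ring_1"
  assumes W: "z dvd W - (1 + a * y + b * y\<^sup>2)" and y: "z dvd y ^ 3" and WU: "W * U = 1"
  shows "z dvd U - (1 - a * y + (a\<^sup>2 - b) * y\<^sup>2)"
proof -
  let ?P = "1 - a * y + (a\<^sup>2 - b) * y\<^sup>2"
  have "U - ?P = U - ?P * (W * U)"
    by (simp add: WU)
  also have "\<dots> = - U * (?P * (W - (1 + a * y + b * y\<^sup>2)) + y ^ 3 * (- a * b + a * (a\<^sup>2 - b) + b * (a\<^sup>2 - b) * y))"
    by (simp add: algebra_simps power2_eq_square power3_eq_cube)
  finally have "U - ?P = \<dots>" .
  moreover have "z dvd \<dots>"
    using W y by (intro dvd_add dvd_mult dvd_mult2)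
  ultimately show ?thesis by (simp only:)
qed

subsection \<open>The coordinate at infinity\<close>

text \<open>In the coordinate \<open>t = X ^ (- q)\<close> the relation \<open>inf_coord q f \<Theta>\<close> reads
  \<open>t \<circ> f = t + \<Theta>\<close>; it is multiplied out to avoid negative powers.\<close>

definition inf_coord :: "nat \<Rightarrow> 'k::field fps \<Rightarrow> 'k fps \<Rightarrow> bool" where
  "inf_coord q f \<Theta> \<longleftrightarrow> fps_X ^ q = f ^ q * (1 + fps_X ^ q * \<Theta>)"

text \<open>In the coordinate t this is the cocycle rule: t after f after g is (t + \<Theta>) after
  g, which is t + \<Phi> + (\<Theta> after g). Iterates therefore lead to orbit sums of
  \<Theta>.\<close>

lemma inf_coord_compose:
  fixes f g :: "'k::field fps"
  assumes g0: "g $ 0 = 0" and f: "inf_coord q f \<Theta>" and g: "inf_coord q g \<Phi>"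
  shows "inf_coord q (f oo g) ((\<Theta> oo g) + \<Phi>)"
proof -
  have "(fps_X ^ q) oo g = (f ^ q * (1 + fps_X ^ q * \<Theta>)) oo g"
    using f by (simp add: inf_coord_def)
  then have 1: "g ^ q = (f oo g) ^ q * (1 + g ^ q * (\<Theta> oo g))"
    by (simp add: fps_compose_mult_distrib[OF g0] fps_compose_add_distrib g0
        fps_compose_power[OF g0, symmetric])
  have 2: "fps_X ^ q = g ^ q * (1 + fps_X ^ q * \<Phi>)"
    using g by (simp add: inf_coord_def)
  have "(f oo g) ^ q * (1 + fps_X ^ q * ((\<Theta> oo g) + \<Phi>))
      = (f oo g) ^ q * (1 + fps_X ^ q * \<Phi> + fps_X ^ q * (\<Theta> oo g))"
    by (simp add: algebra_simps)
  also have "\<dots> = (f oo g) ^ q * (1 + fps_X ^ q * \<Phi> + g ^ q * (1 + fps_X ^ q * \<Phi>) * (\<Theta> oo g))"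
    using 2 by simp
  also have "\<dots> = (f oo g) ^ q * (1 + g ^ q * (\<Theta> oo g)) * (1 + fps_X ^ q * \<Phi>)"
    by (simp add: algebra_simps)
  also have "\<dots> = fps_X ^ q"
    using 1 2 by simp
  finally show ?thesis by (simp add: inf_coord_def)
qed

lemma inf_coord_iterate:
  fixes f :: "'k::field fps"
  assumes f0: "f $ 0 = 0" and f: "inf_coord q f \<Theta>"
  shows "inf_coord q (fps_iterate f m) (\<Sum>j<m. \<Theta> oo fps_iterate f j)"
proof (induction m)
  case 0
  then show ?case by (simp add: inf_coord_def)
next
  case (Suc m)
  show ?case
    using inf_coord_compose[OF fps_iterate_nth_0[OF f0] f Suc]
    by (simp add: fps_iterate_Suc add.commute)
qed

lemma exact_order_0_iff: "exact_order a 0 \<longleftrightarrow> a $ 0 \<noteq> 0"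
  by (simp add: exact_order_def)

lemma exact_order_X_power_mult: "exact_order (fps_X ^ n * a) (m + n) \<longleftrightarrow> exact_order (a :: 'k::field fps) m"
  using exact_order_mult_iff[of "fps_X ^ n" n a m]
  by (simp add: mult.commute) (simp add: exact_order_def fps_X_power_nth)

lemma exact_order_unit_mult:
  fixes a u :: "'k::field fps"
  assumes "u $ 0 \<noteq> 0"
  shows "exact_order (u * a) m \<longleftrightarrow> exact_order a m"
  using exact_order_mult_iff[of u 0 a m] assms by (simp add: exact_order_0_iff mult.commute)

text \<open>With g = X v the relation says v^q (1 + X^q \<Theta>) = 1. The factor (v^q - 1) / (v -
  1) has constant term q, so it is a unit because q is nonzero in the field, and v - 1 is a unit
  times X^q \<Theta>.\<close>

lemma inf_coord_minus_X:
  fixes g :: "'k::field fps"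
  assumes g: "g $ 0 = 0" "g $ 1 = 1" and q: "(of_nat q :: 'k) \<noteq> 0"
    and coord: "inf_coord q g \<Theta>"
  obtains u where "u $ 0 \<noteq> 0" "g - fps_X = fps_X ^ (q + 1) * (u * \<Theta>)"
proof -
  define v where "v = fps_shift 1 g"
  have gv: "g = fps_X * v"
    using fps_decompose_shift[of g] g by (simp add: v_def)
  have v0: "v $ 0 = 1" using g by (simp add: v_def)
  have "fps_X ^ q * 1 = fps_X ^ q * (v ^ q * (1 + fps_X ^ q * \<Theta>))"
    using coord by (simp add: inf_coord_def gv power_mult_distrib mult.assoc)
  then have "1 = v ^ q * (1 + fps_X ^ q * \<Theta>)"
    by (subst (asm) mult_left_cancel) simp_all
  then have "v ^ q - 1 = - (v ^ q) * (fps_X ^ q * \<Theta>)"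
    by (simp add: algebra_simps)
  moreover define S where "S = (\<Sum>i<q. v ^ i)"
  have "v ^ q - 1 = S * (v - 1)"
    by (simp add: S_def power_diff_1_eq mult.commute)
  moreover have "S $ 0 \<noteq> 0"
    using q by (simp add: S_def fps_sum_nth fps_nth_power_0 v0)
  then have "inverse S * S = 1"
    by (rule inverse_mult_eq_1)
  ultimately have "v - 1 = inverse S * (- (v ^ q) * (fps_X ^ q * \<Theta>))"
    by (metis mult.assoc mult_1)
  moreover have "g - fps_X = fps_X * (v - 1)"
    by (simp add: gv algebra_simps)
  ultimately have "g - fps_X = fps_X ^ (q + 1) * ((- inverse S * v ^ q) * \<Theta>)"
    by (simp only:) (simp add: mult_ac)
  moreover have "(- inverse S * v ^ q) $ 0 \<noteq> 0"
    using \<open>S $ 0 \<noteq> 0\<close> by (simp add: fps_nth_power_0 v0)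
  ultimately show ?thesis by (rule that[rotated])
qed

lemma exact_order_if_inf_coord:
  fixes g :: "'k::field fps"
  assumes g: "g $ 0 = 0" "g $ 1 = 1" and q: "(of_nat q :: 'k) \<noteq> 0"
    and coord: "inf_coord q g \<Theta>"
  shows "exact_order (g - fps_X) (q + n + 1) \<longleftrightarrow> exact_order \<Theta> n"
proof -
  obtain u where u: "u $ 0 \<noteq> 0" and eq: "g - fps_X = fps_X ^ (q + 1) * (u * \<Theta>)"
    by (rule inf_coord_minus_X[OF assms])
  have "q + n + 1 = n + (q + 1)" by simp
  then show ?thesis
    by (simp only: eq exact_order_X_power_mult exact_order_unit_mult[OF u])
qed

lemma X_power_dvd_if_inf_coord:
  fixes g :: "'k::field fps"
  assumes g: "g $ 0 = 0" "g $ 1 = 1" and q: "(of_nat q :: 'k) \<noteq> 0"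
    and coord: "inf_coord q g \<Theta>" and n: "fps_X ^ n dvd \<Theta>"
  shows "fps_X ^ (q + n + 1) dvd g - fps_X"
proof -
  obtain u where "g - fps_X = fps_X ^ (q + 1) * (u * \<Theta>)"
    by (rule inf_coord_minus_X[OF g q coord])
  moreover have "fps_X ^ (q + 1) * fps_X ^ n dvd fps_X ^ (q + 1) * (u * \<Theta>)"
    using n by (intro mult_dvd_mono) auto
  moreover have "q + n + 1 = (q + 1) + n" by simp
  ultimately show ?thesis
    by (simp only: power_add)
qed

lemma diff_op_X_power_mult:
  fixes g :: "'k::field fps"
  assumes g0: "g $ 0 = 0" and U: "g ^ q = fps_X ^ q * U"
  shows "diff_op g (fps_X ^ (q * m) * \<Psi>) = fps_X ^ (q * m) * (U ^ m * (\<Psi> oo g) - \<Psi>)"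
proof -
  have "g ^ (q * m) = fps_X ^ (q * m) * U ^ m"
    by (simp add: power_mult U power_mult_distrib)
  then show ?thesis
    by (simp add: diff_op_def fps_compose_mult_distrib[OF g0] fps_compose_power[OF g0, symmetric]
        g0 algebra_simps)
qed

lemma inf_coord_power_eq:
  fixes g :: "'k::field fps"
  assumes "inf_coord q g \<Theta>" "1 \<le> q"
  shows "g ^ q = fps_X ^ q * inverse (1 + fps_X ^ q * \<Theta>)"
proof -
  let ?W = "1 + fps_X ^ q * \<Theta>"
  have "?W * inverse ?W = 1"
    using assms(2) by (intro inverse_mult_eq_1') (simp add: fps_X_power_mult_nth)
  then have "g ^ q = g ^ q * (?W * inverse ?W)" by simp
  also have "\<dots> = (g ^ q * ?W) * inverse ?W"
    by (simp only: mult.assoc)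
  also have "g ^ q * ?W = fps_X ^ q"
    using assms(1) by (simp only: inf_coord_def)
  finally show ?thesis .
qed


lemma expand_to_second_order:
  fixes E :: "'k::field fps"
  assumes "fps_X ^ (2 * q + 1) dvd E - (fps_const a * fps_X ^ q + fps_const b * (fps_X ^ q)\<^sup>2)"
  obtains \<Psi> where "E = fps_X ^ q * (fps_const a + fps_X ^ q * \<Psi>)" "\<Psi> $ 0 = b"
proof -
  obtain R where R: "E - (fps_const a * fps_X ^ q + fps_const b * (fps_X ^ q)\<^sup>2) = fps_X ^ (2 * q + 1) * R"
    using assms by (rule dvdE)
  show ?thesis
  proof
    have "fps_X ^ (2 * q + 1) = (fps_X :: 'k fps) ^ q * (fps_X ^ q * fps_X)"
      by (simp add: power_add mult_2)
    with R show "E = fps_X ^ q * (fps_const a + fps_X ^ q * (fps_const b + fps_X * R))"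
      by (simp add: algebra_simps power2_eq_square)
    show "(fps_const b + fps_X * R) $ 0 = b" by simp
  qed
qed

text \<open>In the coordinate \<open>t\<close> the map \<open>g\<close> is \<open>t \<mapsto> t - A + \<rho> / t + \<dots>\<close>, so the difference
  operator sends \<open>t ^ (- m)\<close> to \<open>m A t ^ (- m - 1) + ((m + 1 choose 2) A\<^sup>2 - m \<rho>) t ^ (- m - 2) + \<dots>\<close>.\<close>

lemma diff_op_translation_step:
  fixes g :: "'k::field fps"
  assumes g: "g $ 0 = 0" "g $ 1 = 1" and q: "1 \<le> q" "(of_nat q :: 'k) \<noteq> 0"
    and coord: "inf_coord q g \<Theta>"
    and \<Theta>: "fps_X ^ (q + 1) dvd \<Theta> - (fps_const (- A) + fps_const \<rho> * fps_X ^ q)"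
  obtains \<Psi>' where "diff_op g (fps_X ^ (q * m) * (fps_const x + fps_X ^ q * \<Psi>)) =
       fps_X ^ (q * Suc m) * (fps_const (of_nat m * A * x) + fps_X ^ q * \<Psi>')"
     "\<Psi>' $ 0 = of_nat (Suc m) * A * \<Psi> $ 0 + (of_nat (Suc m choose 2) * A\<^sup>2 - of_nat m * \<rho>) * x"
proof -
  let ?y = "fps_X ^ q :: 'k fps" and ?z = "fps_X ^ (2 * q + 1) :: 'k fps"
  have "q * 3 = (2 * q + 1) + (q - 1)" using q by simp
  then have "?y ^ 3 = ?z * fps_X ^ (q - 1)"
    by (simp only: power_mult[symmetric] power_add)
  then have z3: "?z dvd ?y ^ 3" by (rule dvdI)
  define W U where "W = 1 + ?y * \<Theta>" and "U = inverse W"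
  have "W $ 0 \<noteq> 0" using q by (simp add: W_def fps_X_power_mult_nth)
  then have WU: "W * U = 1" unfolding U_def by (rule inverse_mult_eq_1')
  have gU: "g ^ q = ?y * U"
    unfolding U_def W_def by (rule inf_coord_power_eq[OF coord q(1)])
  have "W - (1 + fps_const (- A) * ?y + fps_const \<rho> * ?y\<^sup>2)
      = ?y * (\<Theta> - (fps_const (- A) + fps_const \<rho> * ?y))"
    by (simp add: W_def algebra_simps power2_eq_square)
  moreover have "?y * fps_X ^ (q + 1) dvd \<dots>"
    using \<Theta> by (intro mult_dvd_mono) auto
  moreover have yz: "?z = ?y * fps_X ^ (q + 1)"
    by (simp add: power_add mult_2)
  ultimately have "?z dvd W - (1 + fps_const (- A) * ?y + fps_const \<rho> * ?y\<^sup>2)"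
    by (simp only:)
  from inverse_quadratic_cong[OF this z3 WU]
  have "?z dvd U - (1 + fps_const A * ?y + fps_const (A\<^sup>2 - \<rho>) * ?y\<^sup>2)"
    by (simp add: power2_eq_square fps_const_neg[symmetric] del: fps_const_neg)
  note Upow = power_quadratic_cong[OF this z3]
  define c where "c m = of_nat m * (A\<^sup>2 - \<rho>) + of_nat (m choose 2) * A\<^sup>2" for m
  have Upow: "?z dvd U ^ m - (1 + fps_const (of_nat m * A) * ?y + fps_const (c m) * ?y\<^sup>2)" for m
    using Upow[of m] by (simp add: c_def power2_eq_square flip: fps_of_nat)
  have y1: "fps_X ^ (q + 1) dvd ?z" "fps_X ^ (q + 1) dvd ?y\<^sup>2"
    unfolding power_mult[symmetric] by (rule le_imp_power_dvd, use q in simp)+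
  have Upow1: "fps_X ^ (q + 1) dvd U ^ m - (1 + fps_const (of_nat m * A) * ?y)" for m
  proof -
    have "fps_X ^ (q + 1) dvd (U ^ m - (1 + fps_const (of_nat m * A) * ?y + fps_const (c m) * ?y\<^sup>2))
        + fps_const (c m) * ?y\<^sup>2"
      using Upow[of m] y1 by (intro dvd_add dvd_mult) (auto intro: dvd_trans)
    then show ?thesis by (simp add: algebra_simps)
  qed
  \<comment> \<open>For every \<Theta> the displacement g - X is divisible by X^(q+1), so replacing
    \<open>\<Psi> oo g\<close> by \<Psi> is harmless at this precision.\<close>
  have "fps_X ^ 0 dvd \<Theta>" by simp
  from X_power_dvd_if_inf_coord[OF g q(2) coord this]
  have d\<Psi>: "fps_X ^ (q + 1) dvd (\<Psi> oo g) - \<Psi>"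
    using X_power_dvd_diff_op[of "q + 1" g \<Psi>] g by (simp add: diff_op_def)
  have \<Psi>0: "fps_X dvd (\<Psi> oo g) - fps_const (\<Psi> $ 0)"
    using X_power_dvd_iff[of 1 "(\<Psi> oo g) - fps_const (\<Psi> $ 0)"] by simp
  let ?b = "of_nat (Suc m) * A * \<Psi> $ 0"
  have "fps_X ^ (q + 1) dvd U ^ Suc m * (\<Psi> oo g) - \<Psi> - fps_const ?b * ?y"
  proof -
    have "U ^ Suc m * (\<Psi> oo g) - \<Psi> - fps_const ?b * ?y =
      (U ^ Suc m - (1 + fps_const (of_nat (Suc m) * A) * ?y)) * (\<Psi> oo g)
      + fps_const (of_nat (Suc m) * A) * (?y * ((\<Psi> oo g) - fps_const (\<Psi> $ 0)))
      + ((\<Psi> oo g) - \<Psi>)"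
      by (simp add: algebra_simps)
    moreover have "fps_X ^ q * fps_X dvd ?y * ((\<Psi> oo g) - fps_const (\<Psi> $ 0))"
      using \<Psi>0 by (intro mult_dvd_mono) auto
    then have "fps_X ^ (q + 1) dvd ?y * ((\<Psi> oo g) - fps_const (\<Psi> $ 0))"
      by (simp only: power_add power_one_right)
    note dvd_add[OF dvd_add[OF dvd_mult2[OF Upow1] dvd_mult[OF this]] d\<Psi>]
    ultimately show ?thesis by (simp only:)
  qed
  then have "?y * fps_X ^ (q + 1) dvd ?y * (U ^ Suc m * (\<Psi> oo g) - \<Psi> - fps_const ?b * ?y)"
    by (intro mult_dvd_mono) auto
  then have 1: "?z dvd ?y * (U ^ Suc m * (\<Psi> oo g) - \<Psi> - fps_const ?b * ?y)"
    by (simp only: yz)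
  define E where "E = fps_const x * (U ^ m - 1) + ?y * (U ^ Suc m * (\<Psi> oo g) - \<Psi>)"
  have "E - (fps_const (of_nat m * A * x) * ?y + fps_const (?b + c m * x) * ?y\<^sup>2)
     = fps_const x * (U ^ m - (1 + fps_const (of_nat m * A) * ?y + fps_const (c m) * ?y\<^sup>2))
       + ?y * (U ^ Suc m * (\<Psi> oo g) - \<Psi> - fps_const ?b * ?y)"
    by (simp add: E_def algebra_simps power2_eq_square flip: fps_const_add fps_const_mult)
  then have "?z dvd E - (fps_const (of_nat m * A * x) * ?y + fps_const (?b + c m * x) * ?y\<^sup>2)"
    using dvd_add[OF dvd_mult[OF Upow] 1] by (simp only:)
  then obtain \<Psi>' where \<Psi>': "E = ?y * (fps_const (of_nat m * A * x) + ?y * \<Psi>')" "\<Psi>' $ 0 = ?b + c m * x"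
    by (rule expand_to_second_order)
  have "diff_op g (fps_X ^ (q * m) * (fps_const x + ?y * \<Psi>)) =
      diff_op g (fps_X ^ (q * m) * fps_const x) + diff_op g (fps_X ^ (q * Suc m) * \<Psi>)"
    by (simp add: diff_op_add[symmetric] distrib_left power_add mult.assoc mult.left_commute)
  also have "\<dots> = fps_X ^ (q * m) * E"
    unfolding diff_op_X_power_mult[OF g(1) gU] by (simp add: E_def algebra_simps power_add)
  also have "\<dots> = fps_X ^ (q * Suc m) * (fps_const (of_nat m * A * x) + ?y * \<Psi>')"
    unfolding \<Psi>' by (simp add: power_add algebra_simps)
  finally have "diff_op g (fps_X ^ (q * m) * (fps_const x + ?y * \<Psi>)) = \<dots>" .
  moreover have "(Suc m choose 2) = m + (m choose 2)"
    by (simp add: numeral_2_eq_2)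
  then have "c m = of_nat (Suc m choose 2) * A\<^sup>2 - of_nat m * \<rho>"
    by (simp add: c_def algebra_simps)
  with \<Psi>'(2) have "\<Psi>' $ 0 = ?b + (of_nat (Suc m choose 2) * A\<^sup>2 - of_nat m * \<rho>) * x"
    by simp
  ultimately show ?thesis by (rule that)
qed


text \<open>To leading order t^(-m) goes to m A t^(-m-1), which turns t^(-1) into k! A^k t^(-k-1).
  The second coefficient is left unspecified.\<close>

lemma diff_op_translation_iterate:
  fixes g :: "'k::field fps"
  assumes g: "g $ 0 = 0" "g $ 1 = 1" and q: "1 \<le> q" "(of_nat q :: 'k) \<noteq> 0"
    and coord: "inf_coord q g \<Theta>"
    and \<Theta>: "fps_X ^ (q + 1) dvd \<Theta> - (fps_const (- A) + fps_const \<rho> * fps_X ^ q)"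
  shows "\<exists>\<Psi>'. (diff_op g ^^ k) (fps_X ^ (q * 1) * (fps_const \<rho> + fps_X ^ q * \<Psi>)) =
       fps_X ^ (q * Suc k) * (fps_const (of_nat (fact k) * A ^ k * \<rho>) + fps_X ^ q * \<Psi>')"
proof (induction k)
  case (Suc k)
  then obtain \<Psi>' where "(diff_op g ^^ k) (fps_X ^ (q * 1) * (fps_const \<rho> + fps_X ^ q * \<Psi>)) =
       fps_X ^ (q * Suc k) * (fps_const (of_nat (fact k) * A ^ k * \<rho>) + fps_X ^ q * \<Psi>')"
    by blast
  moreover obtain \<Psi>'' where "diff_op g (fps_X ^ (q * Suc k) * (fps_const (of_nat (fact k) * A ^ k * \<rho>) + fps_X ^ q * \<Psi>'))
      = fps_X ^ (q * Suc (Suc k)) * (fps_const (of_nat (Suc k) * A * (of_nat (fact k) * A ^ k * \<rho>)) + fps_X ^ q * \<Psi>'')"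
    by (rule diff_op_translation_step[OF assms])
  moreover have "of_nat (Suc k) * A * (of_nat (fact k) * A ^ k * \<rho>) = of_nat (fact (Suc k)) * A ^ Suc k * \<rho>"
    by (simp add: algebra_simps)
  ultimately show ?case
    by (auto simp only: funpow.simps comp_apply)
qed auto

lemma funpow_diff_op_add_const:
  "(diff_op g ^^ Suc k) (fps_const c + \<phi>) = (diff_op g ^^ Suc k) \<phi>"
  by (induction k) (simp_all add: diff_op_add)

text \<open>The constant -A is killed by the first difference, so the process starts from \<rho> /
  t. The second coefficient is computed only in the last of the p - 1 differences: there the
  previous one enters with the factor p = 0, so leading coefficients suffice up to that point. The
  remaining term -(p - 1) \<rho> is \<rho>.\<close>

lemma coord_prime_iterate:
  fixes g :: "'k::field fps"
  assumes p: "prime p" "CHAR('k) = p"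
    and g: "g $ 0 = 0" "g $ 1 = 1" and q: "1 \<le> q" "(of_nat q :: 'k) \<noteq> 0"
    and coord: "inf_coord q g \<Theta>"
    and \<Theta>: "fps_X ^ (2 * q) dvd \<Theta> - (fps_const (- A) + fps_const \<rho> * fps_X ^ q)"
  obtains \<Psi> where "inf_coord q (fps_iterate g p)
      (fps_X ^ (q * p) * (fps_const (of_nat (fact (p - 1)) * A ^ (p - 1) * \<rho>) + fps_X ^ q * \<Psi>))"
    "\<Psi> $ 0 = (of_nat (p choose 2) * A\<^sup>2 + \<rho>) * (of_nat (fact (p - 2)) * A ^ (p - 2) * \<rho>)"
proof -
  have p2: "p = Suc (Suc (p - 2))" using prime_ge_2_nat[OF p(1)] by simp
  have p0: "(of_nat p :: 'k) = 0" using p(2) by (simp add: of_nat_eq_0_iff_char_dvd)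
  have "fps_X ^ (q + 1) dvd (fps_X :: 'k fps) ^ (2 * q)"
    by (rule le_imp_power_dvd) (use q in simp)
  then have \<Theta>': "fps_X ^ (q + 1) dvd \<Theta> - (fps_const (- A) + fps_const \<rho> * fps_X ^ q)"
    using \<Theta> by (rule dvd_trans)
  obtain \<Psi>0 where \<Psi>0: "\<Theta> - (fps_const (- A) + fps_const \<rho> * fps_X ^ q) = fps_X ^ (2 * q) * \<Psi>0"
    using \<Theta> by (rule dvdE)
  have \<Theta>_eq: "\<Theta> = fps_const (- A) + fps_X ^ (q * 1) * (fps_const \<rho> + fps_X ^ q * \<Psi>0)"
  proof -
    have "(fps_X :: 'k fps) ^ (2 * q) = fps_X ^ q * fps_X ^ q"
      by (simp only: mult_2 power_add)
    with \<Psi>0 show ?thesis by (simp add: algebra_simps)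
  qed
  have "inf_coord q (fps_iterate g p) ((diff_op g ^^ (p - 1)) \<Theta>)"
    using inf_coord_iterate[OF g(1) coord, of p]
    by (simp only: sum_compose_iterates_eq_diff_op[OF g(1) p])
  moreover have p1: "p - 1 = Suc (p - 2)" using p2 by simp
  ultimately have 1: "inf_coord q (fps_iterate g p)
     ((diff_op g ^^ Suc (p - 2)) (fps_X ^ (q * 1) * (fps_const \<rho> + fps_X ^ q * \<Psi>0)))"
    by (simp only: \<Theta>_eq funpow_diff_op_add_const)
  let ?x = "of_nat (fact (p - 2)) * A ^ (p - 2) * \<rho>"
  obtain \<Psi>1 where \<Psi>1: "(diff_op g ^^ (p - 2)) (fps_X ^ (q * 1) * (fps_const \<rho> + fps_X ^ q * \<Psi>0))
     = fps_X ^ (q * Suc (p - 2)) * (fps_const ?x + fps_X ^ q * \<Psi>1)"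
    using diff_op_translation_iterate[OF g q coord \<Theta>'] by blast
  obtain \<Psi> where \<Psi>: "diff_op g (fps_X ^ (q * Suc (p - 2)) * (fps_const ?x + fps_X ^ q * \<Psi>1)) =
       fps_X ^ (q * Suc (Suc (p - 2))) * (fps_const (of_nat (Suc (p - 2)) * A * ?x) + fps_X ^ q * \<Psi>)"
     "\<Psi> $ 0 = of_nat (Suc (Suc (p - 2))) * A * \<Psi>1 $ 0 +
        (of_nat (Suc (Suc (p - 2)) choose 2) * A\<^sup>2 - of_nat (Suc (p - 2)) * \<rho>) * ?x"
    by (rule diff_op_translation_step[OF g q coord \<Theta>'])
  have "of_nat (Suc (p - 2)) * A * ?x = of_nat (fact (p - 1)) * A ^ (p - 1) * \<rho>"
    unfolding p1 fact_Suc power_Suc of_nat_mult of_nat_id by (simp only: mult_ac)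
  then have "inf_coord q (fps_iterate g p)
      (fps_X ^ (q * p) * (fps_const (of_nat (fact (p - 1)) * A ^ (p - 1) * \<rho>) + fps_X ^ q * \<Psi>))"
    using 1 unfolding funpow.simps comp_apply \<Psi>1 \<Psi>(1) p2[symmetric] by (simp only:)
  moreover have "(of_nat (Suc (p - 2)) :: 'k) = - 1"
  proof -
    have "(of_nat (Suc (p - 2)) :: 'k) + 1 = of_nat (Suc (Suc (p - 2)))"
      by simp
    also have "\<dots> = 0" unfolding p2[symmetric] by (rule p0)
    finally show ?thesis by (simp add: eq_neg_iff_add_eq_0 del: of_nat_Suc)
  qed
  then have "\<Psi> $ 0 = (of_nat (p choose 2) * A\<^sup>2 + \<rho>) * ?x"
    using \<Psi>(2) unfolding p2[symmetric] p0 by (simp del: of_nat_Suc)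
  ultimately show ?thesis by (rule that)
qed

lemma power_linear_cong:
  fixes a :: "'k::field"
  assumes "fps_X ^ (N + 1) dvd U - (1 + fps_const a * fps_X ^ N)" "1 \<le> N"
  shows "fps_X ^ (N + 1) dvd U ^ m - (1 + fps_const (of_nat m * a) * fps_X ^ N)"
proof -
  have "(fps_X :: 'k fps) ^ (N + 1) dvd (fps_X ^ N)\<^sup>2"
    unfolding power_mult[symmetric] by (rule le_imp_power_dvd) (use assms in simp)
  then have d: "fps_X ^ (N + 1) dvd b * ((fps_X :: 'k fps) ^ N)\<^sup>2" for b
    by (rule dvd_mult)
  have "(fps_X ^ N :: 'k fps) ^ 3 = (fps_X ^ N) * (fps_X ^ N)\<^sup>2"
    by (simp add: power2_eq_square power3_eq_cube mult_ac)
  then have "fps_X ^ (N + 1) dvd (fps_X ^ N :: 'k fps) ^ 3"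
    using d by (simp only:)
  moreover have "fps_X ^ (N + 1) dvd U - (1 + fps_const a * fps_X ^ N + 0 * (fps_X ^ N)\<^sup>2)"
    using assms by simp
  ultimately have "fps_X ^ (N + 1) dvd
      U ^ m - (1 + of_nat m * fps_const a * fps_X ^ N + (of_nat m * 0 + of_nat (m choose 2) * (fps_const a)\<^sup>2) * (fps_X ^ N)\<^sup>2)"
    by (intro power_quadratic_cong)
  from dvd_add[OF this d[of "of_nat m * 0 + of_nat (m choose 2) * (fps_const a)\<^sup>2"]] show ?thesis
    by (simp add: algebra_simps flip: fps_of_nat)
qed

lemma fact_nonzero_if_less_char:
  assumes "prime p" "CHAR('k::field) = p" "n < p"
  shows "(of_nat (fact n) :: 'k) \<noteq> 0"
proof -
  have "\<not> p dvd fact n"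
    using assms by (simp add: prime_dvd_fact_iff)
  then show ?thesis
    using assms by (simp add: of_nat_eq_0_iff_char_dvd)
qed

text \<open>Here g is t -> t + C t^(-p) + \<dots>. The difference of t^(-p) is pushed to high order
  by Frobenius, so the order is decided by the next term t^(-p-1), whose exponent p + 1 is 1 in the
  field. Each difference multiplies by t^(-p-1) and, in the step from k to k + 1, by -C (k + 1);
  after p - 1 of them the leading coefficient is (-C)^(p-1) (p-1)! times
  \<open>\<Psi> $ 0\<close>.\<close>

lemma exact_order_coord_second_iterate:
  fixes g :: "'k::field fps"
  assumes p: "prime p" "CHAR('k) = p"
    and g: "g $ 0 = 0" "g $ 1 = 1" and q: "1 \<le> q" "(of_nat q :: 'k) \<noteq> 0"
    and coord: "inf_coord q g (fps_X ^ (q * p) * (fps_const C + fps_X ^ q * \<Psi>))"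
    and C: "C \<noteq> 0"
  obtains \<Phi> where "inf_coord q (fps_iterate g p) \<Phi>"
    "exact_order \<Phi> (q * (p + 1) * p) \<longleftrightarrow> \<Psi> $ 0 \<noteq> 0"
proof -
  have p2: "p \<ge> 2" using prime_ge_2_nat[OF p(1)] .
  define N \<Theta> where "N = q * (p + 1)" and "\<Theta> = fps_X ^ (q * p) * (fps_const C + fps_X ^ q * \<Psi>)"
  have N: "1 \<le> N" "N = q + q * p" using q by (simp_all add: N_def)
  note coord = coord[folded \<Theta>_def]
  define U where "U = inverse (1 + fps_X ^ q * \<Theta>)"
  have "(1 + fps_X ^ q * \<Theta>) $ 0 \<noteq> 0" using q by (simp add: fps_X_power_mult_nth)
  then have WU: "(1 + fps_X ^ q * \<Theta>) * U = 1" unfolding U_def by (rule inverse_mult_eq_1')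
  have gU: "g ^ q = fps_X ^ q * U"
    unfolding U_def by (rule inf_coord_power_eq[OF coord q(1)])
  have qT: "fps_X ^ q * \<Theta> = fps_X ^ N * (fps_const C + fps_X ^ q * \<Psi>)"
    by (simp add: \<Theta>_def N power_add mult.assoc)
  have U1: "fps_X ^ N dvd U - 1"
  proof -
    have "U - 1 = - (fps_X ^ N * (fps_const C + fps_X ^ q * \<Psi>)) * U"
      using WU unfolding qT by (simp add: algebra_simps)
    also have "\<dots> = fps_X ^ N * (- (fps_const C + fps_X ^ q * \<Psi>) * U)"
      by (simp only: mult.assoc mult_minus_left mult_minus_right)
    finally show ?thesis by (rule dvdI)
  qed
  have "fps_X ^ (N + 1) dvd U - (1 + fps_const (- C) * fps_X ^ N)"
  proof -
    have "U - (1 + fps_const (- C) * fps_X ^ N)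
       = - (fps_X ^ N * (fps_X ^ q * \<Psi> * U)) - fps_const C * (fps_X ^ N * (U - 1))"
      using WU unfolding qT by (simp add: algebra_simps fps_const_neg[symmetric] del: fps_const_neg)
    moreover have d1: "fps_X ^ N * fps_X ^ 1 dvd fps_X ^ N * (fps_X ^ q * \<Psi> * U)"
      using q by (intro mult_dvd_mono dvd_mult2 le_imp_power_dvd) auto
    have d2: "fps_X ^ N * fps_X ^ 1 dvd fps_X ^ N * (U - 1)"
      using dvd_trans[OF le_imp_power_dvd[OF N(1)] U1] by (intro mult_dvd_mono) auto
    note dvd_diff[OF iffD2[OF dvd_minus_iff d1] dvd_mult[OF d2]]
    ultimately show ?thesis
      by (simp only: power_add)
  qed
  from power_linear_cong[OF this N(1)]
  have Upow: "fps_X ^ (N + 1) dvd U ^ m - (1 + fps_const (of_nat m * - C) * fps_X ^ N)" for m .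
  have "fps_X ^ (q * p) dvd \<Theta>" by (simp add: \<Theta>_def)
  from X_power_dvd_if_inf_coord[OF g q(2) coord this]
  have gX: "fps_X ^ (N + 1) dvd g - fps_X" by (simp only: N(2))
  have step: "fps_X ^ (q * m + N + 1) dvd
      diff_op g (fps_X ^ (q * m) * \<Psi>) - fps_const (- (of_nat m * C * \<Psi> $ 0)) * fps_X ^ (q * m + N)" for m \<Psi>
  proof -
    have d: "fps_X ^ (N + 1) dvd (\<Psi> oo g) - \<Psi>"
      using X_power_dvd_diff_op[OF gX g(1), of \<Psi>] by (simp add: diff_op_def)
    have "fps_X dvd \<Psi> - fps_const (\<Psi> $ 0)"
      using X_power_dvd_iff[of 1 "\<Psi> - fps_const (\<Psi> $ 0)"] by simp
    then have "fps_X ^ N * fps_X dvd fps_X ^ N * (\<Psi> - fps_const (\<Psi> $ 0))"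
      by (intro mult_dvd_mono) auto
    then have d0: "fps_X ^ (N + 1) dvd fps_X ^ N * (\<Psi> - fps_const (\<Psi> $ 0))"
      by (simp only: power_add power_one_right)
    have "U ^ m * (\<Psi> oo g) - \<Psi> - fps_const (- (of_nat m * C * \<Psi> $ 0)) * fps_X ^ N =
        U ^ m * ((\<Psi> oo g) - \<Psi>) + (U ^ m - (1 + fps_const (of_nat m * - C) * fps_X ^ N)) * \<Psi>
        + fps_const (of_nat m * - C) * (fps_X ^ N * (\<Psi> - fps_const (\<Psi> $ 0)))"
      by (simp add: algebra_simps fps_const_neg[symmetric] fps_const_mult[symmetric] del: fps_const_neg fps_const_mult)
    moreover have "fps_X ^ (N + 1) dvd \<dots>"
      by (rule dvd_add[OF dvd_add[OF dvd_mult[OF d] dvd_mult2[OF Upow]] dvd_mult[OF d0]])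
    ultimately have "fps_X ^ (q * m) * fps_X ^ (N + 1) dvd
        fps_X ^ (q * m) * (U ^ m * (\<Psi> oo g) - \<Psi> - fps_const (- (of_nat m * C * \<Psi> $ 0)) * fps_X ^ N)"
      by (intro mult_dvd_mono) auto
    moreover have "diff_op g (fps_X ^ (q * m) * \<Psi>) - fps_const (- (of_nat m * C * \<Psi> $ 0)) * fps_X ^ (q * m + N)
      = fps_X ^ (q * m) * (U ^ m * (\<Psi> oo g) - \<Psi> - fps_const (- (of_nat m * C * \<Psi> $ 0)) * fps_X ^ N)"
      unfolding diff_op_X_power_mult[OF g(1) gU] by (simp add: algebra_simps power_add)
    ultimately show ?thesis
      by (simp only: power_add mult.assoc)
  qed
  have base: "fps_X ^ (N * 2 + 1) dvd diff_op g \<Theta> - fps_const (- C * \<Psi> $ 0) * fps_X ^ (N * 2)"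
  proof -
    have split: "diff_op g \<Theta> = diff_op g (fps_X ^ (q * p) * fps_const C) + diff_op g (fps_X ^ (q * (p + 1)) * \<Psi>)"
    proof -
      have "fps_X ^ (q * (p + 1)) = (fps_X :: 'k fps) ^ (q * p) * fps_X ^ q"
        unfolding power_add[symmetric] by (simp only: add_mult_distrib2 mult_1_right)
      then have "\<Theta> = fps_X ^ (q * p) * fps_const C + fps_X ^ (q * (p + 1)) * \<Psi>"
        unfolding \<Theta>_def by (simp only: distrib_left mult.assoc)
      then show ?thesis by (simp only: diff_op_add)
    qed
    \<comment> \<open>U - 1 is divisible by X^N, so U^p - 1 = (U - 1)^p is divisible by X^(N p),
      beyond the precision required here even for p = 2 thanks to the additional factor X^(q
      p).\<close>
    have "(U - 1 + 1) ^ p = (U - 1) ^ p + 1 ^ p"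
      by (rule freshmans_dream) (simp_all only: semiring_char_fps p)
    then have "U ^ p - 1 = (U - 1) ^ p"
      by (simp only: diff_add_cancel power_one add_diff_cancel_right')
    with dvd_power_same[OF U1, of p] have "(fps_X ^ N) ^ p dvd U ^ p - 1"
      by (simp only:)
    then have 1: "fps_X ^ (q * p) * (fps_X ^ N) ^ p dvd fps_X ^ (q * p) * (fps_const C * (U ^ p - 1))"
      by (intro mult_dvd_mono[OF dvd_refl] dvd_mult)
    have "N * 2 \<le> N * p" using p2 by (rule mult_le_mono2)
    moreover have "1 \<le> q * p" using p2 q by simp
    ultimately have "N * 2 + 1 \<le> q * p + N * p" by linarith
    then have 2: "(fps_X :: 'k fps) ^ (N * 2 + 1) dvd fps_X ^ (q * p) * (fps_X ^ N) ^ p"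
      unfolding power_mult[symmetric] power_add[symmetric] by (rule le_imp_power_dvd)
    have "diff_op g (fps_X ^ (q * p) * fps_const C) = fps_X ^ (q * p) * (fps_const C * (U ^ p - 1))"
      unfolding diff_op_X_power_mult[OF g(1) gU] by (simp add: algebra_simps)
    with dvd_trans[OF 2 1] have d1: "fps_X ^ (N * 2 + 1) dvd diff_op g (fps_X ^ (q * p) * fps_const C)"
      by (simp only:)
    have "(of_nat (p + 1) :: 'k) = 1"
      using of_nat_CHAR[where ?'a = 'k] p(2) by simp
    moreover have "q * (p + 1) + N = N * 2" by (simp add: N_def)
    ultimately have d2: "fps_X ^ (N * 2 + 1) dvd
        diff_op g (fps_X ^ (q * (p + 1)) * \<Psi>) - fps_const (- (1 * C * \<Psi> $ 0)) * fps_X ^ (N * 2)"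
      using step[of "p + 1" \<Psi>] by (simp only:)
    show ?thesis
      using dvd_add[OF d1 d2] unfolding split by (simp only: add_diff_eq[symmetric] mult_1 mult_minus_left)
  qed
  have iter: "fps_X ^ (N * Suc k + 1) dvd
      (diff_op g ^^ k) \<Theta> - fps_const ((- C) ^ k * of_nat (fact k) * \<Psi> $ 0) * fps_X ^ (N * Suc k)" if "1 \<le> k" for k
    using that
  proof (induction k rule: nat_induct_at_least)
    case base
    have "N * Suc 1 = N * 2" "(- C) ^ 1 * of_nat (fact 1) * \<Psi> $ 0 = - C * \<Psi> $ 0"
      "(diff_op g ^^ 1) \<Theta> = diff_op g \<Theta>"
      by simp_all
    then show ?case
      using \<open>fps_X ^ (N * 2 + 1) dvd _\<close> by (simp only:)
  next
    case (Suc k)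
    define L where "L = fps_const ((- C) ^ k * of_nat (fact k) * \<Psi> $ 0)"
    define R where "R = (diff_op g ^^ k) \<Theta> - L * fps_X ^ (N * Suc k)"
    obtain S where S: "R = fps_X ^ (N * Suc k + 1) * S"
      using Suc.IH unfolding R_def L_def by (rule dvdE)
    have m: "N * Suc k = q * ((p + 1) * Suc k)" by (simp only: N_def mult.assoc)
    have "(diff_op g ^^ k) \<Theta> = fps_X ^ (q * ((p + 1) * Suc k)) * (L + fps_X * S)"
      unfolding m[symmetric] using S by (simp add: R_def algebra_simps)
    then have "fps_X ^ (N * Suc k + N + 1) dvd (diff_op g ^^ Suc k) \<Theta>
        - fps_const (- (of_nat ((p + 1) * Suc k) * C * (L + fps_X * S) $ 0)) * fps_X ^ (N * Suc k + N)"
      using step[of "(p + 1) * Suc k" "L + fps_X * S"] unfolding m[symmetric] by simp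
    moreover have "(of_nat ((p + 1) * Suc k) :: 'k) = of_nat (Suc k)"
      using of_nat_CHAR[where ?'a = 'k] p(2) by simp
    moreover have "- (of_nat (Suc k) * C * (L + fps_X * S) $ 0) = (- C) ^ Suc k * of_nat (fact (Suc k)) * \<Psi> $ 0"
      by (simp add: L_def algebra_simps)
    moreover have "N * Suc k + N = N * Suc (Suc k)" by simp
    ultimately show ?case by (simp only:)
  qed
  have "fps_X ^ (N * Suc (p - 1) + 1) dvd
      (diff_op g ^^ (p - 1)) \<Theta> - fps_const ((- C) ^ (p - 1) * of_nat (fact (p - 1)) * \<Psi> $ 0) * fps_X ^ (N * Suc (p - 1))"
    by (rule iter) (use p2 in simp)
  moreover have "Suc (p - 1) = p" using p2 by simp
  ultimately have "\<forall>i<N * p + 1. (diff_op g ^^ (p - 1)) \<Theta> $ i =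
      (if i = N * p then (- C) ^ (p - 1) * of_nat (fact (p - 1)) * \<Psi> $ 0 else 0)"
    unfolding X_power_dvd_iff by (auto simp: fps_X_power_nth)
  then have "exact_order ((diff_op g ^^ (p - 1)) \<Theta>) (N * p) \<longleftrightarrow> \<Psi> $ 0 \<noteq> 0"
    using C fact_nonzero_if_less_char[OF p, of "p - 1"] p2 by (simp add: exact_order_def)
  moreover have "inf_coord q (fps_iterate g p) ((diff_op g ^^ (p - 1)) \<Theta>)"
    using inf_coord_iterate[OF g(1) coord, of p]
    by (simp only: sum_compose_iterates_eq_diff_op[OF g(1) p])
  ultimately show ?thesis
    using that by (simp add: N_def)
qed


subsection \<open>Normal forms\<close>

text \<open>Averaging over the iterates of \<open>f\<close> kills every coefficient of \<open>\<Theta>\<close> below degree \<open>2 q\<close> whose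
  degree is not divisible by \<open>q\<close>.\<close>

lemma coord_root_of_unity_iterate:
  fixes f :: "'k::field fps"
  assumes f0: "f $ 0 = 0" and f1: "f $ 1 = \<gamma>" and q: "1 \<le> q"
    and \<gamma>: "\<gamma> ^ q = 1" "\<And>i. 1 \<le> i \<Longrightarrow> i < q \<Longrightarrow> \<gamma> ^ i \<noteq> 1"
    and fX: "fps_X ^ (q + 1) dvd f - fps_const \<gamma> * fps_X"
    and coord: "inf_coord q f \<Theta>"
    and \<Theta>: "fps_X ^ (q + 1) dvd \<Theta> - (fps_const a + fps_const b * fps_X ^ q)"
  obtains \<Phi> where "inf_coord q (fps_iterate f q) \<Phi>"
    "fps_X ^ (2 * q) dvd \<Phi> - (fps_const (of_nat q * a) + fps_const (of_nat q * b) * fps_X ^ q)"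
proof
  show "inf_coord q (fps_iterate f q) (\<Sum>j<q. \<Theta> oo fps_iterate f j)"
    by (rule inf_coord_iterate[OF f0 coord])
  have \<Theta>_nth: "\<Theta> $ i = (if i = 0 then a else if i = q then b else 0)" if "i \<le> q" for i
    using \<Theta> that q unfolding X_power_dvd_iff by (auto simp: fps_X_power_nth dest!: spec[of _ i])
  have iter: "fps_X ^ (q + 1) dvd fps_iterate f j - fps_const (\<gamma> ^ j) * fps_X" for j
  proof (induction j)
    case (Suc j)
    let ?h = "fps_iterate f j"
    have "fps_iterate f (Suc j) - fps_const (\<gamma> ^ Suc j) * fps_X =
        ((f - fps_const \<gamma> * fps_X) oo ?h) + fps_const \<gamma> * (?h - fps_const (\<gamma> ^ j) * fps_X)"
      by (simp add: fps_iterate_Suc fps_compose_sub_distrib fps_compose_mult_distrib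
          fps_iterate_nth_0 f0 algebra_simps flip: fps_const_mult)
    moreover have "fps_X ^ (q + 1) dvd ((f - fps_const \<gamma> * fps_X) oo ?h)"
    proof -
      obtain r where "f - fps_const \<gamma> * fps_X = fps_X ^ (q + 1) * r"
        using fX by (rule dvdE)
      then have "(f - fps_const \<gamma> * fps_X) oo ?h = ?h ^ (q + 1) * (r oo ?h)"
        by (simp add: fps_compose_mult_distrib fps_compose_power[symmetric] fps_iterate_nth_0 f0)
      moreover have "fps_X dvd ?h"
        using X_power_dvd_iff[of 1 ?h] fps_iterate_nth_0[OF f0] by simp
      then have "fps_X ^ (q + 1) dvd ?h ^ (q + 1)" by (rule dvd_power_same)
      ultimately show ?thesis by simp
    qed
    ultimately show ?case
      using Suc by (simp only:) (intro dvd_add dvd_mult)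
  qed simp
  \<comment> \<open>\<Theta> has no terms in degrees 1 to q - 1, so below degree 2q the iterate of f
    may be replaced by its linear part \<gamma>^j X.\<close>
  have nth: "(\<Theta> oo fps_iterate f j) $ k = \<Theta> $ k * (\<gamma> ^ k) ^ j" if k: "k < 2 * q" for j k
  proof -
    have "fps_X ^ (q + 1 + q - 1) dvd (\<Theta> oo fps_iterate f j) - (\<Theta> oo (fps_const (\<gamma> ^ j) * fps_X))"
      by (rule X_power_dvd_compose_diff[OF iter]) (use q in \<open>auto simp: fps_iterate_nth_0 f0 \<Theta>_nth\<close>)
    then have "(\<Theta> oo fps_iterate f j) $ k = (\<Theta> oo (fps_const (\<gamma> ^ j) * fps_X)) $ k"
      using k unfolding X_power_dvd_iff by auto
    also have "\<dots> = \<Theta> $ k * (\<gamma> ^ k) ^ j"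
      unfolding fps_compose_linear by (simp add: power_mult[symmetric] mult.commute)
    finally show ?thesis .
  qed
  show "fps_X ^ (2 * q) dvd (\<Sum>j<q. \<Theta> oo fps_iterate f j) -
      (fps_const (of_nat q * a) + fps_const (of_nat q * b) * fps_X ^ q)"
    unfolding X_power_dvd_iff
  proof (intro allI impI)
    fix k assume k: "k < 2 * q"
    have S: "(\<Sum>j<q. \<Theta> oo fps_iterate f j) $ k = \<Theta> $ k * (\<Sum>j<q. (\<gamma> ^ k) ^ j)"
      by (simp add: fps_sum_nth nth[OF k] sum_distrib_left)
    consider "k = 0" | "k = q" | "0 < k" "k < q" | "q < k" by linarith
    then show "((\<Sum>j<q. \<Theta> oo fps_iterate f j) -
      (fps_const (of_nat q * a) + fps_const (of_nat q * b) * fps_X ^ q)) $ k = 0"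
    proof cases
      case 4
      then have "\<gamma> ^ (k - q) \<noteq> 1" using k \<gamma>(2) by simp
      moreover have "\<gamma> ^ k = \<gamma> ^ q * \<gamma> ^ (k - q)"
        using 4 by (simp flip: power_add)
      ultimately have "\<gamma> ^ k \<noteq> 1" using \<gamma>(1) by simp
      moreover have "(\<gamma> ^ k) ^ q = 1"
        using \<gamma>(1) by (metis mult.commute power_mult power_one)
      ultimately have "(\<Sum>j<q. (\<gamma> ^ k) ^ j) = 0"
        by (simp add: geometric_sum)
      then show ?thesis using S 4 q by (simp add: fps_X_power_nth)
    qed (use q S in \<open>auto simp: \<Theta>_nth \<gamma>(1) fps_X_power_nth\<close>)
  qed
qed

text \<open>With F = \<gamma> X V the coordinate t becomes t V^(-q), because \<gamma>^q = 1.
  Expanding V^(-q) gives t - a + b / t + \<dots> with a = q \<alpha> and b = a^2 - (q \<beta> + (q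
  choose 2) \<alpha>^2), and summing over q iterates gives A = q a and \<rho> = q b. The three
  orders then test A, the product (p-1)! A^(p-1) \<rho>, and the second coefficient of the p-th
  iterate.\<close>

theorem minimally_ramified_normal_form_iff:
  fixes \<gamma> \<alpha> \<beta> :: "'k::field"
  assumes p: "prime p" "CHAR('k) = p" and q: "1 \<le> q" "(of_nat q :: 'k) \<noteq> 0"
    and \<gamma>: "root_of_unity \<gamma>" "q = unity_order \<gamma>"
    and F: "fps_X ^ (2 * q + 2) dvd
        F - fps_const \<gamma> * fps_X * (1 + fps_const \<alpha> * fps_X ^ q + fps_const \<beta> * (fps_X ^ q)\<^sup>2)"
  defines "A \<equiv> of_nat q * (of_nat q * \<alpha>)"
    and "\<rho> \<equiv> of_nat q * ((of_nat q * \<alpha>)\<^sup>2 - (of_nat q * \<beta> + of_nat (q choose 2) * \<alpha>\<^sup>2))"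
  shows "minimally_ramified p F \<longleftrightarrow> A \<noteq> 0 \<and> \<rho> \<noteq> 0 \<and> of_nat (p choose 2) * A\<^sup>2 + \<rho> \<noteq> 0"
proof -
  let ?y = "fps_X ^ q :: 'k fps" and ?z = "fps_X ^ (2 * q + 1) :: 'k fps"
  have p2: "p \<ge> 2" using prime_ge_2_nat[OF p(1)] .
  have \<gamma>q: "\<gamma> ^ q = 1" and \<gamma>i: "\<And>i. 1 \<le> i \<Longrightarrow> i < q \<Longrightarrow> \<gamma> ^ i \<noteq> 1"
    using unity_order[OF \<gamma>(1)] \<gamma>(2) by auto
  have \<gamma>0: "\<gamma> \<noteq> 0" using \<gamma>q q by (metis one_neq_zero power_0_left not_one_le_zero)
  obtain R where R: "F - fps_const \<gamma> * fps_X * (1 + fps_const \<alpha> * ?y + fps_const \<beta> * ?y\<^sup>2) = fps_X ^ (2 * q + 2) * R"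
    using F by (rule dvdE)
  define V where "V = 1 + fps_const \<alpha> * ?y + fps_const \<beta> * ?y\<^sup>2 + ?z * (fps_const (inverse \<gamma>) * R)"
  have "fps_const \<gamma> * fps_const (inverse \<gamma>) = 1"
    using \<gamma>0 by simp
  then have "fps_const \<gamma> * fps_X * (?z * (fps_const (inverse \<gamma>) * R)) = fps_X ^ (2 * q + 2) * R"
    by (simp add: mult_ac power_add)
  then have FV: "F = fps_const \<gamma> * fps_X * V"
    using R unfolding V_def by (simp add: algebra_simps)
  have y_nth: "?y $ i = (if i = q then 1 else 0)" for i
    by (simp add: fps_X_power_nth)
  have V0: "V $ 0 = 1"
    using q by (simp add: V_def y_nth fps_X_power_mult_nth power_mult[symmetric] fps_X_power_nth)
  have F0: "F $ 0 = 0" by (simp add: FV mult.assoc)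
  have F1: "F $ 1 = \<gamma>" by (simp add: FV V0 mult.assoc)
  have mult: "multiplier F = \<gamma>" using F1 by (simp add: multiplier_def)
  then have par: "parabolic F" using F0 \<gamma> by (simp add: parabolic_def)
  have "q * 3 = (2 * q + 1) + (q - 1)" using q by simp
  then have "?y ^ 3 = ?z * fps_X ^ (q - 1)"
    by (simp only: power_mult[symmetric] power_add)
  then have z3: "?z dvd ?y ^ 3" by (rule dvdI)
  have "?z dvd V - (1 + fps_const \<alpha> * ?y + fps_const \<beta> * ?y\<^sup>2)"
    by (simp add: V_def)
  from power_quadratic_cong[OF this z3, of q]
  have Vq: "?z dvd V ^ q - (1 + fps_const (of_nat q * \<alpha>) * ?y
      + fps_const (of_nat q * \<beta> + of_nat (q choose 2) * \<alpha>\<^sup>2) * ?y\<^sup>2)"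
    by (simp add: power2_eq_square flip: fps_of_nat)
  define U where "U = inverse (V ^ q)"
  have VU: "V ^ q * U = 1"
    unfolding U_def by (rule inverse_mult_eq_1') (simp add: fps_nth_power_0 V0)
  define a b where "a = of_nat q * \<alpha>" and "b = a\<^sup>2 - (of_nat q * \<beta> + of_nat (q choose 2) * \<alpha>\<^sup>2)"
  have "?z dvd U - (1 - fps_const a * ?y + fps_const b * ?y\<^sup>2)"
    using inverse_quadratic_cong[OF Vq z3 VU] by (simp add: a_def b_def power2_eq_square)
  then obtain S where S: "U - (1 - fps_const a * ?y + fps_const b * ?y\<^sup>2) = ?z * S"
    by (rule dvdE)
  define \<Theta> where "\<Theta> = fps_const (- a) + fps_const b * ?y + fps_X ^ (q + 1) * S"
  have zy: "?z = ?y * fps_X ^ (q + 1)"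
    by (simp add: power_add mult_2)
  have U\<Theta>: "U = 1 + ?y * \<Theta>"
    using S unfolding zy \<Theta>_def
    by (simp add: algebra_simps power2_eq_square fps_const_neg[symmetric] del: fps_const_neg)
  have "F ^ q = ?y * V ^ q"
    using \<gamma>q by (simp add: FV power_mult_distrib fps_const_power)
  then have coordF: "inf_coord q F \<Theta>"
    unfolding inf_coord_def U\<Theta>[symmetric] using VU by (simp add: mult.assoc)
  have \<Theta>_dvd: "fps_X ^ (q + 1) dvd \<Theta> - (fps_const (- a) + fps_const b * ?y)"
    by (simp add: \<Theta>_def)
  have FX: "fps_X ^ (q + 1) dvd F - fps_const \<gamma> * fps_X"
  proof -
    have V1: "?y dvd V - 1"
    proof -
      have "V - 1 = ?y * (fps_const \<alpha> + fps_const \<beta> * ?y + fps_X ^ (q + 1) * (fps_const (inverse \<gamma>) * R))"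
        unfolding V_def zy by (simp add: algebra_simps power2_eq_square)
      then show ?thesis by (rule dvdI)
    qed
    have "F - fps_const \<gamma> * fps_X = fps_const \<gamma> * (fps_X * (V - 1))"
      by (simp add: FV algebra_simps)
    moreover have "fps_X * ?y dvd fps_X * (V - 1)"
      using V1 by (intro mult_dvd_mono) auto
    ultimately show ?thesis by (simp add: mult.commute)
  qed
  define g where "g = fps_iterate F q"
  obtain \<Phi> where coord0: "inf_coord q g \<Phi>" and
    \<Phi>: "fps_X ^ (2 * q) dvd \<Phi> - (fps_const (of_nat q * - a) + fps_const (of_nat q * b) * ?y)"
    unfolding g_def by (rule coord_root_of_unity_iterate[OF F0 F1 q(1) \<gamma>q \<gamma>i FX coordF \<Theta>_dvd])
  have A: "of_nat q * - a = - A" and \<rho>: "of_nat q * b = \<rho>"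
    by (simp_all add: A_def a_def \<rho>_def b_def)
  note \<Phi> = \<Phi>[unfolded A \<rho>]
  have g: "g $ 0 = 0" "g $ 1 = 1"
    using fps_iterate_nth_0[OF F0] fps_iterate_nth_1[OF F0, of q] F1 \<gamma>q by (simp_all add: g_def)
  obtain \<Psi> where coord1: "inf_coord q (fps_iterate g p)
      (fps_X ^ (q * p) * (fps_const (of_nat (fact (p - 1)) * A ^ (p - 1) * \<rho>) + ?y * \<Psi>))"
    and \<Psi>: "\<Psi> $ 0 = (of_nat (p choose 2) * A\<^sup>2 + \<rho>) * (of_nat (fact (p - 2)) * A ^ (p - 2) * \<rho>)"
    by (rule coord_prime_iterate[OF p g q coord0 \<Phi>])
  define C where "C = of_nat (fact (p - 1)) * A ^ (p - 1) * \<rho>"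
  note coord1 = coord1[folded C_def]
  define h where "h = fps_iterate g p"
  have h: "h $ 0 = 0" "h $ 1 = 1"
    using fps_iterate_nth_0[OF g(1)] fps_iterate_nth_1[OF g(1), of p] g by (simp_all add: h_def)
  have hp: "fps_iterate g (p ^ 2) = fps_iterate h p"
    by (simp add: h_def fps_iterate_mult[OF g(1), symmetric] power2_eq_square)
  have fact: "(of_nat (fact (p - 1)) :: 'k) \<noteq> 0" "(of_nat (fact (p - 2)) :: 'k) \<noteq> 0"
    using fact_nonzero_if_less_char[OF p] p2 by simp_all
  have C: "C \<noteq> 0 \<longleftrightarrow> A \<noteq> 0 \<and> \<rho> \<noteq> 0"
    using fact p2 by (auto simp: C_def)
  have i0: "exact_order (g - fps_X) (q + 1) \<longleftrightarrow> A \<noteq> 0"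
  proof -
    have "exact_order (g - fps_X) (q + 0 + 1) \<longleftrightarrow> exact_order \<Phi> 0"
      by (rule exact_order_if_inf_coord[OF g q(2) coord0])
    moreover have "\<Phi> $ 0 = - A"
      using \<Phi> q unfolding X_power_dvd_iff by (auto simp: y_nth dest!: spec[of _ 0])
    ultimately show ?thesis by (simp add: exact_order_0_iff)
  qed
  have i1: "exact_order (h - fps_X) (q * (1 + p) + 1) \<longleftrightarrow> C \<noteq> 0"
  proof -
    have "exact_order (h - fps_X) (q + q * p + 1) \<longleftrightarrow>
        exact_order (fps_X ^ (q * p) * (fps_const C + ?y * \<Psi>)) (0 + q * p)"
      using exact_order_if_inf_coord[OF h q(2) coord1[folded h_def]] by simp
    also have "\<dots> \<longleftrightarrow> C \<noteq> 0"
      unfolding exact_order_X_power_mult using q by (simp add: exact_order_0_iff fps_X_power_mult_nth)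
    finally show ?thesis by simp
  qed
  have i2: "exact_order (fps_iterate h p - fps_X) (q * (1 + p + p ^ 2) + 1) \<longleftrightarrow> \<Psi> $ 0 \<noteq> 0" if C0: "C \<noteq> 0"
  proof -
    obtain \<Phi>2 where \<Phi>2: "inf_coord q (fps_iterate h p) \<Phi>2"
      "exact_order \<Phi>2 (q * (p + 1) * p) \<longleftrightarrow> \<Psi> $ 0 \<noteq> 0"
      by (rule exact_order_coord_second_iterate[OF p h q coord1[folded h_def] C0])
    have "fps_iterate h p $ 0 = 0" "fps_iterate h p $ 1 = 1"
      using fps_iterate_nth_0[OF h(1)] fps_iterate_nth_1[OF h(1), of p] h by simp_all
    from exact_order_if_inf_coord[OF this q(2) \<Phi>2(1), of "q * (p + 1) * p"] \<Phi>2(2)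
    have "exact_order (fps_iterate h p - fps_X) (q + q * (p + 1) * p + 1) \<longleftrightarrow> \<Psi> $ 0 \<noteq> 0"
      by blast
    moreover have "q + q * (p + 1) * p = q * (1 + p + p ^ 2)"
      by (simp add: algebra_simps power2_eq_square)
    ultimately show ?thesis by (simp only:)
  qed
  have "minimally_ramified p F \<longleftrightarrow> A \<noteq> 0 \<and> C \<noteq> 0 \<and> \<Psi> $ 0 \<noteq> 0"
    using minimally_ramified_iff_orders[OF p par _ q(1)] i0 i1 i2
    unfolding mult \<gamma>(2)[symmetric] g_def[symmetric] h_def[symmetric] hp by blast
  also have "\<dots> \<longleftrightarrow> A \<noteq> 0 \<and> \<rho> \<noteq> 0 \<and> of_nat (p choose 2) * A\<^sup>2 + \<rho> \<noteq> 0"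
    unfolding C \<Psi> using fact by auto
  finally show ?thesis .
qed

text \<open>If the order were p m, Frobenius would give (\<gamma>^m - 1)^p = \<gamma>^(p m) - 1 = 0,
  so m would already be an exponent.\<close>

lemma unity_order_nonzero_in_field:
  fixes \<gamma> :: "'k::field"
  assumes p: "prime p" "CHAR('k) = p" and \<gamma>: "root_of_unity \<gamma>"
  shows "(of_nat (unity_order \<gamma>) :: 'k) \<noteq> 0"
proof
  assume "(of_nat (unity_order \<gamma>) :: 'k) = 0"
  then have "p dvd unity_order \<gamma>"
    by (simp add: of_nat_eq_0_iff_char_dvd p)
  then obtain m where m: "unity_order \<gamma> = p * m" by (rule dvdE)
  have p2: "p \<ge> 2" using p(1) by (rule prime_ge_2_nat)
  have "m \<noteq> 0" using m unity_order(1)[OF \<gamma>] by (intro notI) simp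
  then have "1 \<le> m" "m < p * m" using p2 by simp_all
  then have "1 \<le> m" "m < unity_order \<gamma>" unfolding m .
  then have "\<gamma> ^ m \<noteq> 1" by (rule unity_order(3)[OF \<gamma>])
  have "(\<gamma> ^ m - 1 + 1) ^ p = (\<gamma> ^ m - 1) ^ p + 1 ^ p"
    by (rule freshmans_dream) (simp_all only: p)
  moreover have "(\<gamma> ^ m) ^ p = 1"
    using unity_order(2)[OF \<gamma>] unfolding m by (simp only: power_mult[symmetric] mult.commute[of p])
  ultimately have "(\<gamma> ^ m - 1) ^ p = 0"
    by (simp only: diff_add_cancel power_one) simp
  then show False using \<open>\<gamma> ^ m \<noteq> 1\<close> by simp
qed

subsection \<open>Invariance under conjugation\<close>

text \<open>Removing the linear part of \<phi> leaves a series without a term of degree 1, for which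
  the composition estimate gains one order.\<close>

lemma X_power_dvd_compose_perturb:
  fixes G H :: "'k::field fps"
  assumes n: "fps_X ^ n dvd G - H" and 0: "G $ 0 = 0" "H $ 0 = 0"
  shows "fps_X ^ (n + 1) dvd ((\<phi> oo G) - (\<phi> oo H)) - fps_const (\<phi> $ 1) * (G - H)"
proof -
  have "fps_X ^ (n + 2 - 1) dvd ((\<phi> - fps_const (\<phi> $ 1) * fps_X) oo G) - ((\<phi> - fps_const (\<phi> $ 1) * fps_X) oo H)"
  proof (rule X_power_dvd_compose_diff[OF n 0])
    fix i :: nat assume "1 \<le> i" "i < 2"
    then have "i = 1" by simp
    then show "(\<phi> - fps_const (\<phi> $ 1) * fps_X) $ i = 0" by simp
  qed simp
  then show ?thesis
    by (simp add: fps_compose_sub_distrib fps_compose_mult_distrib 0 algebra_simps)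
qed

text \<open>The leading term of the left difference is h'(0) times that of G - X; the converse
  follows from uniqueness of orders.\<close>

lemma exact_order_compose_diff:
  fixes h G :: "'k::field fps"
  assumes h: "h $ 1 \<noteq> 0" and G: "G $ 0 = 0"
  shows "exact_order ((h oo G) - h) j \<longleftrightarrow> exact_order (G - fps_X) j"
proof -
  have *: "exact_order ((h oo G) - h) j" if j: "exact_order (G - fps_X) j" for j
  proof -
    have "fps_X ^ j dvd G - fps_X"
      using j unfolding X_power_dvd_iff exact_order_def by blast
    from X_power_dvd_compose_perturb[OF this G, of h]
    have "fps_X ^ (j + 1) dvd ((h oo G) - h) - fps_const (h $ 1) * (G - fps_X)"
      by simp
    then have "((h oo G) - h) $ i = h $ 1 * (G - fps_X) $ i" if "i \<le> j" for i
      using that unfolding X_power_dvd_iff by (auto dest!: spec[of _ i])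
    then show ?thesis using j h by (auto simp: exact_order_def)
  qed
  show ?thesis
  proof
    assume j: "exact_order ((h oo G) - h) j"
    then have "G \<noteq> fps_X" using fps_nonzero_if_exact_order by fastforce
    then have "exact_order (G - fps_X) (subdegree (G - fps_X))"
      by (simp add: exact_order_iff_subdegree)
    with *[OF this] j show "exact_order (G - fps_X) j"
      using exact_order_unique by metis
  qed (rule *)
qed

lemma exact_order_conjugate:
  fixes F N h :: "'k::field fps"
  assumes h: "h $ 0 = 0" "h $ 1 \<noteq> 0" and F: "F $ 0 = 0" and N: "N $ 0 = 0" and conj: "F oo h = h oo N"
  shows "exact_order (fps_iterate F m - fps_X) j \<longleftrightarrow> exact_order (fps_iterate N m - fps_X) j"
proof -
  have "fps_iterate F m oo h = h oo fps_iterate N m"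
  proof (induction m)
    case (Suc m)
    have "fps_iterate F (Suc m) oo h = F oo (fps_iterate F m oo h)"
      by (simp add: fps_iterate_Suc fps_compose_assoc h fps_iterate_nth_0 F)
    also have "\<dots> = (F oo h) oo fps_iterate N m"
      unfolding Suc by (simp add: fps_compose_assoc h fps_iterate_nth_0 N)
    also have "\<dots> = h oo fps_iterate N (Suc m)"
      unfolding conj by (simp add: fps_iterate_Suc fps_compose_assoc fps_iterate_nth_0 N)
    finally show ?case .
  qed (simp add: h)
  then have "(fps_iterate F m - fps_X) oo h = (h oo fps_iterate N m) - h"
    by (simp add: fps_compose_sub_distrib h)
  moreover have "exact_order h 1" using h by (simp add: exact_order_def)
  then have "exact_order (a oo h) j \<longleftrightarrow> exact_order a j" for a
    using h by (auto simp: exact_order_iff_subdegree fps_compose_eq_0_iff)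
  ultimately show ?thesis
    using exact_order_compose_diff[OF h(2) fps_iterate_nth_0[OF N]] by metis
qed

lemma minimally_ramified_conjugate:
  fixes F N h :: "'k::field fps"
  assumes p: "prime p" "CHAR('k) = p"
    and h: "h $ 0 = 0" "h $ 1 \<noteq> 0" and F: "F $ 0 = 0" and N: "N $ 0 = 0" and conj: "F oo h = h oo N"
  shows "minimally_ramified p F \<longleftrightarrow> minimally_ramified p N"
proof -
  have "F $ 1 * h $ 1 = h $ 1 * N $ 1"
    using fps_compose_nth_1[OF h(1), of F] fps_compose_nth_1[OF N, of h] conj by simp
  then have mult: "multiplier F = multiplier N" using h by (simp add: multiplier_def)
  then have par: "parabolic F \<longleftrightarrow> parabolic N" using F N by (simp add: parabolic_def)
  show ?thesis
  proof (cases "parabolic N")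
    case True
    then have q: "1 \<le> unity_order (multiplier N)" by (intro unity_order(1)) (simp add: parabolic_def)
    have it: "fps_iterate (fps_iterate G q) n = fps_iterate G (q * n)" if "G $ 0 = 0" for G :: "'k fps" and q n
      by (rule fps_iterate_mult[OF that, symmetric])
    note iff = minimally_ramified_iff_orders[OF p _ refl]
    show ?thesis
      using iff[of F] iff[of N] True q exact_order_conjugate[OF h F N conj]
      unfolding mult par it[OF F] it[OF N] by simp
  next
    case False
    then show ?thesis using par by (simp add: minimally_ramified_def)
  qed
qed

subsection \<open>Polynomial functions\<close>

definition monomial_eval :: "(nat \<Rightarrow>\<^sub>0 nat) \<Rightarrow> (nat \<Rightarrow> 'k::field) \<Rightarrow> 'k" where
  "monomial_eval e x = (\<Prod>i\<in>Poly_Mapping.keys e. x i ^ Poly_Mapping.lookup e i)"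

lemma monomial_eval_superset:
  assumes "finite A" "Poly_Mapping.keys e \<subseteq> A"
  shows "monomial_eval e x = (\<Prod>i\<in>A. x i ^ Poly_Mapping.lookup e i)"
  unfolding monomial_eval_def using assms
  by (intro prod.mono_neutral_left) (auto simp: in_keys_iff)

lemma monomial_eval_add: "monomial_eval (e + e') x = monomial_eval e x * monomial_eval e' x"
proof -
  let ?A = "Poly_Mapping.keys e \<union> Poly_Mapping.keys e'"
  have "monomial_eval (e + e') x = (\<Prod>i\<in>?A. x i ^ Poly_Mapping.lookup (e + e') i)"
    by (rule monomial_eval_superset) (use keys_add[of e e'] in auto)
  also have "\<dots> = (\<Prod>i\<in>?A. x i ^ Poly_Mapping.lookup e i) * (\<Prod>i\<in>?A. x i ^ Poly_Mapping.lookup e' i)"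
    by (simp add: lookup_add power_add prod.distrib)
  also have "\<dots> = monomial_eval e x * monomial_eval e' x"
    by (subst (1 2) monomial_eval_superset[of ?A]) auto
  finally show ?thesis .
qed

lemma multipoly_eval_eq:
  "multipoly_eval M x = (\<Sum>e\<in>Poly_Mapping.keys M. Poly_Mapping.lookup M e * monomial_eval e x)"
  by (simp add: multipoly_eval_def monomial_eval_def)

lemma multipoly_eval_0 [simp]: "multipoly_eval 0 x = 0"
  by (simp add: multipoly_eval_def)

lemma multipoly_eval_add: "multipoly_eval (M + N) x = multipoly_eval M x + multipoly_eval N x"
  unfolding multipoly_eval_eq
  by (rule setsum_keys_plus_distrib[where f = "\<lambda>e a. a * monomial_eval e x"]) (auto simp: algebra_simps)

lemma multipoly_eval_sum: "multipoly_eval (sum f A) x = (\<Sum>i\<in>A. multipoly_eval (f i) x)"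
  by (induction A rule: infinite_finite_induct) (simp_all add: multipoly_eval_add)

lemma multipoly_eval_single: "multipoly_eval (Poly_Mapping.single e a) x = a * monomial_eval e x"
  by (simp add: multipoly_eval_eq)

lemma poly_mapping_eq_sum_single:
  "(M :: 'a \<Rightarrow>\<^sub>0 'b::comm_monoid_add) = (\<Sum>e\<in>Poly_Mapping.keys M. Poly_Mapping.single e (Poly_Mapping.lookup M e))"
  by (rule poly_mapping_eqI) (auto simp: lookup_sum lookup_single when_def in_keys_iff)

lemma multipoly_mult_eq_sum:
  fixes M N :: "'k::field multipoly"
  shows "M * N = (\<Sum>e\<in>Poly_Mapping.keys M. \<Sum>e'\<in>Poly_Mapping.keys N.
     Poly_Mapping.single (e + e') (Poly_Mapping.lookup M e * Poly_Mapping.lookup N e'))"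
  by (subst poly_mapping_eq_sum_single[of M], subst poly_mapping_eq_sum_single[of N])
    (simp add: sum_product mult_single)

lemma multipoly_eval_mult:
  fixes M N :: "'k::field multipoly"
  shows "multipoly_eval (M * N) x = multipoly_eval M x * multipoly_eval N x"
  unfolding multipoly_mult_eq_sum multipoly_eval_sum multipoly_eval_single monomial_eval_add
  by (simp add: multipoly_eval_eq sum_product mult_ac)

lemma multipoly_over_add:
  assumes "is_subfield K" "M \<in> multipoly_over K I" "N \<in> multipoly_over K I"
  shows "M + N \<in> multipoly_over K I"
proof -
  have "Poly_Mapping.lookup (M + N) e \<in> K" for e
    using assms by (auto simp: lookup_add multipoly_over_def is_subfield_def)
  moreover have "Poly_Mapping.keys e \<subseteq> I" if "e \<in> Poly_Mapping.keys (M + N)" for e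
    using that keys_add[of M N] assms(2,3) unfolding multipoly_over_def by blast
  ultimately show ?thesis by (simp add: multipoly_over_def)
qed

lemma multipoly_over_sum:
  assumes K: "is_subfield K" and "\<And>i. i \<in> A \<Longrightarrow> f i \<in> multipoly_over K I"
  shows "sum f A \<in> multipoly_over K I"
  using assms(2)
proof (induction A rule: infinite_finite_induct)
  case (insert a A)
  then show ?case by (auto intro: multipoly_over_add[OF K])
qed (use K in \<open>auto simp: multipoly_over_def is_subfield_def\<close>)

lemma multipoly_over_single:
  assumes "is_subfield K" "a \<in> K" "Poly_Mapping.keys e \<subseteq> I"
  shows "Poly_Mapping.single e a \<in> multipoly_over K I"
  using assms by (auto simp: multipoly_over_def is_subfield_def lookup_single when_def)

lemma multipoly_over_mult:
  assumes K: "is_subfield K" and M: "M \<in> multipoly_over K I" and N: "N \<in> multipoly_over K I"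
  shows "M * N \<in> multipoly_over K I"
  unfolding multipoly_mult_eq_sum
proof (intro multipoly_over_sum K multipoly_over_single)
  fix e e' assume e: "e \<in> Poly_Mapping.keys M" "e' \<in> Poly_Mapping.keys N"
  show "Poly_Mapping.lookup M e * Poly_Mapping.lookup N e' \<in> K"
    using assms unfolding multipoly_over_def is_subfield_def by blast
  show "Poly_Mapping.keys (e + e') \<subseteq> I"
    using keys_add[of e e'] e M N unfolding multipoly_over_def by blast
qed

text \<open>Polynomials are handled through the functions they define, so that closure rules replace
  computations with monomials and a polynomial is extracted only at the end.\<close>

definition poly_function :: "'k::field set \<Rightarrow> nat set \<Rightarrow> ((nat \<Rightarrow> 'k) \<Rightarrow> 'k) \<Rightarrow> bool" where
  "poly_function K I \<phi> \<longleftrightarrow> (\<exists>M\<in>multipoly_over K I. \<forall>c. multipoly_eval M c = \<phi> c)"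

lemma poly_function_add:
  assumes "is_subfield K" "poly_function K I \<phi>" "poly_function K I \<psi>"
  shows "poly_function K I (\<lambda>c. \<phi> c + \<psi> c)"
  using assms unfolding poly_function_def
  by (metis multipoly_over_add multipoly_eval_add)

lemma poly_function_mult:
  assumes "is_subfield K" "poly_function K I \<phi>" "poly_function K I \<psi>"
  shows "poly_function K I (\<lambda>c. \<phi> c * \<psi> c)"
  using assms unfolding poly_function_def
  by (metis multipoly_over_mult multipoly_eval_mult)

lemma poly_function_const:
  assumes "is_subfield K" "a \<in> K"
  shows "poly_function K I (\<lambda>_. a)"
  unfolding poly_function_def
  by (rule bexI[of _ "Poly_Mapping.single 0 a"])
    (auto simp: multipoly_eval_single monomial_eval_def intro!: multipoly_over_single assms)

lemma poly_function_var:
  assumes K: "is_subfield K" and i: "i \<in> I"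
  shows "poly_function K I (\<lambda>c. c i)"
proof -
  have "(1 :: 'a) \<in> K" using K by (simp add: is_subfield_def)
  then show ?thesis
    unfolding poly_function_def using i
    by (intro bexI[of _ "Poly_Mapping.single (Poly_Mapping.single i 1) 1"])
      (auto simp: multipoly_eval_single monomial_eval_def intro!: multipoly_over_single K)
qed

lemma poly_function_diff:
  assumes K: "is_subfield K" and "poly_function K I \<phi>" "poly_function K I \<psi>"
  shows "poly_function K I (\<lambda>c. \<phi> c - \<psi> c)"
proof -
  have "- 1 \<in> K" using K unfolding is_subfield_def by blast
  then have "poly_function K I (\<lambda>c. \<phi> c + (- 1) * \<psi> c)"
    using assms by (intro poly_function_add poly_function_mult poly_function_const)
  then show ?thesis by simp
qed

lemma poly_function_sum:
  assumes K: "is_subfield K" and "\<And>i. i \<in> A \<Longrightarrow> poly_function K I (\<phi> i)"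
  shows "poly_function K I (\<lambda>c. \<Sum>i\<in>A. \<phi> i c)"
  using assms(2)
proof (induction A rule: infinite_finite_induct)
  case (insert a A)
  then show ?case by (auto intro: poly_function_add[OF K])
qed (use poly_function_const[OF K, of 0] K in \<open>auto simp: is_subfield_def\<close>)

lemma poly_function_power:
  assumes K: "is_subfield K" and "poly_function K I \<phi>"
  shows "poly_function K I (\<lambda>c. \<phi> c ^ n)"
proof (induction n)
  case 0
  then show ?case using poly_function_const[OF K, of 1] K by (simp add: is_subfield_def)
next
  case (Suc n)
  then show ?case using assms by (auto intro: poly_function_mult)
qed

lemma of_nat_in_subfield: "is_subfield K \<Longrightarrow> of_nat n \<in> K"
  by (induction n) (auto simp: is_subfield_def)

lemma power_in_subfield: "is_subfield K \<Longrightarrow> a \<in> K \<Longrightarrow> a ^ n \<in> K"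
  by (induction n) (auto simp: is_subfield_def)

lemma is_subfield_adjoin: "is_subfield (adjoin K a)"
  unfolding adjoin_def by (rule hull_in) (simp add: is_subfield_def)

lemma in_adjoin: "a \<in> adjoin K a"
  unfolding adjoin_def by (rule hull_inc) simp

definition polynomial_fps :: "'k::field set \<Rightarrow> nat set \<Rightarrow> ((nat \<Rightarrow> 'k) \<Rightarrow> 'k fps) \<Rightarrow> bool" where
  "polynomial_fps K I \<Phi> \<longleftrightarrow> (\<forall>n. poly_function K I (\<lambda>c. \<Phi> c $ n))"

lemma polynomial_fps_mult:
  assumes K: "is_subfield K" and "polynomial_fps K I \<Phi>" "polynomial_fps K I \<Psi>"
  shows "polynomial_fps K I (\<lambda>c. \<Phi> c * \<Psi> c)"
  using assms(2,3) unfolding polynomial_fps_def fps_mult_nth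
  by (intro allI poly_function_sum poly_function_mult K) auto

lemma polynomial_fps_power:
  assumes K: "is_subfield K" and "polynomial_fps K I \<Phi>"
  shows "polynomial_fps K I (\<lambda>c. \<Phi> c ^ n)"
proof (induction n)
  case 0
  have "0 \<in> K" "1 \<in> K" using K by (auto simp: is_subfield_def)
  then show ?case
    using poly_function_const[OF K] by (auto simp: polynomial_fps_def)
next
  case (Suc n)
  then show ?case using assms by (auto intro: polynomial_fps_mult)
qed

lemma polynomial_fps_compose:
  assumes K: "is_subfield K" and "polynomial_fps K I \<Phi>" "polynomial_fps K I \<Psi>"
  shows "polynomial_fps K I (\<lambda>c. \<Phi> c oo \<Psi> c)"
  unfolding polynomial_fps_def fps_compose_nth
proof (intro allI poly_function_sum poly_function_mult K)
  fix n i
  show "poly_function K I (\<lambda>c. \<Phi> c $ i)"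
    using assms by (simp add: polynomial_fps_def)
  show "poly_function K I (\<lambda>c. (\<Psi> c ^ i) $ n)"
    using polynomial_fps_power[OF K assms(3)] by (simp add: polynomial_fps_def)
qed

lemma polynomial_fps_add_monom:
  assumes K: "is_subfield K" and "polynomial_fps K I \<Phi>" "poly_function K I \<phi>"
  shows "polynomial_fps K I (\<lambda>c. \<Phi> c + fps_const (\<phi> c) * fps_X ^ m)"
  unfolding polynomial_fps_def
proof
  fix n
  have "0 \<in> K" using K by (simp add: is_subfield_def)
  then show "poly_function K I (\<lambda>c. (\<Phi> c + fps_const (\<phi> c) * fps_X ^ m) $ n)"
    using assms poly_function_add[OF K]
    by (cases "n = m") (auto simp: polynomial_fps_def fps_X_power_nth)
qed

text \<open>Cutting off above degree L + 1 makes every coefficient depend only on c 1, ..., c L. For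
  L = 2q this agrees with the full series modulo X^(2q+2).\<close>

definition truncated_series :: "'k::field \<Rightarrow> nat \<Rightarrow> (nat \<Rightarrow> 'k) \<Rightarrow> 'k fps" where
  "truncated_series \<gamma> L c =
     Abs_fps (\<lambda>n. if n = 0 then 0 else if n = 1 then \<gamma> else if n \<le> L + 1 then \<gamma> * c (n - 1) else 0)"

lemma polynomial_fps_truncated_series:
  assumes K: "is_subfield K" and \<gamma>: "\<gamma> \<in> K"
  shows "polynomial_fps K {1..L} (truncated_series \<gamma> L)"
  unfolding polynomial_fps_def
proof
  fix n
  have "0 \<in> K" using K by (simp add: is_subfield_def)
  note const = poly_function_const[OF K this] poly_function_const[OF K \<gamma>]
  consider "n = 0" | "n = 1" | "2 \<le> n" "n \<le> L + 1" | "L + 1 < n" "n \<noteq> 0" "n \<noteq> 1" by linarith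
  then show "poly_function K {1..L} (\<lambda>c. truncated_series \<gamma> L c $ n)"
  proof cases
    case 3
    have "poly_function K {1..L} (\<lambda>c. \<gamma> * c (n - 1))"
      using 3 by (intro poly_function_mult poly_function_var const K) auto
    then show ?thesis using 3 by (simp add: truncated_series_def)
  qed (simp_all add: truncated_series_def const)
qed

section \<open>Construction of the conjugacy and the normal form\<close>

lemma fps_compose_add_monom_right:
  fixes F H :: "'k::field fps"
  assumes "H $ 0 = 0" "1 \<le> n"
  shows "fps_X ^ (n + 1) dvd
    (F oo (H + fps_const t * fps_X ^ n)) - (F oo H) - fps_const (F $ 1 * t) * fps_X ^ n"
proof -
  have "fps_X ^ n dvd (H + fps_const t * fps_X ^ n) - H" by simp
  from X_power_dvd_compose_perturb[OF this, of F] show ?thesis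
    using assms by (simp add: fps_X_power_nth mult.assoc[symmetric])
qed

text \<open>Together with the preceding lemma this is the linearised conjugacy equation: adding t
  X^n to H changes the defect in degree n by (\<gamma> - \<gamma>^n) t.\<close>

lemma fps_compose_add_monom_left:
  fixes N H :: "'k::field fps"
  assumes N: "N $ 0 = 0" "N $ 1 = \<gamma>" and n: "1 \<le> n"
  shows "fps_X ^ (n + 1) dvd
    ((H + fps_const t * fps_X ^ n) oo N) - (H oo N) - fps_const (\<gamma> ^ n * t) * fps_X ^ n"
proof -
  have "fps_X ^ 2 dvd N - fps_const \<gamma> * fps_X"
    unfolding X_power_dvd_iff using N by (auto simp: less_2_cases_iff)
  then have "fps_X ^ (2 + n - 1) dvd N ^ n - (fps_const \<gamma> * fps_X) ^ n"
    by (rule X_power_dvd_power_diff) (use N n in auto)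
  then have "fps_X ^ (n + 1) dvd fps_const t * (N ^ n - (fps_const \<gamma> * fps_X) ^ n)"
    by (intro dvd_mult) simp
  moreover have "((H + fps_const t * fps_X ^ n) oo N) - (H oo N) - fps_const (\<gamma> ^ n * t) * fps_X ^ n
     = fps_const t * (N ^ n - (fps_const \<gamma> * fps_X) ^ n)"
    by (simp add: fps_compose_add_distrib fps_compose_mult_distrib N fps_compose_power[symmetric]
        power_mult_distrib fps_const_power algebra_simps flip: fps_const_mult)
  ultimately show ?thesis by simp
qed

text \<open>The last clause records that a series already in normal form is left unchanged. It
  allows the resulting polynomials to be evaluated at explicit series and thereby shown to be
  nonzero.\<close>

definition normal_form_upto ::
    "'k::field \<Rightarrow> nat \<Rightarrow> nat \<Rightarrow> (nat \<Rightarrow> 'k) \<Rightarrow> 'k fps \<Rightarrow> 'k fps \<Rightarrow> 'k fps \<Rightarrow> bool" where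
  "normal_form_upto \<gamma> q m c F H N \<longleftrightarrow>
     H $ 0 = 0 \<and> H $ 1 = 1 \<and> N $ 0 = 0 \<and> N $ 1 = \<gamma> \<and>
     fps_X ^ (m + 2) dvd (F oo H) - (H oo N) \<and>
     (\<forall>i. \<not> q dvd i \<longrightarrow> N $ (i + 1) = 0) \<and> (\<forall>i>m + 1. N $ i = 0) \<and>
     ((\<forall>i. \<not> q dvd i \<longrightarrow> c i = 0) \<longrightarrow> H = fps_X \<and> (\<forall>i\<le>m + 1. N $ i = F $ i))"

text \<open>The conjugacy \<open>H\<close> and the normal form \<open>N\<close> are solved for degree by degree: a coefficient of
  degree \<open>n\<close> of the defect is absorbed by \<open>N\<close> if \<open>q\<close> divides \<open>n - 1\<close>, and otherwise by \<open>H\<close>, where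
  the divisor \<open>\<gamma> ^ n - \<gamma>\<close> does not depend on \<open>c\<close>.\<close>

lemma exists_polynomial_normal_form:
  fixes \<gamma> :: "'k::field" and L :: nat
  assumes K: "is_subfield K" and \<gamma>: "\<gamma> \<in> K" "\<gamma> \<noteq> 0" "\<And>i. \<not> q dvd i \<Longrightarrow> \<gamma> ^ i \<noteq> 1"
  defines "F \<equiv> truncated_series \<gamma> L"
  shows "\<exists>H N. polynomial_fps K {1..L} H \<and> polynomial_fps K {1..L} N \<and>
     (\<forall>c. normal_form_upto \<gamma> q m c (F c) (H c) (N c))"
  unfolding normal_form_upto_def
proof (induction m)
  case 0
  have 01: "0 \<in> K" "1 \<in> K" using K by (auto simp: is_subfield_def)
  have "polynomial_fps K {1..L} (\<lambda>_. fps_X)"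
    unfolding polynomial_fps_def using poly_function_const[OF K] 01 by auto
  moreover have "polynomial_fps K {1..L} (\<lambda>_. fps_const \<gamma> * fps_X)"
    unfolding polynomial_fps_def using poly_function_const[OF K] 01 \<gamma> by auto
  moreover have "fps_X ^ 2 dvd F c - fps_const \<gamma> * fps_X" for c
    unfolding X_power_dvd_iff by (auto simp: F_def truncated_series_def less_2_cases_iff)
  ultimately show ?case
    by (intro exI[of _ "\<lambda>_. fps_X"] exI[of _ "\<lambda>_. fps_const \<gamma> * fps_X"])
      (auto simp: F_def truncated_series_def le_Suc_eq numeral_2_eq_2 gr0_conv_Suc)
next
  case (Suc m)
  then obtain H N where PH: "polynomial_fps K {1..L} H" and PN: "polynomial_fps K {1..L} N"
    and H: "\<And>c. H c $ 0 = 0" "\<And>c. H c $ 1 = 1" and N: "\<And>c. N c $ 0 = 0" "\<And>c. N c $ 1 = \<gamma>"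
    and conj: "\<And>c. fps_X ^ (m + 2) dvd (F c oo H c) - (H c oo N c)"
    and Nq: "\<And>c i. \<not> q dvd i \<Longrightarrow> N c $ (i + 1) = 0" and Nm: "\<And>c i. i > m + 1 \<Longrightarrow> N c $ i = 0"
    and special: "\<And>c. (\<forall>i. \<not> q dvd i \<longrightarrow> c i = 0) \<Longrightarrow> H c = fps_X \<and> (\<forall>i\<le>m + 1. N c $ i = F c $ i)"
    by metis
  define n where "n = m + 2"
  have n: "1 \<le> n" "n \<noteq> 1" "n \<noteq> 0" "n - 1 = m + 1" by (simp_all add: n_def)
  have F: "F c $ 0 = 0" "F c $ 1 = \<gamma>" for c by (simp_all add: F_def truncated_series_def)
  define D where "D c = ((F c oo H c) - (H c oo N c)) $ n" for c
  have PF: "polynomial_fps K {1..L} F"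
    unfolding F_def by (rule polynomial_fps_truncated_series[OF K \<gamma>(1)])
  have PD: "poly_function K {1..L} D"
    unfolding D_def using polynomial_fps_compose[OF K PF PH] polynomial_fps_compose[OF K PH PN]
    by (auto simp: polynomial_fps_def intro: poly_function_diff[OF K])
  have conjD: "fps_X ^ (n + 1) dvd (F c oo H c) - (H c oo N c) - fps_const (D c) * fps_X ^ n" for c
    unfolding X_power_dvd_iff
  proof (intro allI impI)
    fix i assume "i < n + 1"
    then consider "i < n" | "i = n" by linarith
    then show "((F c oo H c) - (H c oo N c) - fps_const (D c) * fps_X ^ n) $ i = 0"
    proof cases
      case 1
      then have "((F c oo H c) - (H c oo N c)) $ i = 0"
        using conj[of c] unfolding X_power_dvd_iff n_def by blast
      then show ?thesis using 1 by (simp add: fps_X_power_nth)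
    next
      case 2
      then show ?thesis using D_def[of c] by (simp add: fps_X_power_nth)
    qed
  qed
  \<comment> \<open>Here H = X and N has no term of degree n yet, so the defect is the coefficient
    of F.\<close>
  have spD: "D c = F c $ n" if c: "\<forall>i. \<not> q dvd i \<longrightarrow> c i = 0" for c
    using special[OF c] Nm[of n c] N by (simp add: D_def n_def)
  show ?case
  proof (cases "q dvd m + 1")
    case True
    define N' where "N' c = N c + fps_const (D c) * fps_X ^ n" for c
    have "polynomial_fps K {1..L} N'"
      unfolding N'_def by (rule polynomial_fps_add_monom[OF K PN PD])
    moreover have "N' c $ 0 = 0" "N' c $ 1 = \<gamma>" for c
      using N n by (simp_all add: N'_def fps_X_power_nth)
    moreover have "fps_X ^ (Suc m + 2) dvd (F c oo H c) - (H c oo N' c)" for c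
    proof -
      have "fps_X ^ (n + 1) dvd ((F c oo H c) - (H c oo N c) - fps_const (D c) * fps_X ^ n)
          - ((H c oo N' c) - (H c oo N c) - fps_const (H c $ 1 * D c) * fps_X ^ n)"
        unfolding N'_def by (rule dvd_diff[OF conjD fps_compose_add_monom_right[OF N(1) n(1)]])
      then show ?thesis using H(2) by (simp add: n_def)
    qed
    moreover have "N' c $ (i + 1) = 0" if "\<not> q dvd i" for c i
    proof -
      have "i \<noteq> m + 1" using that True by auto
      then have "i + 1 \<noteq> n" by (simp add: n_def)
      then show ?thesis using Nq[OF that] by (simp add: N'_def fps_X_power_nth)
    qed
    moreover have "N' c $ i = 0" if "i > Suc m + 1" for c i
      using that Nm[of i c] by (simp add: N'_def fps_X_power_nth n_def)
    moreover have "N' c $ i = F c $ i" if c: "\<forall>i. \<not> q dvd i \<longrightarrow> c i = 0" and i: "i \<le> Suc m + 1" for c i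
    proof (cases "i = n")
      case True
      then show ?thesis using spD[OF c] Nm[of n c] by (simp add: N'_def fps_X_power_nth n_def)
    next
      case False
      then have "N' c $ i = N c $ i" "i \<le> m + 1"
        using i by (simp add: N'_def fps_X_power_nth, simp add: n_def)
      then show ?thesis using special[OF c] by simp
    qed
    ultimately show ?thesis
      using PH H special by (intro exI[of _ H] exI[of _ N']) blast
  next
    case False
    \<comment> \<open>Dividing by \<gamma>^n - \<gamma> is multiplication by a constant of
      \<open>K\<close>, so the correction is still polynomial in c.\<close>
    define u where "u = inverse (\<gamma> ^ n - \<gamma>)"
    have "\<gamma> ^ n - \<gamma> = \<gamma> * (\<gamma> ^ (m + 1) - 1)"
      by (simp add: n_def algebra_simps)
    then have ne: "\<gamma> ^ n - \<gamma> \<noteq> 0" using \<gamma>(2) \<gamma>(3)[OF False] by simp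
    have "\<gamma> ^ n + (- \<gamma>) \<in> K"
      using K \<gamma>(1) power_in_subfield[OF K \<gamma>(1), of n] unfolding is_subfield_def by blast
    then have "u \<in> K"
      using K unfolding is_subfield_def u_def by simp
    define t where "t c = u * D c" for c
    have Pt: "poly_function K {1..L} t"
      unfolding t_def by (intro poly_function_mult poly_function_const K PD \<open>u \<in> K\<close>)
    define H' where "H' c = H c + fps_const (t c) * fps_X ^ n" for c
    have "polynomial_fps K {1..L} H'"
      unfolding H'_def by (rule polynomial_fps_add_monom[OF K PH Pt])
    moreover have "H' c $ 0 = 0" "H' c $ 1 = 1" for c
      using H n by (simp_all add: H'_def fps_X_power_nth)
    moreover have "fps_X ^ (Suc m + 2) dvd (F c oo H' c) - (H' c oo N c)" for c
    proof -
      have "D c = (\<gamma> ^ n - \<gamma>) * t c" using ne by (simp add: t_def u_def)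
      then have D: "fps_const (D c) = fps_const (\<gamma> ^ n * t c) - fps_const (\<gamma> * t c)"
        by (simp add: left_diff_distrib)
      have "fps_X ^ (n + 1) dvd ((F c oo H c) - (H c oo N c) - fps_const (D c) * fps_X ^ n)
          + ((F c oo H' c) - (F c oo H c) - fps_const (F c $ 1 * t c) * fps_X ^ n)
          - ((H' c oo N c) - (H c oo N c) - fps_const (\<gamma> ^ n * t c) * fps_X ^ n)"
        unfolding H'_def
        by (rule dvd_diff[OF dvd_add[OF conjD fps_compose_add_monom_right[OF H(1) n(1)]]
            fps_compose_add_monom_left[OF N n(1)]])
      also have "\<dots> = (F c oo H' c) - (H' c oo N c)"
        unfolding F(2) D by (simp add: algebra_simps del: fps_const_sub fps_const_mult)
      finally show ?thesis by (simp add: n_def)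
    qed
    moreover have "N c $ i = 0" if "i > Suc m + 1" for c i
      using that Nm[of i c] by simp
    moreover have "H' c = fps_X \<and> (\<forall>i\<le>Suc m + 1. N c $ i = F c $ i)"
      if c: "\<forall>i. \<not> q dvd i \<longrightarrow> c i = 0" for c
    proof -
      have "F c $ n = 0"
        using c False n by (simp add: F_def truncated_series_def)
      then have "N c $ n = F c $ n" "t c = 0"
        using Nm[of n c] spD[OF c] by (simp_all add: n_def t_def)
      then show ?thesis
        using special[OF c] by (auto simp: H'_def n_def le_Suc_eq)
    qed
    ultimately show ?thesis
      using PN N Nq by (intro exI[of _ H'] exI[of _ N]) blast
  qed
qed

text \<open>H conjugates the truncation F to N only modulo X^(2q+2). The exact conjugate
  \<open>N0\<close> of G by H agrees with N to this precision, which is all that the criterion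
  reads.\<close>

lemma minimally_ramified_iff_normal_form:
  fixes F G H N :: "'k::field fps"
  assumes p: "prime p" "CHAR('k) = p" and q: "q = unity_order \<gamma>" and \<gamma>: "root_of_unity \<gamma>"
    and G: "G $ 0 = 0" and FG: "fps_X ^ (2 * q + 2) dvd G - F"
    and H: "H $ 0 = 0" "H $ 1 = 1" and N: "N $ 0 = 0" "N $ 1 = \<gamma>"
    and conj: "fps_X ^ (2 * q + 2) dvd (F oo H) - (H oo N)"
    and Nq: "\<And>i. \<not> q dvd i \<Longrightarrow> N $ (i + 1) = 0"
  defines "\<alpha> \<equiv> N $ (q + 1) / \<gamma>" and "\<beta> \<equiv> N $ (2 * q + 1) / \<gamma>"
  defines "A \<equiv> of_nat q * (of_nat q * \<alpha>)"
    and "\<rho> \<equiv> of_nat q * ((of_nat q * \<alpha>)\<^sup>2 - (of_nat q * \<beta> + of_nat (q choose 2) * \<alpha>\<^sup>2))"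
  shows "minimally_ramified p G \<longleftrightarrow> A \<noteq> 0 \<and> \<rho> \<noteq> 0 \<and> of_nat (p choose 2) * A\<^sup>2 + \<rho> \<noteq> 0"
proof -
  have q1: "1 \<le> q" "\<gamma> ^ q = 1" unfolding q using unity_order[OF \<gamma>] by auto
  then have \<gamma>0: "\<gamma> \<noteq> 0" by (metis one_neq_zero power_0_left not_one_le_zero)
  define N0 where "N0 = (fps_inv H oo (G oo H))"
  have inv0: "fps_inv H $ 0 = 0" by (simp add: fps_inv_def)
  have N0: "N0 $ 0 = 0" by (simp add: N0_def inv0)
  have HN0: "G oo H = H oo N0"
    using H G by (simp add: N0_def fps_compose_assoc inv0 fps_inv_right)
  have "fps_X ^ (2 * q + 2) dvd (G - F) oo H"
  proof -
    obtain R where "G - F = fps_X ^ (2 * q + 2) * R" using FG by (rule dvdE)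
    then have "(G - F) oo H = H ^ (2 * q + 2) * (R oo H)"
      using H by (simp add: fps_compose_mult_distrib fps_compose_power[symmetric] del: power_Suc)
    moreover have "fps_X dvd H"
      using X_power_dvd_iff[of 1 H] H by simp
    then have "fps_X ^ (2 * q + 2) dvd H ^ (2 * q + 2)" by (rule dvd_power_same)
    ultimately show ?thesis by simp
  qed
  from dvd_add[OF this conj]
  have "fps_X ^ (2 * q + 2) dvd (H oo N0) - (H oo N)"
    by (simp add: fps_compose_sub_distrib HN0)
  from X_power_dvd_compose_diff[OF this _ _ order_refl, of "fps_inv H"]
  have "fps_X ^ (2 * q + 2) dvd (fps_inv H oo (H oo N0)) - (fps_inv H oo (H oo N))"
    using H by simp
  moreover have "fps_inv H oo (H oo M) = M" if "M $ 0 = 0" for M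
    using H that by (simp add: fps_compose_assoc fps_inv)
  ultimately have "fps_X ^ (2 * q + 2) dvd N0 - N"
    using N0 N by simp
  moreover have "fps_X ^ (2 * q + 2) dvd
      N - fps_const \<gamma> * fps_X * (1 + fps_const \<alpha> * fps_X ^ q + fps_const \<beta> * (fps_X ^ q)\<^sup>2)"
    unfolding X_power_dvd_iff
  proof (intro allI impI)
    fix i assume i: "i < 2 * q + 2"
    have rhs: "(fps_const \<gamma> * fps_X * (1 + fps_const \<alpha> * fps_X ^ q + fps_const \<beta> * (fps_X ^ q)\<^sup>2)) $ i
      = (if i = 0 then 0 else \<gamma> * ((if i - 1 = 0 then 1 else 0) + \<alpha> * (if i - 1 = q then 1 else 0)
          + \<beta> * (if i - 1 = 2 * q then 1 else 0)))"
      by (simp add: mult.assoc fps_X_power_nth power_mult[symmetric] mult.commute[of q])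
    show "(N - fps_const \<gamma> * fps_X * (1 + fps_const \<alpha> * fps_X ^ q + fps_const \<beta> * (fps_X ^ q)\<^sup>2)) $ i = 0"
    proof (cases i)
      case 0
      then show ?thesis using N by simp
    next
      case (Suc j)
      show ?thesis
      proof (cases "q dvd j")
        case True
        then obtain k where k: "j = q * k" by (rule dvdE)
        have "q * k < q * 3" using i q1 unfolding Suc k by linarith
        then have "k < 3" by simp
        then have "k = 0 \<or> k = 1 \<or> k = 2" by linarith
        then show ?thesis
          using N q1 \<gamma>0 unfolding fps_sub_nth rhs unfolding Suc k \<alpha>_def \<beta>_def
          by (auto simp: mult.commute[of q])
      next
        case False
        then have "j \<noteq> 0" "j \<noteq> q" "j \<noteq> 2 * q"
          by (metis dvd_0_right, metis dvd_refl, metis dvd_triv_right)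
        then show ?thesis
          using Nq[OF False] unfolding fps_sub_nth rhs unfolding Suc by simp
      qed
    qed
  qed
  ultimately have "fps_X ^ (2 * q + 2) dvd (N0 - N) +
      (N - fps_const \<gamma> * fps_X * (1 + fps_const \<alpha> * fps_X ^ q + fps_const \<beta> * (fps_X ^ q)\<^sup>2))"
    by (rule dvd_add)
  then have N0N: "fps_X ^ (2 * q + 2) dvd
      N0 - fps_const \<gamma> * fps_X * (1 + fps_const \<alpha> * fps_X ^ q + fps_const \<beta> * (fps_X ^ q)\<^sup>2)"
    by (simp only: diff_add_cancel add_diff_eq)
  have "(of_nat q :: 'k) \<noteq> 0"
    unfolding q by (rule unity_order_nonzero_in_field[OF p \<gamma>])
  from minimally_ramified_normal_form_iff[OF p q1(1) this \<gamma> q N0N]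
  have "minimally_ramified p N0 \<longleftrightarrow> A \<noteq> 0 \<and> \<rho> \<noteq> 0 \<and> of_nat (p choose 2) * A\<^sup>2 + \<rho> \<noteq> 0"
    unfolding A_def \<rho>_def .
  moreover have "minimally_ramified p G \<longleftrightarrow> minimally_ramified p N0"
    using H by (intro minimally_ramified_conjugate[OF p _ _ G N0 HN0]) auto
  ultimately show ?thesis by simp
qed

theorem minimally_ramified_generic:
  fixes \<gamma> :: "'k::field"
  assumes p: "prime p" "CHAR('k) = p" and \<gamma>: "root_of_unity \<gamma>" and q: "q = unity_order \<gamma>"
  shows "\<exists>M \<in> multipoly_over (adjoin prime_field \<gamma>) {1..2 * q}. M \<noteq> 0 \<and>
     (\<forall>c. minimally_ramified p (fps_const \<gamma> * fps_X * (1 + Abs_fps (\<lambda>i. if i = 0 then 0 else c i)))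
        \<longleftrightarrow> multipoly_eval M c \<noteq> 0)"
proof -
  define K where "K = adjoin (prime_field :: 'k set) \<gamma>"
  have K: "is_subfield K" and \<gamma>K: "\<gamma> \<in> K"
    by (simp_all add: K_def is_subfield_adjoin in_adjoin)
  have q1: "1 \<le> q" "\<gamma> ^ q = 1" unfolding q using unity_order[OF \<gamma>] by auto
  then have \<gamma>0: "\<gamma> \<noteq> 0" by (metis one_neq_zero power_0_left not_one_le_zero)
  have q0: "(of_nat q :: 'k) \<noteq> 0"
    unfolding q by (rule unity_order_nonzero_in_field[OF p \<gamma>])
  have \<gamma>i: "\<gamma> ^ i \<noteq> 1" if "\<not> q dvd i" for i
  proof -
    have "\<gamma> ^ i = (\<gamma> ^ q) ^ (i div q) * \<gamma> ^ (i mod q)"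
      by (simp flip: power_mult power_add)
    moreover have "1 \<le> i mod q" "i mod q < q"
      using that q1 by (auto simp: dvd_eq_mod_eq_0)
    then have "\<gamma> ^ (i mod q) \<noteq> 1"
      unfolding q by (rule unity_order(3)[OF \<gamma>])
    ultimately show ?thesis using q1 by simp
  qed
  define I F where "I = {1..2 * q}" and "F = truncated_series \<gamma> (2 * q)"
  have "\<exists>H N. polynomial_fps K I H \<and> polynomial_fps K I N \<and>
      (\<forall>c. normal_form_upto \<gamma> q (2 * q) c (F c) (H c) (N c))"
    unfolding I_def F_def by (rule exists_polynomial_normal_form[OF K \<gamma>K \<gamma>0 \<gamma>i])
  then obtain H N where PN: "polynomial_fps K I N"
    and HN: "\<forall>c. normal_form_upto \<gamma> q (2 * q) c (F c) (H c) (N c)"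
    by blast
  note HN = HN[unfolded normal_form_upto_def]
  have H: "H c $ 0 = 0" "H c $ 1 = 1" and N: "N c $ 0 = 0" "N c $ 1 = \<gamma>"
    and conj: "fps_X ^ (2 * q + 2) dvd (F c oo H c) - (H c oo N c)" for c
    using spec[OF HN, of c] by blast+
  have Nq: "N c $ (i + 1) = 0" if "\<not> q dvd i" for c i
    using spec[OF HN, of c] that by blast
  have special: "N c $ i = F c $ i" if "\<forall>i. \<not> q dvd i \<longrightarrow> c i = 0" "i \<le> 2 * q + 1" for c i
    using spec[OF HN, of c] that by blast
  define G where "G c = fps_const \<gamma> * fps_X * (1 + Abs_fps (\<lambda>i. if i = 0 then 0 else c i))" for c
  define \<alpha> \<beta> where "\<alpha> c = N c $ (q + 1) / \<gamma>" and "\<beta> c = N c $ (2 * q + 1) / \<gamma>" for c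
  define A \<rho> \<sigma> where "A c = of_nat q * (of_nat q * \<alpha> c)"
    and "\<rho> c = of_nat q * ((of_nat q * \<alpha> c)\<^sup>2 - (of_nat q * \<beta> c + of_nat (q choose 2) * (\<alpha> c)\<^sup>2))"
    and "\<sigma> c = of_nat (p choose 2) * (A c)\<^sup>2 + \<rho> c" for c
  have iff: "minimally_ramified p (G c) \<longleftrightarrow> A c \<noteq> 0 \<and> \<rho> c \<noteq> 0 \<and> \<sigma> c \<noteq> 0" for c
  proof -
    have GF: "fps_X ^ (2 * q + 2) dvd G c - F c"
      unfolding X_power_dvd_iff
      by (auto simp: G_def F_def truncated_series_def mult.assoc)
    have G0: "G c $ 0 = 0" by (simp add: G_def mult.assoc)
    show ?thesis
      unfolding A_def \<rho>_def \<sigma>_def \<alpha>_def \<beta>_def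
      by (rule minimally_ramified_iff_normal_form[OF p q \<gamma> G0 GF H N conj Nq])
  qed
  note K_intros = poly_function_mult poly_function_add poly_function_diff
    poly_function_power poly_function_const of_nat_in_subfield K
  have "inverse \<gamma> \<in> K" using K \<gamma>K by (simp add: is_subfield_def)
  then have P\<alpha>: "poly_function K I \<alpha>" and P\<beta>: "poly_function K I \<beta>"
    unfolding \<alpha>_def \<beta>_def divide_inverse
    using PN unfolding polynomial_fps_def
    by (intro poly_function_mult poly_function_const K; simp)+
  have PA: "poly_function K I A"
    unfolding A_def by (intro K_intros P\<alpha>)
  have P\<rho>: "poly_function K I \<rho>"
    unfolding \<rho>_def by (intro K_intros P\<alpha> P\<beta>)
  have P\<sigma>: "poly_function K I \<sigma>"
    unfolding \<sigma>_def by (intro K_intros PA P\<rho>)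
  obtain MA M\<rho> M\<sigma> where MA: "MA \<in> multipoly_over K I" "\<And>c. multipoly_eval MA c = A c"
    and M\<rho>: "M\<rho> \<in> multipoly_over K I" "\<And>c. multipoly_eval M\<rho> c = \<rho> c"
    and M\<sigma>: "M\<sigma> \<in> multipoly_over K I" "\<And>c. multipoly_eval M\<sigma> c = \<sigma> c"
    using PA P\<rho> P\<sigma> unfolding poly_function_def by blast
  \<comment> \<open>The test series are \<gamma> X (1 + X^q), where A = q^2, and \<gamma> X (1 +
    X^(2q)), where A = 0 and \<rho> = \<sigma> = -q^2.\<close>
  define c1 c2 where "c1 i = (if i = q then 1 else 0 :: 'k)" and "c2 i = (if i = 2 * q then 1 else 0 :: 'k)" for i
  have "N c1 $ (q + 1) = F c1 $ (q + 1)"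
    by (rule special) (auto simp: c1_def)
  then have "A c1 \<noteq> 0"
    using q0 q1 \<gamma>0 by (simp add: A_def \<alpha>_def F_def truncated_series_def c1_def)
  then have "MA \<noteq> 0" using MA(2)[of c1] by auto
  have "N c2 $ (q + 1) = F c2 $ (q + 1)" "N c2 $ (2 * q + 1) = F c2 $ (2 * q + 1)"
    by (rule special; auto simp: c2_def)+
  then have "\<alpha> c2 = 0" "\<beta> c2 = 1"
    using q1 \<gamma>0 by (simp_all add: \<alpha>_def \<beta>_def F_def truncated_series_def c2_def)
  then have "\<rho> c2 \<noteq> 0" "\<sigma> c2 \<noteq> 0"
    using q0 by (simp_all add: \<sigma>_def \<rho>_def A_def)
  then have "M\<rho> \<noteq> 0" "M\<sigma> \<noteq> 0" using M\<rho>(2)[of c2] M\<sigma>(2)[of c2] by auto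
  show ?thesis
  proof (intro bexI conjI allI)
    \<comment> \<open>The factors are shown nonzero separately and multiplied in an integral domain.
      A common test point may be missing: over the field with two elements with q = 1, the three
      values are \<alpha>, \<alpha>^2 - \<beta> and -\<beta>, and they are never all
      nonzero.\<close>
    show "MA * M\<rho> * M\<sigma> \<noteq> 0"
      using \<open>MA \<noteq> 0\<close> \<open>M\<rho> \<noteq> 0\<close> \<open>M\<sigma> \<noteq> 0\<close> by simp
    show "MA * M\<rho> * M\<sigma> \<in> multipoly_over (adjoin prime_field \<gamma>) {1..2 * q}"
      using MA(1) M\<rho>(1) M\<sigma>(1) K unfolding K_def I_def by (intro multipoly_over_mult)
    show "minimally_ramified p (fps_const \<gamma> * fps_X * (1 + Abs_fps (\<lambda>i. if i = 0 then 0 else c i)))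
        \<longleftrightarrow> multipoly_eval (MA * M\<rho> * M\<sigma>) c \<noteq> 0" for c
      using iff[of c] by (simp add: G_def multipoly_eval_mult MA(2) M\<rho>(2) M\<sigma>(2))
  qed
qed

theorem mainTheorem1:
  fixes p :: nat
    and absv :: "'k::field \<Rightarrow> real"
  assumes "prime p"
    and "ultrametric_field absv"
    and "CHAR('k) = p"
  shows "(\<forall>(U :: 'k set) f \<zeta>0 n F.
            analytic_map absv U f \<and>
            periodic_point U f \<zeta>0 \<and>
            n = minimal_period U f \<zeta>0 \<and>
            has_expansion_at_0 absv (\<lambda>x. (f ^^ n) (x + \<zeta>0) - \<zeta>0) F \<and>
            root_of_unity (multiplier F) \<and>
            minimally_ramified p F
            \<longrightarrow> isolated_periodic_point absv U f \<zeta>0) \<and>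
         (\<forall>(\<gamma> :: 'k) q.
            root_of_unity \<gamma> \<and> q = unity_order \<gamma>
            \<longrightarrow> (\<exists>M \<in> multipoly_over (adjoin prime_field \<gamma>) {1..2 * q}.
                  M \<noteq> 0 \<and>
                  (\<forall>c :: nat \<Rightarrow> 'k.
                     minimally_ramified p
                       (fps_const \<gamma> * fps_X * (1 + Abs_fps (\<lambda>i. if i = 0 then 0 else c i)))
                     \<longleftrightarrow> multipoly_eval M c \<noteq> 0)))"
proof (intro conjI allI impI; elim conjE)
  fix U :: "'k set" and f \<zeta>0 n F
  assume "periodic_point U f \<zeta>0" "has_expansion_at_0 absv (\<lambda>x. (f ^^ n) (x + \<zeta>0) - \<zeta>0) F"
    "minimally_ramified p F"
  then show "isolated_periodic_point absv U f \<zeta>0"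
    by (rule minimally_ramified_imp_isolated_periodic_point[OF assms(1,3,2)])
next
  fix \<gamma> :: 'k and q
  assume "root_of_unity \<gamma>" "q = unity_order \<gamma>"
  then show "\<exists>M \<in> multipoly_over (adjoin prime_field \<gamma>) {1..2 * q}. M \<noteq> 0 \<and>
      (\<forall>c. minimally_ramified p (fps_const \<gamma> * fps_X * (1 + Abs_fps (\<lambda>i. if i = 0 then 0 else c i)))
        \<longleftrightarrow> multipoly_eval M c \<noteq> 0)"
    by (rule minimally_ramified_generic[OF assms(1,3)])
qed

end
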